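(* Let $K$ be a field and let $G$ be a finite simple connected bipartite graph without isolated vertices on the vertex set $V$ with bipartition $V=V_1\cup V_2$, where $|V_1|=n$ and $|V_2|=m$. Then the following conditions are equivalent: (a) $G$ is a bi-Cohen-Macaulay graph over $K$; (b) $n=m$, and the vertices can be labeled $V_1=\{v_1,\ldots,v_n\}$, $V_2=\{w_1,\ldots,w_n\}$ in such a way that $E(G)=\{\{v_i,w_j\}: 1\leq i\leq j\leq n\}$.
   Context: For a graph $G$ with vertex set $V$, let $S$ be the polynomial ring over $K$ with one variable $x_v$ for each $v\in V$. The edge ideal $I_G\subset S$ is generated by all $x_vx_w$ with $\{v,w\}\in E(G)$. For a squarefree monomial ideal $I=\bigcap_{j} P_j$ (irredundant intersection of its minimal monomial prime ideals $P_j$), the Alexander dual $I^\vee$ is the ideal generated by the monomials $\prod_{x_v\in P_j}x_v$. An ideal $I\subset S$ is called Cohen-Macaulay if $S/I$ is Cohen-Macaulay. The graph $G$ is bi-Cohen-Macaulay over $K$ if both $I_G$ and $(I_G)^\vee$ are Cohen-Macaulay ideals. Bipartition means that $V$ is the disjoint union of $V_1$ and $V_2$ and both are independent sets. *)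

theory Defs
  imports "HOL-Algebra.QuotRing" "HOL-Library.Poly_Mapping" "HOL-Library.Extended_Nat"
begin

section \<open>Krull dimension and depth\<close>

definition krull_dim :: "('a, 'b) ring_scheme \<Rightarrow> enat" where
  "krull_dim R = Sup {enat k | k. \<exists>P :: nat \<Rightarrow> 'a set.
     (\<forall>i\<le>k. primeideal (P i) R) \<and> (\<forall>i<k. P i \<subset> P (Suc i))}"

text \<open>The i-th entry has to be a nonzerodivisor on the quotient of R by the ideal generated by
  the preceding entries, and the quotient by the whole sequence has to be nonzero.\<close>

definition regular_sequence :: "('a, 'b) ring_scheme \<Rightarrow> 'a list \<Rightarrow> bool" where
  "regular_sequence R xs \<longleftrightarrow>
     set xs \<subseteq> carrier R \<and>
     (\<forall>i<length xs. \<forall>y\<in>carrier R.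
        xs ! i \<otimes>\<^bsub>R\<^esub> y \<in> Idl\<^bsub>R\<^esub> (set (take i xs)) \<longrightarrow> y \<in> Idl\<^bsub>R\<^esub> (set (take i xs))) \<and>
     Idl\<^bsub>R\<^esub> (set xs) \<noteq> carrier R"

definition depth :: "('a, 'b) ring_scheme \<Rightarrow> 'a set \<Rightarrow> enat" where
  "depth R M = Sup {enat (length xs) | xs. regular_sequence R xs \<and> set xs \<subseteq> M}"

definition minimal_prime :: "('a, 'b) ring_scheme \<Rightarrow> 'a set \<Rightarrow> 'a set \<Rightarrow> bool" where
  "minimal_prime R I P \<longleftrightarrow> primeideal P R \<and> I \<subseteq> P \<and>
     (\<forall>Q. primeideal Q R \<and> I \<subseteq> Q \<and> Q \<subseteq> P \<longrightarrow> Q = P)"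

section \<open>The polynomial ring with one variable for each vertex\<close>

text \<open>A monomial is its exponent vector, a finitely supported function on the variables; a
  polynomial is a finitely supported function from monomials to coefficients. The product of the
  type \<open>\<Rightarrow>\<^sub>0\<close> is convolution, hence polynomial multiplication.\<close>

type_synonym ('v, 'k) mpoly = "('v \<Rightarrow>\<^sub>0 nat) \<Rightarrow>\<^sub>0 'k"

definition poly_ring :: "'v set \<Rightarrow> ('v, 'k::field) mpoly ring" where
  "poly_ring V = \<lparr>carrier = {p. \<forall>t\<in>Poly_Mapping.keys p. Poly_Mapping.keys t \<subseteq> V},
                 mult = (*), one = 1, zero = 0, add = (+)\<rparr>"

lemma cring_poly_ring: "cring (poly_ring V :: ('v,'k::field) mpoly ring)"
proof -
  let ?S = "poly_ring V :: ('v,'k) mpoly ring"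
  have mem: "p \<in> carrier ?S \<longleftrightarrow> (\<forall>t\<in>Poly_Mapping.keys p. Poly_Mapping.keys t \<subseteq> V)" for p
    by (simp add: poly_ring_def)
  have ops [simp]: "x \<oplus>\<^bsub>?S\<^esub> y = x + y" "x \<otimes>\<^bsub>?S\<^esub> y = x * y" "\<zero>\<^bsub>?S\<^esub> = 0" "\<one>\<^bsub>?S\<^esub> = 1" for x y
    by (simp_all add: poly_ring_def)
  have add: "p + q \<in> carrier ?S" if "p \<in> carrier ?S" "q \<in> carrier ?S" for p q
    using that Poly_Mapping.keys_add[of p q] unfolding mem by blast
  have mul: "p * q \<in> carrier ?S" if "p \<in> carrier ?S" "q \<in> carrier ?S" for p q
    unfolding mem
  proof
    fix t assume "t \<in> Poly_Mapping.keys (p * q)"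
    then obtain a b where "t = a + b" "a \<in> Poly_Mapping.keys p" "b \<in> Poly_Mapping.keys q"
      using keys_mult[of p q] by blast
    then show "Poly_Mapping.keys t \<subseteq> V"
      using that Poly_Mapping.keys_add[of a b] unfolding mem by blast
  qed
  have neg: "- p \<in> carrier ?S" if "p \<in> carrier ?S" for p
    using that unfolding mem by simp
  have one: "1 \<in> carrier ?S" and zero: "0 \<in> carrier ?S"
    unfolding mem by auto
  have "abelian_group ?S"
  proof (rule abelian_groupI)
    show "\<exists>y\<in>carrier ?S. y \<oplus>\<^bsub>?S\<^esub> x = \<zero>\<^bsub>?S\<^esub>" if "x \<in> carrier ?S" for x
      by (rule bexI[OF _ neg[OF that]]) simp
  qed (simp_all add: add zero ac_simps)
  moreover have "comm_monoid ?S"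
    by (rule comm_monoidI) (simp_all add: mul one ac_simps)
  ultimately show ?thesis
    by (rule cringI) (simp add: distrib_right)
qed

definition var :: "'v \<Rightarrow> ('v, 'k::field) mpoly" where
  "var v = Poly_Mapping.single (Poly_Mapping.single v 1) 1"

definition irrelevant_ideal :: "'v set \<Rightarrow> ('v, 'k::field) mpoly set" where
  "irrelevant_ideal V = Idl\<^bsub>poly_ring V\<^esub> (var ` V)"

text \<open>The definition of Cohen-Macaulayness for a graded quotient \<open>S/I\<close> of the polynomial ring
  \<open>S\<close>: the depth with respect to the graded maximal ideal of \<open>S/I\<close> (the image of the ideal
  generated by the variables) equals the Krull dimension. It is meant for proper homogeneous
  ideals \<open>I\<close>; edge ideals and their Alexander duals are monomial ideals.\<close>

definition cohen_macaulay_ideal :: "'v set \<Rightarrow> ('v, 'k::field) mpoly set \<Rightarrow> bool" where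
  "cohen_macaulay_ideal V I \<longleftrightarrow>
     depth (poly_ring V Quot I) ((\<lambda>p. I +>\<^bsub>poly_ring V\<^esub> p) ` irrelevant_ideal V) =
     krull_dim (poly_ring V Quot I)"

text \<open>For a squarefree monomial ideal \<open>I\<close> the minimal primes are generated by variables, and
  \<open>I\<close> is their irredundant intersection; these are the components \<open>P\<^sub>j\<close> in the definition of the
  Alexander dual.\<close>

definition alexander_dual :: "'v set \<Rightarrow> ('v, 'k::field) mpoly set \<Rightarrow> ('v, 'k) mpoly set" where
  "alexander_dual V I = Idl\<^bsub>poly_ring V\<^esub>
     {\<Prod>v\<in>{v\<in>V. var v \<in> P}. var v | P. minimal_prime (poly_ring V) I P}"

section \<open>Graphs\<close>

definition simple_graph :: "'v set \<Rightarrow> 'v set set \<Rightarrow> bool" where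
  "simple_graph V E \<longleftrightarrow> (\<forall>e\<in>E. e \<subseteq> V \<and> card e = 2)"

definition connected_graph :: "'v set \<Rightarrow> 'v set set \<Rightarrow> bool" where
  "connected_graph V E \<longleftrightarrow> V \<noteq> {} \<and> (\<forall>u\<in>V. \<forall>v\<in>V. (u, v) \<in> {(x, y). {x, y} \<in> E}\<^sup>*)"

definition no_isolated_vertices :: "'v set \<Rightarrow> 'v set set \<Rightarrow> bool" where
  "no_isolated_vertices V E \<longleftrightarrow> (\<forall>v\<in>V. \<exists>e\<in>E. v \<in> e)"

definition independent_set :: "'v set set \<Rightarrow> 'v set \<Rightarrow> bool" where
  "independent_set E A \<longleftrightarrow> (\<forall>e\<in>E. \<not> e \<subseteq> A)"

definition bipartition :: "'v set \<Rightarrow> 'v set set \<Rightarrow> 'v set \<Rightarrow> 'v set \<Rightarrow> bool" where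
  "bipartition V E V1 V2 \<longleftrightarrow> V = V1 \<union> V2 \<and> V1 \<inter> V2 = {} \<and>
     independent_set E V1 \<and> independent_set E V2"

definition edge_ideal :: "'v set \<Rightarrow> 'v set set \<Rightarrow> ('v, 'k::field) mpoly set" where
  "edge_ideal V E = Idl\<^bsub>poly_ring V\<^esub> {var v * var w | v w. {v, w} \<in> E}"

text \<open>The field enters only through the type of the coefficients, so it is passed as a type
  argument.\<close>

definition bi_cohen_macaulay :: "'k::field itself \<Rightarrow> 'v set \<Rightarrow> 'v set set \<Rightarrow> bool" where
  "bi_cohen_macaulay K V E \<longleftrightarrow>
     cohen_macaulay_ideal V (edge_ideal V E :: ('v, 'k) mpoly set) \<and>
     cohen_macaulay_ideal V (alexander_dual V (edge_ideal V E :: ('v, 'k) mpoly set))"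

end

theory Submission
  imports Defs
begin

text \<open>Both implications rest on bounds for depth and dimension in both directions. Depth is bounded
  from above by nonzero Koszul homology: if \<open>x\<close> lies in the irrelevant ideal and is a nonzerodivisor
  modulo \<open>J\<close>, then multiplication by \<open>x\<close> is null-homotopic on the Koszul complex, and the homotopy
  turns a nontrivial cycle modulo \<open>J\<close> of degree \<open>q\<close> into one modulo \<open>J + (x)\<close> of degree \<open>q + 1\<close>; since
  degrees do not exceed the number \<open>N\<close> of variables, the depth of \<open>S/J\<close> is at most \<open>N - q\<close>. Complete
  bipartite subgraphs \<open>K\<^sub>a\<^sub>,\<^sub>b\<close> give cycles of degree \<open>a + b - 1\<close> for the edge ideal; induced pairs of
  disjoint edges give cycles of degree 3 for the Alexander dual, whose quotient has dimension
  \<open>N - 2\<close>. So if \<open>G\<close> is bi-Cohen-Macaulay, the neighbourhoods of the vertices in \<open>V1\<close> form a chain, and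
  comparing the sizes of complete bipartite subgraphs with those of independent sets forces
  their cardinalities to be \<open>1, \<dots>, n\<close>. Conversely, for the staircase graph the differences
  \<open>v\<^sub>i - w\<^sub>i\<close> form a regular sequence modulo the edge ideal, and the differences \<open>v\<^sub>1 - v\<^sub>i\<close>, \<open>w\<^sub>n - w\<^sub>i\<close>
  form one modulo its dual.\<close>

section \<open>Depth and dimension of a quotient ring\<close>

text \<open>Depth ranges over arbitrary regular sequences in the irrelevant ideal and dimension over
  arbitrary chains of primes, so an upper bound for either has to cope with elements that are
  neither monomial nor homogeneous. For the depth, every such element is a combination of the
  variables, which is all that the homotopy needs. For the dimension, a chain longer than the number
  of variables outside its smallest prime would give too many polynomials in too few variables, and
  a count of monomials produces a relation that the primes exclude. The lower bounds are monomial: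
  chains of primes generated by variables, and differences of variables, whose quotients stay
  monomial. In the dual, a colon by a variable deletes the edges at that vertex, so homology of an
  induced subgraph survives; degree 3 is one more than the codimension 2. For the edge ideal the
  comparison reads \<open>|C| + |D| + |X| + |Y| \<le> N + 1\<close> for an independent set
  \<open>C \<union> D\<close> and a complete bipartite pair \<open>X\<close>, \<open>Y\<close>; two
  vertices with equal neighbourhoods would break the sum of two instances.\<close>

definition regular_mod :: "('a, 'b) ring_scheme \<Rightarrow> 'a set \<Rightarrow> 'a list \<Rightarrow> bool" where
  "regular_mod R I xs \<longleftrightarrow>
     set xs \<subseteq> carrier R \<and>
     (\<forall>i<length xs. \<forall>y\<in>carrier R.
        xs ! i \<otimes>\<^bsub>R\<^esub> y \<in> Idl\<^bsub>R\<^esub> (I \<union> set (take i xs)) \<longrightarrow>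
        y \<in> Idl\<^bsub>R\<^esub> (I \<union> set (take i xs))) \<and>
     Idl\<^bsub>R\<^esub> (I \<union> set xs) \<noteq> carrier R"

lemma (in ring) coset_in_image_ideal_iff:
  assumes "ideal I R" "ideal J R" "I \<subseteq> J" "a \<in> carrier R"
  shows "I +> a \<in> (+>) I ` J \<longleftrightarrow> a \<in> J"
proof
  assume "I +> a \<in> (+>) I ` J"
  then obtain b where b: "b \<in> J" "I +> a = I +> b" by blast
  have bc: "b \<in> carrier R" using ideal.Icarr[OF assms(2) b(1)] .
  have "a \<ominus> b \<in> I"
    using quotient_eq_iff_same_a_r_cos[OF assms(1) assms(4) bc] b(2) by simp
  then have "a \<ominus> b \<oplus> b \<in> J"
    using b(1) assms(2,3) by (meson additive_subgroup.a_closed ideal.axioms(1) subsetD)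
  moreover have "a \<ominus> b \<oplus> b = a"
    using assms(4) bc by (simp add: a_assoc l_neg minus_eq)
  ultimately show "a \<in> J" by simp
qed simp

lemma (in ring) carrier_Quot: "carrier (R Quot I) = (+>) I ` carrier R"
  by (auto simp: FactRing_def A_RCOSETS_def')

lemma (in ring) coset_eq_zero_Quot:
  assumes "ideal I R" "r \<in> I"
  shows "I +> r = \<zero>\<^bsub>R Quot I\<^esub>"
  using a_rcos_zero[OF assms] by (simp add: FactRing_def)

text \<open>Ideals of the quotient correspond to ideals above \<open>I\<close>: the image of
  \<open>Idl (I \<union> X)\<close> is an ideal containing the generators of the quotient ideal, and
  the preimage of the latter contains \<open>I \<union> X\<close>. Minimality of generated ideals
  gives one direction each.\<close>

lemma (in ring) coset_in_genideal_iff: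
  assumes I: "ideal I R" and X: "X \<subseteq> carrier R" and a: "a \<in> carrier R"
  shows "I +> a \<in> Idl\<^bsub>R Quot I\<^esub> ((+>) I ` X) \<longleftrightarrow> a \<in> Idl (I \<union> X)"
proof
  interpret Q: ring "R Quot I" using I by (rule ideal.quotient_is_ring)
  have IX: "I \<union> X \<subseteq> carrier R" using X additive_subgroup.a_subset[OF ideal.axioms(1)[OF I]] by blast
  have piX: "(+>) I ` X \<subseteq> carrier (R Quot I)" using X by (auto simp: carrier_Quot)
  have Id: "ideal (Idl (I \<union> X)) R" using IX by (rule genideal_ideal)
  have sub: "I \<union> X \<subseteq> Idl (I \<union> X)" using IX by (rule genideal_self)
  {
    assume "I +> a \<in> Idl\<^bsub>R Quot I\<^esub> ((+>) I ` X)"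
    moreover have "Idl\<^bsub>R Quot I\<^esub> ((+>) I ` X) \<subseteq> (+>) I ` (Idl (I \<union> X))"
      using sub by (intro Q.genideal_minimal ring_ideal_imp_quot_ideal I Id) blast
    ultimately show "a \<in> Idl (I \<union> X)"
      using coset_in_image_ideal_iff[OF I Id _ a] sub by blast
  next
    interpret h: ring_hom_ring R "R Quot I" "(+>) I" using I by (rule ideal.rcos_ring_hom_ring)
    let ?J = "{r \<in> carrier R. I +> r \<in> Idl\<^bsub>R Quot I\<^esub> ((+>) I ` X)}"
    assume "a \<in> Idl (I \<union> X)"
    moreover have "Idl (I \<union> X) \<subseteq> ?J"
    proof (rule genideal_minimal)
      show "ideal ?J R" by (rule h.ideal_vimage[OF Q.genideal_ideal[OF piX]])
      have "I +> r \<in> Idl\<^bsub>R Quot I\<^esub> ((+>) I ` X)" if "r \<in> I" for r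
      proof -
        have "I +> r = \<zero>\<^bsub>R Quot I\<^esub>" by (rule coset_eq_zero_Quot[OF I that])
        then show ?thesis
          using Q.genideal_ideal[OF piX] additive_subgroup.zero_closed ideal.axioms(1) by metis
      qed
      moreover have "I +> r \<in> Idl\<^bsub>R Quot I\<^esub> ((+>) I ` X)" if "r \<in> X" for r
        using Q.genideal_self[OF piX] that by blast
      ultimately show "I \<union> X \<subseteq> ?J" using IX by blast
    qed
    ultimately show "I +> a \<in> Idl\<^bsub>R Quot I\<^esub> ((+>) I ` X)" by blast
  }
qed

text \<open>The clauses of \<open>regular_sequence\<close> are about membership in generated ideals,
  so they lift along the projection. From here on, regular sequences in a quotient are handled
  inside \<open>R\<close>, without cosets.\<close>

lemma (in cring) regular_sequence_Quot_iff:
  assumes I: "ideal I R" and xs: "set xs \<subseteq> carrier R"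
  shows "regular_sequence (R Quot I) (map ((+>) I) xs) \<longleftrightarrow> regular_mod R I xs"
proof -
  interpret Q: ring "R Quot I" using I by (rule ideal.quotient_is_ring)
  interpret h: ring_hom_ring R "R Quot I" "(+>) I" using I by (rule ideal.rcos_ring_hom_ring)
  have take: "set (take i (map ((+>) I) xs)) = (+>) I ` set (take i xs)" for i
    by (simp add: take_map)
  have tk: "set (take i xs) \<subseteq> carrier R" for i using xs set_take_subset by fastforce
  have mem: "I +> a \<in> Idl\<^bsub>R Quot I\<^esub> (set (take i (map ((+>) I) xs))) \<longleftrightarrow> a \<in> Idl (I \<union> set (take i xs))"
    if "a \<in> carrier R" for a i
    unfolding take by (rule coset_in_genideal_iff[OF I tk that])
  have mulc: "xs ! i \<otimes> y \<in> carrier R" if "i < length xs" "y \<in> carrier R" for i y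
    using xs that by (meson m_closed nth_mem subsetD)
  have nz: "(map ((+>) I) xs ! i) \<otimes>\<^bsub>R Quot I\<^esub> (I +> y) = I +> (xs ! i \<otimes> y)"
    if "i < length xs" "y \<in> carrier R" for i y
    using that xs by (simp add: h.hom_mult subsetD)
  have IX: "I \<union> set xs \<subseteq> carrier R" using xs additive_subgroup.a_subset[OF ideal.axioms(1)[OF I]] by blast
  have "Idl\<^bsub>R Quot I\<^esub> (set (map ((+>) I) xs)) = carrier (R Quot I) \<longleftrightarrow> Idl (I \<union> set xs) = carrier R"
    (is "?L = ?R")
  proof -
    have "?L \<longleftrightarrow> (\<forall>a\<in>carrier R. I +> a \<in> Idl\<^bsub>R Quot I\<^esub> (set (map ((+>) I) xs)))"
      using Q.genideal_ideal[of "set (map ((+>) I) xs)"] xs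
        additive_subgroup.a_subset[OF ideal.axioms(1)[of "Idl\<^bsub>R Quot I\<^esub> (set (map ((+>) I) xs))" "R Quot I"]]
      unfolding carrier_Quot by auto
    also have "\<dots> \<longleftrightarrow> (\<forall>a\<in>carrier R. a \<in> Idl (I \<union> set xs))"
      using mem[of _ "length xs"] by simp
    also have "\<dots> \<longleftrightarrow> ?R"
      using genideal_ideal[OF IX] additive_subgroup.a_subset ideal.axioms(1) by blast
    finally show ?thesis .
  qed
  moreover have "set (map ((+>) I) xs) \<subseteq> carrier (R Quot I)" using xs by (auto simp: carrier_Quot)
  moreover have "(\<forall>y\<in>carrier (R Quot I).
        map ((+>) I) xs ! i \<otimes>\<^bsub>R Quot I\<^esub> y \<in> Idl\<^bsub>R Quot I\<^esub> (set (take i (map ((+>) I) xs))) \<longrightarrow>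
        y \<in> Idl\<^bsub>R Quot I\<^esub> (set (take i (map ((+>) I) xs)))) \<longleftrightarrow>
      (\<forall>y\<in>carrier R. xs ! i \<otimes> y \<in> Idl (I \<union> set (take i xs)) \<longrightarrow> y \<in> Idl (I \<union> set (take i xs)))"
    if i: "i < length xs" for i
    unfolding carrier_Quot ball_simps using nz[OF i] mem mulc[OF i] by (simp only: cong: ball_cong)
  ultimately show ?thesis
    unfolding regular_sequence_def regular_mod_def using xs by simp
qed

lemma (in cring) depth_Quot:
  assumes I: "ideal I R" and M: "M \<subseteq> carrier R"
  shows "depth (R Quot I) ((+>) I ` M) = Sup {enat (length xs) | xs. regular_mod R I xs \<and> set xs \<subseteq> M}"
proof -
  have "{enat (length ys) | ys. regular_sequence (R Quot I) ys \<and> set ys \<subseteq> (+>) I ` M} =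
        {enat (length xs) | xs. regular_mod R I xs \<and> set xs \<subseteq> M}" (is "?A = ?B")
  proof
    show "?A \<subseteq> ?B"
    proof safe
      fix ys assume ys: "regular_sequence (R Quot I) ys" "set ys \<subseteq> (+>) I ` M"
      then have "ys \<in> map ((+>) I) ` lists M"
        unfolding lists_image[symmetric] by auto
      then obtain xs where xs: "set xs \<subseteq> M" "ys = map ((+>) I) xs"
        by auto
      then show "\<exists>xs. enat (length ys) = enat (length xs) \<and> regular_mod R I xs \<and> set xs \<subseteq> M"
        using ys(1) regular_sequence_Quot_iff[OF I, of xs] M by auto
    qed
    show "?B \<subseteq> ?A"
    proof safe
      fix xs assume xs: "regular_mod R I xs" "set xs \<subseteq> M"
      then have "regular_sequence (R Quot I) (map ((+>) I) xs)"
        using regular_sequence_Quot_iff[OF I, of xs] M by auto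
      then show "\<exists>ys. enat (length xs) = enat (length ys) \<and> regular_sequence (R Quot I) ys \<and> set ys \<subseteq> (+>) I ` M"
        using xs(2) by (intro exI[of _ "map ((+>) I) xs"]) auto
    qed
  qed
  then show ?thesis unfolding depth_def by simp
qed

lemma (in cring) primeideal_image_Quot:
  assumes I: "ideal I R" and P: "primeideal P R" and "I \<subseteq> P"
  shows "primeideal ((+>) I ` P) (R Quot I)"
proof (rule primeidealI)
  have PI: "ideal P R" using P by (rule primeideal.axioms)
  interpret h: ring_hom_ring R "R Quot I" "(+>) I" using I by (rule ideal.rcos_ring_hom_ring)
  note mem = coset_in_image_ideal_iff[OF I PI \<open>I \<subseteq> P\<close>]
  show "ideal ((+>) I ` P) (R Quot I)" by (rule ring_ideal_imp_quot_ideal[OF I PI])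
  show "cring (R Quot I)" by (rule ideal.quotient_is_cring[OF I is_cring])
  show "carrier (R Quot I) \<noteq> (+>) I ` P"
  proof
    assume "carrier (R Quot I) = (+>) I ` P"
    have "r \<in> P" if r: "r \<in> carrier R" for r
    proof -
      have "I +> r \<in> (+>) I ` P"
        using \<open>carrier (R Quot I) = (+>) I ` P\<close> r unfolding carrier_Quot by (metis imageI)
      then show ?thesis using mem[OF r] by simp
    qed
    then show False using primeideal.I_notcarr[OF P] ideal.Icarr[OF PI] by blast
  qed
  fix x y assume "x \<in> carrier (R Quot I)" "y \<in> carrier (R Quot I)" and xy: "x \<otimes>\<^bsub>R Quot I\<^esub> y \<in> (+>) I ` P"
  then obtain a b where ab: "a \<in> carrier R" "b \<in> carrier R" "x = I +> a" "y = I +> b"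
    unfolding carrier_Quot by blast
  then have "I +> (a \<otimes> b) \<in> (+>) I ` P" using xy h.hom_mult by metis
  then have "a \<otimes> b \<in> P" using mem[OF m_closed[OF ab(1,2)]] by blast
  then have "a \<in> P \<or> b \<in> P" using primeideal.I_prime[OF P] ab by blast
  then show "x \<in> (+>) I ` P \<or> y \<in> (+>) I ` P" using ab by blast
qed

text \<open>Primes are pulled back and pushed forward along the projection; strict inclusions
  survive because all primes involved contain \<open>I\<close>, so cosets still separate
  them.\<close>

lemma (in cring) krull_dim_Quot:
  assumes I: "ideal I R"
  shows "krull_dim (R Quot I) = Sup {enat k | k. \<exists>P :: nat \<Rightarrow> 'a set.
     (\<forall>i\<le>k. primeideal (P i) R \<and> I \<subseteq> P i) \<and> (\<forall>i<k. P i \<subset> P (Suc i))}"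
proof -
  interpret h: ring_hom_ring R "R Quot I" "(+>) I" using I by (rule ideal.rcos_ring_hom_ring)
  have "(\<exists>Q. (\<forall>i\<le>k. primeideal (Q i) (R Quot I)) \<and> (\<forall>i<k. Q i \<subset> Q (Suc i))) \<longleftrightarrow>
    (\<exists>P :: nat \<Rightarrow> 'a set. (\<forall>i\<le>k. primeideal (P i) R \<and> I \<subseteq> P i) \<and> (\<forall>i<k. P i \<subset> P (Suc i)))"
    (is "?L \<longleftrightarrow> ?R") for k
  proof
    assume ?L
    then obtain Q where Q: "\<And>i. i \<le> k \<Longrightarrow> primeideal (Q i) (R Quot I)" "\<And>i. i < k \<Longrightarrow> Q i \<subset> Q (Suc i)"
      by blast
    let ?P = "\<lambda>i. {r \<in> carrier R. I +> r \<in> Q i}"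
    have "primeideal (?P i) R" "I \<subseteq> ?P i" if "i \<le> k" for i
    proof -
      show "primeideal (?P i) R" by (rule h.primeideal_vimage[OF is_cring Q(1)[OF that]])
      have Qi: "ideal (Q i) (R Quot I)" using Q(1)[OF that] by (rule primeideal.axioms)
      have "I +> r \<in> Q i" if "r \<in> I" for r
      proof -
        have "I +> r = \<zero>\<^bsub>R Quot I\<^esub>" by (rule coset_eq_zero_Quot[OF I that])
        then show ?thesis using Qi additive_subgroup.zero_closed ideal.axioms(1) by metis
      qed
      then show "I \<subseteq> ?P i" using ideal.Icarr[OF I] by blast
    qed
    moreover have "?P i \<subset> ?P (Suc i)" if ik: "i < k" for i
    proof -
      obtain q where q: "q \<in> Q (Suc i)" "q \<notin> Q i" using Q(2)[OF ik] by blast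
      have "ideal (Q (Suc i)) (R Quot I)" using Q(1)[of "Suc i", THEN primeideal.axioms(1)] ik by simp
      then have "q \<in> carrier (R Quot I)" using q by (auto intro: ideal.Icarr)
      then obtain r where "r \<in> carrier R" "q = I +> r" unfolding carrier_Quot by blast
      then show ?thesis using Q(2)[OF ik] q by blast
    qed
    ultimately have "(\<forall>i\<le>k. primeideal (?P i) R \<and> I \<subseteq> ?P i) \<and> (\<forall>i<k. ?P i \<subset> ?P (Suc i))"
      by simp
    then show ?R by (rule exI[of _ ?P])
  next
    assume ?R
    then obtain P where P: "\<And>i. i \<le> k \<Longrightarrow> primeideal (P i) R" "\<And>i. i \<le> k \<Longrightarrow> I \<subseteq> P i"
        "\<And>i. i < k \<Longrightarrow> P i \<subset> P (Suc i)"
      by blast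
    have "(+>) I ` P i \<subset> (+>) I ` P (Suc i)" if ik: "i < k" for i
    proof -
      obtain p where p: "p \<in> P (Suc i)" "p \<notin> P i" using P(3)[OF ik] by blast
      have Pi: "ideal (P i) R" "ideal (P (Suc i)) R"
        using P(1)[THEN primeideal.axioms(1)] ik by simp_all
      then have "I +> p \<notin> (+>) I ` P i"
        using coset_in_image_ideal_iff[OF I Pi(1) P(2), of p] p ik ideal.Icarr[OF Pi(2)] by auto
      then show ?thesis using p P(3)[OF ik] by blast
    qed
    then show ?L
      using primeideal_image_Quot[OF I] P(1,2) by (intro exI[of _ "\<lambda>i. (+>) I ` P i"]) auto
  qed
  then show ?thesis unfolding krull_dim_def by simp
qed

section \<open>Polynomials and monomial ideals\<close>

abbreviation "lookup \<equiv> Poly_Mapping.lookup"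
abbreviation "keys \<equiv> Poly_Mapping.keys"
abbreviation "single \<equiv> Poly_Mapping.single"

abbreviation polys :: "'v set \<Rightarrow> ('v, 'k::field) mpoly set" where
  "polys V \<equiv> carrier (poly_ring V)"

lemma poly_ring_simps [simp]:
  "mult (poly_ring V) = (*)" "one (poly_ring V) = 1" "zero (poly_ring V) = 0" "add (poly_ring V) = (+)"
  by (simp_all add: poly_ring_def)

lemma in_polys: "p \<in> polys V \<longleftrightarrow> (\<forall>t\<in>keys p. keys t \<subseteq> V)"
  by (simp add: poly_ring_def)

lemma keys_add_nat: "keys (s + t) = keys s \<union> keys (t :: 'v \<Rightarrow>\<^sub>0 nat)"
  by (auto simp: in_keys_iff lookup_add)

lemma keys_mult_subset:
  "t \<in> keys (p * q :: ('v, 'k::field) mpoly) \<Longrightarrow>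
   \<exists>a\<in>keys p. \<exists>b\<in>keys q. t = a + b"
  using keys_mult[of p q] by blast

lemma polys_zero [simp]: "0 \<in> polys V"
  and polys_one [simp]: "1 \<in> polys V"
  and polys_add [intro]: "p \<in> polys V \<Longrightarrow> q \<in> polys V \<Longrightarrow> p + q \<in> polys V"
  and polys_mult [intro]: "p \<in> polys V \<Longrightarrow> q \<in> polys V \<Longrightarrow> p * q \<in> polys V"
  using cring.cring_simprules[OF cring_poly_ring[of V]] by auto

lemma polys_uminus [intro]: "p \<in> polys V \<Longrightarrow> - p \<in> polys V"
  by (simp add: in_polys)

lemma polys_diff [intro]: "p \<in> polys V \<Longrightarrow> q \<in> polys V \<Longrightarrow> p - q \<in> polys V"
  using polys_add[OF _ polys_uminus, of p V q] by simp

lemma polys_sum [intro]: "(\<And>i. i \<in> A \<Longrightarrow> f i \<in> polys V) \<Longrightarrow> sum f A \<in> polys V"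
  by (induction A rule: infinite_finite_induct) auto

lemma polys_prod [intro]: "(\<And>i. i \<in> A \<Longrightarrow> f i \<in> polys V) \<Longrightarrow> prod f A \<in> polys V"
  by (induction A rule: infinite_finite_induct) auto

lemma polys_single [intro]: "keys t \<subseteq> V \<Longrightarrow> single t c \<in> polys V"
  by (simp add: in_polys)

lemma polys_var [intro]: "v \<in> V \<Longrightarrow> var v \<in> polys V"
  by (simp add: var_def in_polys)

lemma poly_idealI:
  assumes "J \<subseteq> polys V" "0 \<in> J" "\<And>f g. f \<in> J \<Longrightarrow> g \<in> J \<Longrightarrow> f + g \<in> J"
    "\<And>f g. f \<in> polys V \<Longrightarrow> g \<in> J \<Longrightarrow> f * g \<in> J"
  shows "ideal J (poly_ring V :: ('v, 'k::field) mpoly ring)"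
proof -
  interpret cring "poly_ring V :: ('v, 'k) mpoly ring" by (rule cring_poly_ring)
  \<comment> \<open>Negation is multiplication by the constant -1, so closure under it follows from
    the other premises.\<close>
  have "- 1 * f \<in> J" if "f \<in> J" for f using that assms(4)[of "-1" f] by (simp add: in_polys)
  then have neg: "- f \<in> J" if "f \<in> J" for f using that by simp
  have "subgroup J (add_monoid (poly_ring V))"
  proof (rule add.subgroupI)
    fix f assume "f \<in> J"
    have "\<ominus>\<^bsub>poly_ring V\<^esub> f = - f"
      by (rule add.inv_equality) (use \<open>f \<in> J\<close> assms(1) in auto)
    then show "\<ominus>\<^bsub>poly_ring V\<^esub> f \<in> J"
      using neg[OF \<open>f \<in> J\<close>] by simp
  qed (use assms in auto)
  moreover have "g * f \<in> J" if "f \<in> polys V" "g \<in> J" for f g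
    using assms(4)[OF that] by (simp add: mult.commute)
  ultimately show ?thesis
    by (intro idealI ring_axioms) (use assms(4) in auto)
qed

context
  fixes J :: "('v, 'k::field) mpoly set" and V
  assumes J: "ideal J (poly_ring V)"
begin

lemma poly_ideal_subset: "J \<subseteq> polys V"
  using ideal.Icarr[OF J] by blast

lemma poly_ideal_zero: "0 \<in> J"
  using additive_subgroup.zero_closed[OF ideal.axioms(1)[OF J]] by simp

lemma poly_ideal_add: "f \<in> J \<Longrightarrow> g \<in> J \<Longrightarrow> f + g \<in> J"
  using additive_subgroup.a_closed[OF ideal.axioms(1)[OF J]] by fastforce

lemma poly_ideal_mult: "f \<in> polys V \<Longrightarrow> g \<in> J \<Longrightarrow> f * g \<in> J"
  using ideal.I_l_closed[OF J] by fastforce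

lemma poly_ideal_uminus: "f \<in> J \<Longrightarrow> - f \<in> J"
  using poly_ideal_mult[of "-1" f] by (simp add: in_polys)

lemma poly_ideal_diff: "f \<in> J \<Longrightarrow> g \<in> J \<Longrightarrow> f - g \<in> J"
  using poly_ideal_add[of f "- g"] poly_ideal_uminus by simp

lemma poly_ideal_sum: "(\<And>i. i \<in> A \<Longrightarrow> h i \<in> J) \<Longrightarrow> sum h A \<in> J"
  by (induction A rule: infinite_finite_induct) (auto simp: poly_ideal_zero poly_ideal_add)

lemma poly_ideal_one: "1 \<in> J \<Longrightarrow> J = polys V"
  using poly_ideal_mult[of _ 1] poly_ideal_subset by auto

end

lemma poly_genideal_least:
  fixes J :: "('v, 'k::field) mpoly set"
  shows "ideal J (poly_ring V) \<Longrightarrow> X \<subseteq> J \<Longrightarrow> Idl\<^bsub>poly_ring V\<^esub> X \<subseteq> J"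
  using ring.genideal_minimal[OF cring.axioms(1)[OF cring_poly_ring]] by blast

lemma poly_genideal_ideal:
  fixes X :: "('v, 'k::field) mpoly set"
  shows "X \<subseteq> polys V \<Longrightarrow> ideal (Idl\<^bsub>poly_ring V\<^esub> X) (poly_ring V)"
  by (rule ring.genideal_ideal[OF cring.axioms(1)[OF cring_poly_ring]])

lemma poly_genideal_superset:
  fixes X :: "('v, 'k::field) mpoly set"
  shows "X \<subseteq> polys V \<Longrightarrow> X \<subseteq> Idl\<^bsub>poly_ring V\<^esub> X"
  by (rule ring.genideal_self[OF cring.axioms(1)[OF cring_poly_ring]])

lemma poly_eq_sum_single:
  fixes f :: "'a \<Rightarrow>\<^sub>0 'b::comm_monoid_add"
  shows "f = (\<Sum>t\<in>keys f. single t (lookup f t))"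
proof (rule poly_mapping_eqI)
  fix k
  show "lookup f k =
    lookup (\<Sum>t\<in>keys f. single t (lookup f t)) k"
    by (simp add: lookup_sum lookup_single when_def sum.delta' in_keys_iff)
qed

lemma lookup_mult_sum:
  fixes f g :: "('v, 'k::field) mpoly"
  shows "lookup (f * g) u =
    (\<Sum>s\<in>keys f. \<Sum>t\<in>keys g.
       if s + t = u then lookup f s * lookup g t else 0)"
proof -
  have "f * g = (\<Sum>s\<in>keys f. \<Sum>t\<in>keys g.
      single (s + t) (lookup f s * lookup g t))"
    by (subst poly_eq_sum_single[of f], subst poly_eq_sum_single[of g]) (simp add: sum_product mult_single)
  then show ?thesis by (simp add: lookup_sum lookup_single when_def)
qed

lemma lookup_single_mult:
  fixes f :: "('v, 'k::field) mpoly"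
  shows "lookup (single s c * f) (s + t) = c * lookup f t"
proof (cases "c = 0")
  case False
  then have k: "keys (single s c) = {s}" by simp
  show ?thesis unfolding lookup_mult_sum k by (simp add: in_keys_iff)
qed simp

lemma lookup_const_mult:
  fixes f :: "('v, 'k::field) mpoly"
  shows "lookup (single 0 c * f) t = c * lookup f t"
  using lookup_single_mult[of 0 c f t] by simp

lemma lookup_var_mult:
  fixes f :: "('v, 'k::field) mpoly"
  shows "lookup (var v * f) t =
    (if v \<in> keys t then lookup f (t - single v 1) else 0)"
proof (cases "v \<in> keys t")
  case True
  then have "t = single v 1 + (t - single v 1)"
    by (intro poly_mapping_eqI) (auto simp: lookup_add lookup_minus lookup_single when_def in_keys_iff)
  then show ?thesis using True unfolding var_def
    by (metis lookup_single_mult mult_1)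
next
  case False
  have "t \<notin> keys (var v * f)"
    using keys_mult_subset[of t "var v" f] False by (auto simp: var_def keys_add_nat)
  then show ?thesis using False by (simp add: in_keys_iff)
qed

lemma lookup_neg_one_power_mult:
  fixes f :: "('v, 'k::field) mpoly"
  shows "lookup ((- 1) ^ n * f) t = (- 1) ^ n * lookup f t"
  by (induction n) auto

definition mono_ideal :: "'v set \<Rightarrow> ('v \<Rightarrow>\<^sub>0 nat) set \<Rightarrow> ('v, 'k::field) mpoly set" where
  "mono_ideal V M = {f \<in> polys V. keys f \<subseteq> M}"

definition up_closed :: "('v \<Rightarrow>\<^sub>0 nat) set \<Rightarrow> bool" where
  "up_closed M \<longleftrightarrow> (\<forall>s. \<forall>t\<in>M. s + t \<in> M)"

lemma ideal_mono_ideal: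
  assumes "up_closed M"
  shows "ideal (mono_ideal V M :: ('v, 'k::field) mpoly set) (poly_ring V)"
proof (rule poly_idealI)
  fix f g :: "('v, 'k) mpoly"
  show "f * g \<in> mono_ideal V M" if "f \<in> polys V" "g \<in> mono_ideal V M"
    using that assms keys_mult_subset[of _ f g] unfolding mono_ideal_def up_closed_def by blast
  show "f + g \<in> mono_ideal V M" if "f \<in> mono_ideal V M" "g \<in> mono_ideal V M"
    using that Poly_Mapping.keys_add[of f g] unfolding mono_ideal_def by blast
qed (auto simp: mono_ideal_def)

lemma single_in_mono_ideal_iff:
  "c \<noteq> 0 \<Longrightarrow> keys t \<subseteq> V \<Longrightarrow> single t c \<in> mono_ideal V M \<longleftrightarrow> t \<in> M"
  by (auto simp: mono_ideal_def)

lemma mono_ideal_mono: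
  assumes "\<And>t. t \<in> M \<Longrightarrow> keys t \<subseteq> V \<Longrightarrow> t \<in> M'"
  shows "mono_ideal V M \<subseteq> mono_ideal V M'"
  using assms by (fastforce simp: mono_ideal_def in_polys)

lemma mono_ideal_cong:
  assumes "\<And>t. keys t \<subseteq> V \<Longrightarrow> t \<in> M \<longleftrightarrow> t \<in> M'"
  shows "mono_ideal V M = mono_ideal V M'"
  using assms by (intro equalityI mono_ideal_mono) auto

text \<open>Each term of a polynomial on the right is a multiple of a single generator, and a
  polynomial is the sum of its terms.\<close>

lemma genideal_monomials:
  assumes "\<And>t. t \<in> T \<Longrightarrow> keys t \<subseteq> V"
  shows "Idl\<^bsub>poly_ring V\<^esub> ((\<lambda>t. single t 1) ` T) =
    (mono_ideal V {s + t | s t. t \<in> T} :: ('v, 'k::field) mpoly set)"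
proof
  have up: "up_closed {s + t | s t. t \<in> T}"
    unfolding up_closed_def
  proof (intro allI ballI)
    fix s u assume "u \<in> {s + t | s t. t \<in> T}"
    then obtain r t where "u = r + t" "t \<in> T" by blast
    then have "s + u = (s + r) + t" "t \<in> T" by (simp_all add: add.assoc)
    then show "s + u \<in> {s + t | s t. t \<in> T}" by blast
  qed
  have sub: "(\<lambda>t. single t 1) ` T \<subseteq> polys V" using assms by auto
  have "t \<in> {s + t | s t. t \<in> T}" if "t \<in> T" for t
    using that by (metis (mono_tags, lifting) add_0 mem_Collect_eq)
  then show "Idl\<^bsub>poly_ring V\<^esub> ((\<lambda>t. single t 1) ` T) \<subseteq>
      (mono_ideal V {s + t | s t. t \<in> T} :: ('v, 'k::field) mpoly set)"
    using assms by (intro poly_genideal_least ideal_mono_ideal up) (auto simp: single_in_mono_ideal_iff)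
  show "(mono_ideal V {s + t | s t. t \<in> T} :: ('v, 'k::field) mpoly set) \<subseteq>
      Idl\<^bsub>poly_ring V\<^esub> ((\<lambda>t. single t 1) ` T)"
  proof
    fix f :: "('v, 'k::field) mpoly" assume f: "f \<in> mono_ideal V {s + t | s t. t \<in> T}"
    have "single u (lookup f u) \<in> Idl\<^bsub>poly_ring V\<^esub> ((\<lambda>t. single t 1) ` T)"
      if u: "u \<in> keys f" for u
    proof -
      obtain s t where st: "u = s + t" "t \<in> T" using f u unfolding mono_ideal_def by blast
      have "keys u \<subseteq> V" using f u by (auto simp: mono_ideal_def in_polys)
      then have "single s (lookup f u) \<in> polys V"
        unfolding st keys_add_nat by auto
      moreover have "single t 1 \<in> Idl\<^bsub>poly_ring V\<^esub> ((\<lambda>t. single t (1::'k)) ` T)"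
        using poly_genideal_superset[OF sub] st by blast
      ultimately have "single s (lookup f u) * single t 1
          \<in> Idl\<^bsub>poly_ring V\<^esub> ((\<lambda>t. single t 1) ` T)"
        by (rule poly_ideal_mult[OF poly_genideal_ideal[OF sub]])
      then show ?thesis by (simp add: mult_single st)
    qed
    then show "f \<in> Idl\<^bsub>poly_ring V\<^esub> ((\<lambda>t. single t 1) ` T)"
      by (subst poly_eq_sum_single) (intro poly_ideal_sum[OF poly_genideal_ideal[OF sub]])
  qed
qed

lemma var_in_mono_ideal_iff: "v \<in> V \<Longrightarrow> var v \<in> mono_ideal V M \<longleftrightarrow> single v 1 \<in> M"
  unfolding var_def by (rule single_in_mono_ideal_iff) auto

lemma var_mult_var: "var v * var w = single (single v 1 + single w 1) 1"
  by (simp add: var_def mult_single)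

lemma prod_var: "finite C \<Longrightarrow> (\<Prod>v\<in>C. var v) = single (\<Sum>v\<in>C. single v 1) 1"
  by (induction C rule: finite_induct) (simp_all add: var_def mult_single)

lemma keys_sum_single: "finite C \<Longrightarrow> keys (\<Sum>v\<in>C. single v (1::nat)) = C"
  by (induction C rule: finite_induct) (simp_all add: keys_add_nat)

lemma exists_add_sum_single_iff:
  assumes "finite C"
  shows "(\<exists>s. t = s + (\<Sum>v\<in>C. single v (1::nat))) \<longleftrightarrow> C \<subseteq> keys t"
proof
  assume "C \<subseteq> keys t"
  moreover have "lookup (\<Sum>v\<in>C. single v (1::nat)) u = (if u \<in> C then 1 else 0)" for u
    using assms by (simp add: lookup_sum lookup_single when_def)
  ultimately have "t = (t - (\<Sum>v\<in>C. single v 1)) + (\<Sum>v\<in>C. single v 1)"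
    by (intro poly_mapping_eqI) (auto simp: lookup_add lookup_minus in_keys_iff Suc_le_eq subset_iff)
  then show "\<exists>s. t = s + (\<Sum>v\<in>C. single v (1::nat))" by blast
qed (metis keys_add_nat keys_sum_single[OF assms] Un_upper2)

lemma irrelevant_ideal_eq:
  "irrelevant_ideal V = (mono_ideal V {t. t \<noteq> 0} :: ('v, 'k::field) mpoly set)"
proof -
  have "var ` V = (\<lambda>t. single t (1::'k)) ` ((\<lambda>v. single v 1) ` V)"
    by (simp add: var_def image_image)
  then have "irrelevant_ideal V = (mono_ideal V {s + t | s t. t \<in> (\<lambda>v. single v 1) ` V} :: ('v, 'k) mpoly set)"
    unfolding irrelevant_ideal_def by (simp only:) (rule genideal_monomials, auto)
  also have "\<dots> = mono_ideal V {t. t \<noteq> 0}"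
  proof (rule mono_ideal_cong)
    fix t :: "'v \<Rightarrow>\<^sub>0 nat" assume t: "keys t \<subseteq> V"
    have "t \<in> {s + t | s t. t \<in> (\<lambda>v. single v 1) ` V} \<longleftrightarrow>
        (\<exists>v\<in>V. \<exists>s. t = s + (\<Sum>u\<in>{v}. single u 1))" by auto
    also have "\<dots> \<longleftrightarrow> (\<exists>v\<in>V. v \<in> keys t)"
      using exists_add_sum_single_iff[of "{v}" t for v] by (metis empty_subsetI finite.emptyI finite_insert insert_subset)
    also have "\<dots> \<longleftrightarrow> t \<noteq> 0" using t by (metis all_not_in_conv keys_eq_empty subsetD)
    finally show "t \<in> {s + t | s t. t \<in> (\<lambda>v. single v 1) ` V} \<longleftrightarrow> t \<in> {t. t \<noteq> 0}" by simp
  qed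
  finally show ?thesis .
qed

abbreviation depth_quot :: "'v set \<Rightarrow> ('v, 'k::field) mpoly set \<Rightarrow> enat" where
  "depth_quot V I \<equiv> depth (poly_ring V Quot I) ((\<lambda>p. I +>\<^bsub>poly_ring V\<^esub> p) ` irrelevant_ideal V)"

section \<open>Koszul cycles bound the depth from above\<close>

text \<open>Exchanging the summations would only show that twice the sum is zero, which says nothing
  in characteristic 2. The induction instead cancels the row of the new element against its
  column.\<close>

lemma antisymmetric_double_sum:
  fixes T :: "'a \<Rightarrow> 'a \<Rightarrow> 'b::ab_group_add"
  assumes "finite B" "\<And>v w. v \<in> B \<Longrightarrow> w \<in> B \<Longrightarrow> v \<noteq> w \<Longrightarrow> T v w = - T w v"
  shows "(\<Sum>v\<in>B. \<Sum>w\<in>B - {v}. T v w) = 0"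
  using assms
proof (induction B rule: finite_induct)
  case (insert b B)
  have "(\<Sum>w\<in>insert b B - {v}. T v w) = T v b + (\<Sum>w\<in>B - {v}. T v w)" if "v \<in> B" for v
  proof -
    have "insert b B - {v} = insert b (B - {v})" using that insert.hyps by blast
    then show ?thesis using insert.hyps by simp
  qed
  then have "(\<Sum>v\<in>insert b B. \<Sum>w\<in>insert b B - {v}. T v w) =
      (\<Sum>w\<in>B. T b w) + ((\<Sum>v\<in>B. T v b) + (\<Sum>v\<in>B. \<Sum>w\<in>B - {v}. T v w))"
    using insert.hyps by (simp add: sum.distrib)
  also have "(\<Sum>w\<in>B. T b w) = (\<Sum>w\<in>B. - T w b)"
    using insert.hyps by (intro sum.cong insert.prems) auto
  also have "(\<Sum>v\<in>B. \<Sum>w\<in>B - {v}. T v w) = 0"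
    by (intro insert.IH insert.prems) auto
  finally show ?case by (simp add: sum_negf)
qed simp

text \<open>A Koszul chain is a function on the subsets of \<open>V\<close>; its value at \<open>F\<close> is the coefficient of
  the basis element \<open>e\<^sub>F\<close> of the exterior algebra. The numbering \<open>ix\<close> of the variables fixes the
  signs.\<close>

locale koszul =
  fixes V :: "'v set" and ix :: "'v \<Rightarrow> nat"
  assumes fin: "finite V" and inj: "inj_on ix V"
begin

definition ksign :: "'v \<Rightarrow> 'v set \<Rightarrow> ('v, 'k::field) mpoly" where
  "ksign v F = (- 1) ^ card {w\<in>F. ix w < ix v}"

text \<open>The Koszul differential that removes only elements of \<open>A\<close>;
  \<open>A = V\<close> gives the full one. The value at \<open>F\<close> collects the coefficients
  at the sets \<open>insert v F\<close>, because \<open>e\<^sub>F\<close> occurs in their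
  boundaries. The partial differentials serve to write down cycles in
  \<open>koszul_class_complete_bipartite\<close>.\<close>

definition bd :: "'v set \<Rightarrow> ('v set \<Rightarrow> ('v, 'k::field) mpoly) \<Rightarrow> 'v set \<Rightarrow> ('v, 'k) mpoly" where
  "bd A z F = (\<Sum>v\<in>A - F. ksign v F * var v * z (insert v F))"

text \<open>Exterior multiplication by \<open>e\<^sub>u\<close>: the coefficient at \<open>F\<close>
  comes from \<open>F - {u}\<close>, with the sign that moves \<open>u\<close> to its place in the
  order.\<close>

definition hp :: "'v \<Rightarrow> ('v set \<Rightarrow> ('v, 'k::field) mpoly) \<Rightarrow> 'v set \<Rightarrow> ('v, 'k) mpoly" where
  "hp u z F = (if u \<in> F then ksign u (F - {u}) * z (F - {u}) else 0)"

definition koszul_boundary :: "('v, 'k::field) mpoly set \<Rightarrow> ('v set \<Rightarrow> ('v, 'k) mpoly) \<Rightarrow> bool" where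
  "koszul_boundary J z \<longleftrightarrow> (\<exists>b. (\<forall>F\<subseteq>V. b F \<in> polys V) \<and> (\<forall>F\<subseteq>V. z F - bd V b F \<in> J))"

text \<open>The Koszul complex of the variables with coefficients in \<open>S/J\<close> has nonzero homology in
  some degree at least \<open>q\<close>.\<close>

definition koszul_class :: "('v, 'k::field) mpoly set \<Rightarrow> nat \<Rightarrow> bool" where
  "koszul_class J q \<longleftrightarrow> (\<exists>z. (\<forall>F\<subseteq>V. z F \<in> polys V) \<and> (\<forall>F\<subseteq>V. card F < q \<longrightarrow> z F = 0) \<and>
     (\<forall>F\<subseteq>V. bd V z F \<in> J) \<and> \<not> koszul_boundary J z)"

lemma ksign_square: "ksign v F * ksign v F = 1"
  by (simp add: ksign_def power_mult_distrib[symmetric])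

lemma ksign_square_left: "ksign v F * (ksign v F * p) = p"
  by (simp add: mult.assoc[symmetric] ksign_square)

lemma ksign_insert:
  assumes "finite F" "u \<notin> F"
  shows "ksign v (insert u F) = (if ix u < ix v then - ksign v F else ksign v F)"
proof (cases "ix u < ix v")
  case True
  then have "{w\<in>insert u F. ix w < ix v} = insert u {w\<in>F. ix w < ix v}" by auto
  then show ?thesis using True assms by (simp add: ksign_def)
next
  case False
  then have "{w\<in>insert u F. ix w < ix v} = {w\<in>F. ix w < ix v}" by auto
  then show ?thesis using False by (simp add: ksign_def)
qed

text \<open>Exactly one of the two insertions changes a sign, namely that of the element with the
  smaller index; injectivity of \<open>ix\<close> excludes ties.\<close>

lemma ksign_swap:
  assumes "finite F" "u \<notin> F" "v \<notin> F" "u \<noteq> v" "u \<in> V" "v \<in> V"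
  shows "ksign u F * ksign v (insert u F) = - (ksign v F * ksign u (insert v F))"
proof -
  have "ix u \<noteq> ix v" using inj assms by (auto dest: inj_onD)
  then show ?thesis using assms by (auto simp: ksign_insert)
qed

lemma ksign_swap_left:
  assumes "finite F" "u \<notin> F" "v \<notin> F" "u \<noteq> v" "u \<in> V" "v \<in> V"
  shows "ksign u F * (ksign v (insert u F) * p) = - (ksign v F * (ksign u (insert v F) * p))"
  by (simp only: mult.assoc[symmetric] mult_minus_left ksign_swap[OF assms])

lemma ksign_polys [intro]: "ksign v F \<in> polys V"
proof -
  have "(- 1) ^ n \<in> polys V" for n by (induction n) (auto intro!: polys_uminus)
  then show ?thesis by (simp add: ksign_def)
qed

lemma fin_sub: "F \<subseteq> V \<Longrightarrow> finite F"
  using fin by (rule finite_subset[rotated])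

lemma bd_bd:
  assumes "A \<subseteq> V" "F \<subseteq> V"
  shows "bd A (bd A z) F = 0"
proof -
  let ?T = "\<lambda>v w. ksign v F * var v * (ksign w (insert v F) * var w * z (insert w (insert v F)))"
  have "bd A (bd A z) F = (\<Sum>v\<in>A - F. \<Sum>w\<in>A - F - {v}. ?T v w)"
    unfolding bd_def sum_distrib_left by (intro sum.cong) auto
  also have "\<dots> = 0"
  proof (rule antisymmetric_double_sum)
    show "finite (A - F)" using assms fin_sub by blast
    fix v w assume vw: "v \<in> A - F" "w \<in> A - F" "v \<noteq> w"
    have "?T v w = ksign v F * (ksign w (insert v F) * (var v * var w * z (insert w (insert v F))))"
      by (simp add: mult_ac)
    also have "\<dots> = - (ksign w F * (ksign v (insert w F) * (var v * var w * z (insert w (insert v F)))))"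
      by (rule ksign_swap_left) (use vw assms fin_sub in auto)
    also have "\<dots> = - ?T w v" by (simp add: mult_ac insert_commute)
    finally show "?T v w = - ?T w v" .
  qed
  finally show ?thesis .
qed

lemma bd_cong:
  assumes "\<And>v. v \<in> A \<Longrightarrow> v \<notin> F \<Longrightarrow> y (insert v F) = z (insert v F)"
  shows "bd A y F = bd A z F"
  unfolding bd_def using assms by (intro sum.cong) auto

lemma bd_add: "bd A (\<lambda>F. y F + z F) F = bd A y F + bd A z F"
  by (simp add: bd_def ring_distribs sum.distrib)

lemma bd_diff: "bd A (\<lambda>F. y F - z F) F = bd A y F - bd A z F"
  by (simp add: bd_def ring_distribs sum_subtractf)

lemma bd_mult: "bd A (\<lambda>F. c * z F) F = c * bd A z F"
  by (simp add: bd_def sum_distrib_left mult_ac)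

lemma bd_sum: "bd A (\<lambda>F. \<Sum>i\<in>I. z i F) F = (\<Sum>i\<in>I. bd A (z i) F)"
  unfolding bd_def sum_distrib_left by (rule sum.swap)

lemma bd_in_ideal:
  assumes "ideal J (poly_ring V)" "A \<subseteq> V" "F \<subseteq> V" "\<And>G. G \<subseteq> V \<Longrightarrow> z G \<in> J"
  shows "bd A z F \<in> J"
  unfolding bd_def
  by (intro poly_ideal_sum[OF assms(1)] poly_ideal_mult[OF assms(1)] polys_mult ksign_polys polys_var)
     (use assms in auto)

lemma bd_polys:
  assumes "A \<subseteq> V" "F \<subseteq> V" "\<And>G. G \<subseteq> V \<Longrightarrow> z G \<in> polys V"
  shows "bd A z F \<in> polys V"
  unfolding bd_def
  by (intro polys_sum polys_mult ksign_polys polys_var) (use assms in auto)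

text \<open>For \<open>u \<notin> F\<close> only the summand \<open>v = u\<close> of the boundary
  survives, and its two signs cancel. For \<open>u \<in> F\<close> this summand comes from the
  second term, while the summands with \<open>v \<noteq> u\<close> occur in both terms with opposite
  signs.\<close>

lemma bd_hp:
  fixes z :: "'v set \<Rightarrow> ('v, 'k::field) mpoly"
  assumes "u \<in> V" "F \<subseteq> V"
  shows "bd V (hp u z) F + hp u (bd V z) F = var u * z F"
proof (cases "u \<in> F")
  case False
  then have "bd V (hp u z) F = (\<Sum>v\<in>V - F. if v = u then ksign u F * var u * (ksign u F * z F) else 0)"
    unfolding bd_def hp_def by (intro sum.cong) auto
  also have "\<dots> = ksign u F * var u * (ksign u F * z F)"
    using False assms fin by (simp add: sum.delta)
  also have "\<dots> = (ksign u F * ksign u F) * (var u * z F)" by (simp add: mult_ac)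
  also have "\<dots> = var u * z F" by (simp add: ksign_square)
  finally show ?thesis using False by (simp add: hp_def)
next
  case True
  define G where "G = F - {u}"
  have G: "u \<notin> G" "F = insert u G" "finite G" using True assms fin_sub by (auto simp: G_def)
  have 1: "bd V (hp u z) F = (\<Sum>v\<in>V - F. ksign v F * var v * (ksign u (insert v G) * z (insert v G)))"
    unfolding bd_def hp_def
  proof (intro sum.cong refl)
    fix v assume "v \<in> V - F"
    then have "insert v F - {u} = insert v G" using G by auto
    then show "ksign v F * var v * (if u \<in> insert v F then ksign u (insert v F - {u}) * z (insert v F - {u}) else 0) =
      ksign v F * var v * (ksign u (insert v G) * z (insert v G))" using True by simp
  qed
  have VG: "V - G = insert u (V - F)" using G assms by auto
  have "u \<notin> V - F" "finite (V - F)" using True fin by auto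
  then have "bd V z G = ksign u G * var u * z F + (\<Sum>v\<in>V - F. ksign v G * var v * z (insert v G))"
    unfolding bd_def VG by (subst sum.insert) (simp_all only: G(2)[symmetric] simp_thms)
  then have "hp u (bd V z) F = ksign u G * (ksign u G * (var u * z F)) +
      (\<Sum>v\<in>V - F. ksign u G * (ksign v G * var v * z (insert v G)))"
    using True by (simp add: hp_def G_def[symmetric] ring_distribs sum_distrib_left mult_ac)
  also have "\<dots> = var u * z F + (\<Sum>v\<in>V - F. ksign u G * (ksign v G * var v * z (insert v G)))"
    by (simp add: ksign_square_left)
  finally have 2: "hp u (bd V z) F = \<dots>" .
  have "(\<Sum>v\<in>V - F. ksign v F * var v * (ksign u (insert v G) * z (insert v G))) =
      (\<Sum>v\<in>V - F. - (ksign u G * (ksign v G * var v * z (insert v G))))"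
  proof (intro sum.cong refl)
    fix v assume v: "v \<in> V - F"
    have "ksign v F * ksign u (insert v G) = - (ksign u G * ksign v G :: ('v, 'k) mpoly)"
    proof -
      have "ix u \<noteq> ix v" using inj assms v True by (auto dest: inj_onD)
      then show ?thesis using G v by (auto simp: ksign_insert)
    qed
    then have "ksign v F * ksign u (insert v G) * (var v * z (insert v G)) =
        - (ksign u G * ksign v G) * (var v * z (insert v G))" by simp
    then show "ksign v F * var v * (ksign u (insert v G) * z (insert v G)) =
      - (ksign u G * (ksign v G * var v * z (insert v G)))" by (simp add: mult_ac)
  qed
  then show ?thesis unfolding 1 2 by (simp add: sum_negf)
qed

text \<open>Writing \<open>x\<close> through the variables combines the homotopies
  \<open>hp u\<close> of the single variables into one for multiplication by
  \<open>x\<close>.\<close>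

lemma irrelevant_ideal_decomposition:
  assumes "x \<in> irrelevant_ideal V"
  shows "\<exists>a. (\<forall>u\<in>V. a u \<in> polys V) \<and> x = (\<Sum>u\<in>V. var u * a u)"
proof -
  let ?J = "{x. \<exists>a. (\<forall>u\<in>V. a u \<in> polys V) \<and> x = (\<Sum>u\<in>V. var u * a u)}"
  have "irrelevant_ideal V \<subseteq> ?J"
    unfolding irrelevant_ideal_def
  proof (rule poly_genideal_least)
    show "ideal ?J (poly_ring V)"
    proof (rule poly_idealI)
      show "?J \<subseteq> polys V" by auto
      show "0 \<in> ?J" by (auto intro!: exI[of _ "\<lambda>_. 0"])
      fix f g assume g: "g \<in> ?J"
      then obtain b where b: "\<forall>u\<in>V. b u \<in> polys V" "g = (\<Sum>u\<in>V. var u * b u)" by blast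
      show "f + g \<in> ?J" if f: "f \<in> ?J"
      proof -
        obtain a where a: "\<forall>u\<in>V. a u \<in> polys V" "f = (\<Sum>u\<in>V. var u * a u)" using f by blast
        then show ?thesis using b
          by (auto intro!: exI[of _ "\<lambda>u. a u + b u"] simp: ring_distribs sum.distrib)
      qed
      show "f * g \<in> ?J" if f: "f \<in> polys V"
        using b f by (auto intro!: exI[of _ "\<lambda>u. f * b u"] simp: sum_distrib_left mult_ac)
    qed
    show "var ` V \<subseteq> ?J"
    proof
      fix y assume "y \<in> var ` V"
      then obtain v where v: "v \<in> V" "y = var v" by blast
      then show "y \<in> ?J"
        using fin by (auto intro!: exI[of _ "\<lambda>u. if u = v then 1 else 0"] simp: if_distrib[of "\<lambda>p. _ * p"] cong: if_cong)
    qed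
  qed
  then show ?thesis using assms by blast
qed

lemma koszul_class_quotient:
  fixes J :: "('v, 'k::field) mpoly set"
  assumes J: "ideal J (poly_ring V)" and x: "x \<in> irrelevant_ideal V"
    and regular: "\<And>y. y \<in> polys V \<Longrightarrow> x * y \<in> J \<Longrightarrow> y \<in> J"
    and J': "ideal J' (poly_ring V)" "J \<subseteq> J'" "x \<in> J'"
    and J'_sub: "J' \<subseteq> {j + x * c | j c. j \<in> J \<and> c \<in> polys V}"
    and "koszul_class J q"
  shows "koszul_class J' (Suc q)"
proof -
  obtain z where z: "\<And>F. F \<subseteq> V \<Longrightarrow> z F \<in> polys V" "\<And>F. F \<subseteq> V \<Longrightarrow> card F < q \<Longrightarrow> z F = 0"
      "\<And>F. F \<subseteq> V \<Longrightarrow> bd V z F \<in> J"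
      and nz: "\<not> koszul_boundary J z"
    using assms(8) unfolding koszul_class_def by blast
  obtain a where a: "\<And>u. u \<in> V \<Longrightarrow> a u \<in> polys V" "x = (\<Sum>u\<in>V. var u * a u)"
    using irrelevant_ideal_decomposition[OF x] by blast
  \<comment> \<open>\<open>y\<close> is the homotopy for \<open>x\<close> applied to
    \<open>z\<close>. Its boundary is \<open>x z\<close> up to the error \<open>k\<close>, which
    applies the homotopy to the boundary of \<open>z\<close> and therefore lies in
    \<open>J\<close>.\<close>
  define y where "y F = (\<Sum>u\<in>V. a u * hp u z F)" for F
  define k where "k F = (\<Sum>u\<in>V. a u * hp u (bd V z) F)" for F
  have bdy: "bd V y F = x * z F - k F" if "F \<subseteq> V" for F
  proof -
    have "bd V y F = (\<Sum>u\<in>V. a u * bd V (hp u z) F)"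
      unfolding y_def by (simp add: bd_sum bd_mult)
    also have "\<dots> = (\<Sum>u\<in>V. a u * (var u * z F - hp u (bd V z) F))"
    proof (intro sum.cong refl)
      fix u assume "u \<in> V"
      have "bd V (hp u z) F = var u * z F - hp u (bd V z) F"
        using bd_hp[OF \<open>u \<in> V\<close> that, of z] by (simp add: eq_diff_eq)
      then show "a u * bd V (hp u z) F = a u * (var u * z F - hp u (bd V z) F)" by simp
    qed
    finally show ?thesis
      by (simp add: a(2) k_def ring_distribs sum_subtractf sum_distrib_left sum_distrib_right mult_ac)
  qed
  have kJ: "k F \<in> J" if "F \<subseteq> V" for F
    unfolding k_def hp_def
    using that z(3)[of "F - {_}"] a(1) poly_ideal_zero[OF J]
    by (intro poly_ideal_sum[OF J] poly_ideal_mult[OF J]) (auto intro!: poly_ideal_mult[OF J])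
  have "y F \<in> polys V" if "F \<subseteq> V" for F
    unfolding y_def hp_def using that z(1)[of "F - {_}"] a(1)
    by (intro polys_sum polys_mult) (auto intro!: polys_mult)
  \<comment> \<open>\<open>hp\<close> reads \<open>z\<close> at a set with one element less, so the
    range of degrees in which the chain vanishes grows by one.\<close>
  moreover have "y F = 0" if F: "F \<subseteq> V" "card F < Suc q" for F
    unfolding y_def
  proof (intro sum.neutral ballI)
    fix u assume "u \<in> V"
    have "z (F - {u}) = 0" if "u \<in> F"
      using that F fin_sub[OF F(1)] card_Diff_singleton[OF that] card_gt_0_iff[of F]
      by (intro z(2)) auto
    then show "a u * hp u z F = 0" by (simp add: hp_def)
  qed
  moreover have "bd V y F \<in> J'" if F: "F \<subseteq> V" for F
    unfolding bdy[OF F]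
    using poly_ideal_mult[OF J'(1) z(1)[OF F] J'(3)] kJ[OF F] J'(2)
    by (auto intro!: poly_ideal_diff[OF J'(1)] simp: mult_ac)
  moreover have "\<not> koszul_boundary J' y"
  proof
    assume "koszul_boundary J' y"
    then obtain b where b: "\<forall>F\<subseteq>V. b F \<in> polys V" "\<forall>F\<subseteq>V. y F - bd V b F \<in> J'"
      unfolding koszul_boundary_def by blast
    have "\<forall>F. \<exists>j c. F \<subseteq> V \<longrightarrow> j \<in> J \<and> c \<in> polys V \<and> y F - bd V b F = j + x * c"
      using b(2) J'_sub by blast
    then obtain j c where jc: "\<And>F. F \<subseteq> V \<Longrightarrow> j F \<in> J" "\<And>F. F \<subseteq> V \<Longrightarrow> c F \<in> polys V"
        "\<And>F. F \<subseteq> V \<Longrightarrow> y F - bd V b F = j F + x * c F" by metis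
    have "z F - bd V c F \<in> J" if F: "F \<subseteq> V" for F
    proof (rule regular)
      show "z F - bd V c F \<in> polys V" using z(1)[OF F] bd_polys[OF _ F jc(2)] by auto
      \<comment> \<open>Taking the boundary once more removes \<open>b\<close> and shows that
        \<open>x z\<close> equals \<open>x\<close> times the boundary of \<open>c\<close> modulo
        \<open>J\<close>. Cancelling the nonzerodivisor \<open>x\<close>, the chain \<open>c\<close>
        would bound \<open>z\<close>.\<close>
      have "bd V (\<lambda>F. y F - bd V b F) F = bd V (\<lambda>F. j F + x * c F) F"
        using jc(3) F by (intro bd_cong) auto
      then have "x * z F - k F = bd V j F + x * bd V c F"
        by (simp add: bd_diff bd_add bd_mult bd_bd F bdy)
      then have "x * (z F - bd V c F) = k F + bd V j F"
        by (simp add: algebra_simps)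
      then show "x * (z F - bd V c F) \<in> J"
        using kJ[OF F] bd_in_ideal[OF J subset_refl F jc(1)] poly_ideal_add[OF J] by simp
    qed
    then show False using nz jc(2) unfolding koszul_boundary_def by blast
  qed
  ultimately show ?thesis unfolding koszul_class_def by blast
qed

lemma koszul_class_le:
  assumes "ideal J (poly_ring V)" "koszul_class J q"
  shows "q \<le> card V"
proof (rule ccontr)
  assume "\<not> q \<le> card V"
  obtain z where z: "\<forall>F\<subseteq>V. card F < q \<longrightarrow> z F = 0"
      and nz: "\<not> koszul_boundary J z"
    using assms(2) unfolding koszul_class_def by blast
  have "z F = 0" if "F \<subseteq> V" for F
    using z that \<open>\<not> q \<le> card V\<close> card_mono[OF fin that] by simp
  then have "z F - bd V (\<lambda>_. 0) F \<in> J" if "F \<subseteq> V" for F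
    using that by (simp add: bd_def poly_ideal_zero[OF assms(1)])
  then have "koszul_boundary J z"
    unfolding koszul_boundary_def by (intro exI[of _ "\<lambda>_. 0"]) simp
  then show False using nz by simp
qed

lemma koszul_class_regular_mod:
  fixes I :: "('v, 'k::field) mpoly set"
  assumes I: "ideal I (poly_ring V)" and "koszul_class I q"
    and xs: "regular_mod (poly_ring V) I xs" "set xs \<subseteq> irrelevant_ideal V"
  shows "q + length xs \<le> card V"
proof -
  let ?S = "poly_ring V :: ('v, 'k) mpoly ring"
  let ?J = "\<lambda>i. Idl\<^bsub>?S\<^esub> (I \<union> set (take i xs))"
  have sub: "I \<union> set (take i xs) \<subseteq> polys V" for i
    using xs(1) poly_ideal_subset[OF I] set_take_subset[of i xs] unfolding regular_mod_def by blast
  have id: "ideal (?J i) ?S" for i by (rule poly_genideal_ideal[OF sub])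
  have "koszul_class (?J i) (q + i)" if "i \<le> length xs" for i
    using that
  proof (induction i)
    case 0
    have "?J 0 = I"
      using poly_genideal_least[OF I, of I] poly_genideal_superset[OF sub[of 0]] by simp
    then show ?case using assms(2) by simp
  next
    case (Suc i)
    have i: "i < length xs" using Suc.prems by simp
    have "koszul_class (?J (Suc i)) (Suc (q + i))"
    proof (rule koszul_class_quotient[OF id])
      show "koszul_class (?J i) (q + i)" using Suc by simp
      show "xs ! i \<in> irrelevant_ideal V" using xs(2) i by auto
      show "y \<in> ?J i" if "y \<in> polys V" "xs ! i * y \<in> ?J i" for y
        using xs(1) i that unfolding regular_mod_def by simp
      show "ideal (?J (Suc i)) ?S" by (rule id)
      have tk: "set (take (Suc i) xs) = insert (xs ! i) (set (take i xs))"
        using i by (simp add: take_Suc_conv_app_nth)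
      show "xs ! i \<in> ?J (Suc i)" using poly_genideal_superset[OF sub[of "Suc i"]] tk by auto
      show "?J i \<subseteq> ?J (Suc i)"
        using poly_genideal_superset[OF sub[of "Suc i"]] tk by (intro poly_genideal_least id) auto
      have xc: "xs ! i \<in> polys V" using sub[of "Suc i"] tk by auto
      \<comment> \<open>Adjoining one entry to the previous ideal gives just the sums of this shape,
        which is what \<open>koszul_class_quotient\<close> asks for.\<close>
      let ?K = "{j + xs ! i * c | j c. j \<in> ?J i \<and> c \<in> polys V}"
      show "?J (Suc i) \<subseteq> ?K"
      proof (rule poly_genideal_least)
        show "ideal ?K ?S"
        proof (rule poly_idealI)
          show "?K \<subseteq> polys V" using poly_ideal_subset[OF id] xc by blast
          show "0 \<in> ?K" using poly_ideal_zero[OF id]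
            by (auto intro!: exI[of _ 0])
          fix f g assume g: "g \<in> ?K"
          then obtain j c where g: "j \<in> ?J i" "c \<in> polys V" "g = j + xs ! i * c" by blast
          show "f + g \<in> ?K" if "f \<in> ?K"
          proof -
            obtain j' c' where f: "j' \<in> ?J i" "c' \<in> polys V" "f = j' + xs ! i * c'" using \<open>f \<in> ?K\<close> by blast
            have "f + g = (j' + j) + xs ! i * (c' + c)" using f g by (simp add: algebra_simps)
            moreover have "j' + j \<in> ?J i" "c' + c \<in> polys V" using f g poly_ideal_add[OF id] by auto
            ultimately show ?thesis by blast
          qed
          show "f * g \<in> ?K" if "f \<in> polys V"
          proof -
            have "f * g = f * j + xs ! i * (f * c)" using g by (simp add: algebra_simps)
            moreover have "f * j \<in> ?J i" "f * c \<in> polys V" using that g poly_ideal_mult[OF id] by auto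
            ultimately show ?thesis by blast
          qed
        qed
        have "j \<in> ?K" if "j \<in> ?J i" for j
        proof -
          have "j = j + xs ! i * 0" by simp
          then show ?thesis using that polys_zero by blast
        qed
        moreover have "xs ! i \<in> ?K"
        proof -
          have "xs ! i = 0 + xs ! i * 1" by simp
          then show ?thesis using poly_ideal_zero[OF id] polys_one by blast
        qed
        ultimately show "I \<union> set (take (Suc i) xs) \<subseteq> ?K"
          using poly_genideal_superset[OF sub[of i]] unfolding tk by blast
      qed
    qed
    then show ?case by simp
  qed
  from koszul_class_le[OF id this[of "length xs"]] show ?thesis by simp
qed

theorem depth_le_koszul_class:
  fixes I :: "('v, 'k::field) mpoly set"
  assumes I: "ideal I (poly_ring V)" and "koszul_class I q"
  shows "depth_quot V I \<le> enat (card V - q)"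
proof -
  have sub: "irrelevant_ideal V \<subseteq> (polys V :: ('v, 'k) mpoly set)"
    by (auto simp: irrelevant_ideal_eq mono_ideal_def)
  show ?thesis
    unfolding cring.depth_Quot[OF cring_poly_ring I sub]
    using koszul_class_regular_mod[OF I assms(2)] by (fastforce intro!: Sup_least)
qed

end

section \<open>Setting a variable to zero, and colon ideals by a variable\<close>

definition set_zero :: "'v \<Rightarrow> ('v, 'k::field) mpoly \<Rightarrow> ('v, 'k) mpoly" where
  "set_zero u f = (\<Sum>t\<in>{t\<in>keys f. u \<notin> keys t}.
     single t (lookup f t))"

lemma lookup_set_zero:
  "lookup (set_zero u f) t = (if u \<in> keys t then 0 else lookup f t)"
  by (auto simp: set_zero_def lookup_sum lookup_single when_def in_keys_iff)

lemma set_zero_add: "set_zero u (f + g) = set_zero u f + set_zero u g"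
  by (intro poly_mapping_eqI) (simp add: lookup_set_zero lookup_add)

lemma set_zero_diff: "set_zero u (f - g) = set_zero u f - set_zero u g"
  by (intro poly_mapping_eqI) (simp add: lookup_set_zero lookup_minus)

lemma set_zero_zero [simp]: "set_zero u 0 = 0"
  by (intro poly_mapping_eqI) (simp add: lookup_set_zero)

lemma set_zero_sum: "set_zero u (\<Sum>i\<in>A. f i) = (\<Sum>i\<in>A. set_zero u (f i))"
  by (induction A rule: infinite_finite_induct) (simp_all add: set_zero_add)

lemma keys_set_zero: "keys (set_zero u f) \<subseteq> keys f"
proof
  fix t assume "t \<in> keys (set_zero u f)"
  then have "lookup (set_zero u f) t \<noteq> 0" unfolding in_keys_iff .
  then have "lookup f t \<noteq> 0" unfolding lookup_set_zero by presburger
  then show "t \<in> keys f" unfolding in_keys_iff .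
qed

lemma set_zero_polys [intro]: "f \<in> polys V \<Longrightarrow> set_zero u f \<in> polys V"
  using keys_set_zero[of u f] unfolding in_polys by blast

lemma set_zero_mono_ideal: "f \<in> mono_ideal V M \<Longrightarrow> set_zero u f \<in> mono_ideal V M"
  using keys_set_zero[of u f] unfolding mono_ideal_def by blast

lemma set_zero_var_mult:
  fixes f :: "('v, 'k::field) mpoly"
  shows "set_zero u (var v * f) = (if v = u then 0 else var v * set_zero u f)"
proof (rule poly_mapping_eqI)
  fix t
  show "lookup (set_zero u (var v * f)) t =
      lookup (if v = u then 0 else var v * set_zero u f) t"
    by (auto simp: lookup_set_zero lookup_var_mult in_keys_iff lookup_minus lookup_single when_def)
qed

lemma set_zero_remainder:
  fixes f :: "('v, 'k::field) mpoly"
  assumes "f \<in> polys V"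
  shows "\<exists>c\<in>polys V. f = set_zero u f + var u * c"
proof
  let ?c = "\<Sum>t\<in>{t\<in>keys f. u \<in> keys t}.
     single (t - single u 1) (lookup f t)"
  show "?c \<in> polys V"
  proof (intro polys_sum polys_single)
    fix t assume "t \<in> {t\<in>keys f. u \<in> keys t}"
    then have "keys t \<subseteq> V" using assms by (auto simp: in_polys)
    moreover have "keys (t - single u 1) \<subseteq> keys t"
      by (auto simp: in_keys_iff lookup_minus)
    ultimately show "keys (t - single u 1) \<subseteq> V" by blast
  qed
  have "var u * ?c = (\<Sum>t\<in>{t\<in>keys f. u \<in> keys t}.
      single t (lookup f t))"
    unfolding sum_distrib_left var_def mult_single
  proof (intro sum.cong refl)
    fix t assume "t \<in> {t\<in>keys f. u \<in> keys t}"
    then have "single u 1 + (t - single u 1) = t"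
      by (intro poly_mapping_eqI) (auto simp: lookup_add lookup_minus lookup_single when_def in_keys_iff)
    then show "single (single u 1 + (t - single u 1)) (1 * lookup f t)
      = single t (lookup f t)" by simp
  qed
  then have "set_zero u f + var u * ?c = (\<Sum>t\<in>keys f. single t (lookup f t))"
    unfolding set_zero_def
    by (simp only: sum.union_disjoint[symmetric] finite_keys finite_Collect_conjI)
       (subst sum.union_disjoint[symmetric], auto intro!: sum.cong)
  then show "f = set_zero u f + var u * ?c" using poly_eq_sum_single[of f] by simp
qed

context koszul
begin

lemma set_zero_ksign_mult: "set_zero u (ksign v F * f) = ksign v F * set_zero u f"
  by (intro poly_mapping_eqI) (simp add: lookup_set_zero ksign_def lookup_neg_one_power_mult)

text \<open>Passing to a colon ideal by a variable does not raise the projective dimension. If \<open>z\<close> is a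
  cycle modulo \<open>(J : x\<^sub>u)\<close> and \<open>x\<^sub>u z\<close> is a boundary \<open>\<partial>b\<close> modulo \<open>J\<close>, then the coefficient of
  \<open>e\<^sub>u\<close> in \<open>b\<close>, with \<open>x\<^sub>u\<close> set to zero, is a cycle modulo \<open>J\<close>.\<close>

lemma koszul_class_colon:
  fixes J :: "('v, 'k::field) mpoly set"
  assumes J: "ideal J (poly_ring V)" and stable: "\<And>f. f \<in> J \<Longrightarrow> set_zero u f \<in> J" and u: "u \<in> V"
    and "koszul_class {f\<in>polys V. var u * f \<in> J} q"
  shows "koszul_class J q"
proof (rule ccontr)
  assume no: "\<not> koszul_class J q"
  let ?J' = "{f\<in>polys V. var u * f \<in> J}"
  have bnd: "koszul_boundary J z" if "\<forall>F\<subseteq>V. z F \<in> polys V" "\<forall>F\<subseteq>V. card F < q \<longrightarrow> z F = 0"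
      "\<forall>F\<subseteq>V. bd V z F \<in> J" for z :: "'v set \<Rightarrow> ('v, 'k) mpoly"
    using no that unfolding koszul_class_def by blast
  obtain z where z: "\<forall>F\<subseteq>V. z F \<in> polys V" "\<forall>F\<subseteq>V. card F < q \<longrightarrow> z F = 0" "\<forall>F\<subseteq>V. bd V z F \<in> ?J'"
      and nz: "\<not> koszul_boundary ?J' z"
    using assms(4) unfolding koszul_class_def by blast
  have "koszul_boundary J (\<lambda>F. var u * z F)"
    using z u by (intro bnd) (auto simp: bd_mult)
  then obtain b' where b': "\<And>F. F \<subseteq> V \<Longrightarrow> b' F \<in> polys V" "\<And>F. F \<subseteq> V \<Longrightarrow> var u * z F - bd V b' F \<in> J"
    unfolding koszul_boundary_def by blast
  \<comment> \<open>The part of \<open>b'\<close> in degrees up to \<open>q\<close> is cut off. It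
    contributes to boundaries only in degrees below \<open>q\<close>, where \<open>z\<close>
    vanishes anyway, and without it the chain \<open>b1\<close>, which reads \<open>b\<close> at
    \<open>insert u F\<close>, vanishes below \<open>q\<close>.\<close>
  define b where "b F = (if card F \<le> q then 0 else b' F)" for F
  have b: "b F \<in> polys V" if "F \<subseteq> V" for F using b'(1)[OF that] by (simp add: b_def)
  have bz: "var u * z F - bd V b F \<in> J" if F: "F \<subseteq> V" for F
  proof (cases "card F < q")
    case True
    have "bd V b F = bd V (\<lambda>_. 0) F"
      using True fin_sub[OF F] by (intro bd_cong) (simp add: b_def)
    then show ?thesis using True z(2) F poly_ideal_zero[OF J] by (simp add: bd_def)
  next
    case False
    have "bd V b F = bd V b' F"
      using False fin_sub[OF F] by (intro bd_cong) (simp add: b_def)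
    then show ?thesis using b'(2)[OF F] by simp
  qed
  have bdb: "set_zero u (bd V b F) \<in> J" if F: "F \<subseteq> V" for F
    using stable[OF poly_ideal_uminus[OF J bz[OF F]]]
    by (simp add: set_zero_diff set_zero_var_mult)
  \<comment> \<open>With \<open>x\<^sub>u\<close> set to zero, \<open>b\<close> splits into
    \<open>b0\<close>, the part free of \<open>e\<^sub>u\<close>, and \<open>hp u b1\<close>. Both
    \<open>b0\<close> and \<open>b1\<close> are cycles modulo \<open>J\<close>, because
    \<open>x\<^sub>u z\<close> disappears under the substitution.\<close>
  define b0 where "b0 F = (if u \<in> F then 0 else set_zero u (b F))" for F
  define b1 where "b1 F = (if u \<in> F then 0 else ksign u F * set_zero u (b (insert u F)))" for F
  have bd0: "bd V b0 F \<in> J" if F: "F \<subseteq> V" for F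
  proof (cases "u \<in> F")
    case True
    then have "bd V b0 F = 0" by (simp add: bd_def b0_def)
    then show ?thesis using poly_ideal_zero[OF J] by simp
  next
    case False
    have "bd V b0 F = set_zero u (bd V b F)"
      unfolding bd_def set_zero_sum mult.assoc set_zero_ksign_mult set_zero_var_mult b0_def
      using False by (intro sum.cong) auto
    then show ?thesis using bdb[OF F] by simp
  qed
  have bd1: "bd V b1 F \<in> J" if F: "F \<subseteq> V" for F
  proof (cases "u \<in> F")
    case True
    then have "bd V b1 F = 0" by (simp add: bd_def b1_def)
    then show ?thesis using poly_ideal_zero[OF J] by simp
  next
    case False
    have VF: "V - F = insert u (V - insert u F)" using u False by auto
    have "bd V b1 F = ksign u F * var u * b1 (insert u F) + (\<Sum>v\<in>V - insert u F. ksign v F * var v * b1 (insert v F))"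
      unfolding bd_def VF using fin by (subst sum.insert) auto
    also have "\<dots> = (\<Sum>v\<in>V - insert u F. ksign v F * var v * b1 (insert v F))" by (simp add: b1_def)
    also have "\<dots> = (\<Sum>v\<in>V - insert u F. - (ksign u F * (ksign v (insert u F) * (var v * set_zero u (b (insert v (insert u F)))))))"
    proof (intro sum.cong refl)
      fix v assume v: "v \<in> V - insert u F"
      then have uv: "u \<noteq> v" by blast
      have "ksign v F * var v * b1 (insert v F) =
          ksign v F * (ksign u (insert v F) * (var v * set_zero u (b (insert v (insert u F)))))"
        using uv False by (simp add: b1_def insert_commute mult_ac)
      also have "\<dots> = - (ksign u F * (ksign v (insert u F) * (var v * set_zero u (b (insert v (insert u F))))))"
        by (rule ksign_swap_left) (use v False F u fin_sub in auto)
      finally show "ksign v F * var v * b1 (insert v F) = \<dots>" .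
    qed
    also have "\<dots> = - ksign u F * set_zero u (bd V b (insert u F))"
      unfolding bd_def set_zero_sum sum_distrib_left
    proof (intro sum.cong refl)
      fix v assume "v \<in> V - insert u F"
      then have "v \<noteq> u" by blast
      then show "- (ksign u F * (ksign v (insert u F) * (var v * set_zero u (b (insert v (insert u F)))))) =
          - ksign u F * set_zero u (ksign v (insert u F) * var v * b (insert v (insert u F)))"
        by (simp add: mult.assoc set_zero_ksign_mult set_zero_var_mult)
    qed
    finally show ?thesis
      using bdb[of "insert u F"] F u ksign_polys[of u F]
      by (auto intro!: poly_ideal_mult[OF J] poly_ideal_uminus[OF J])
  qed
  have b0p: "b0 F \<in> polys V" "b1 F \<in> polys V" if "F \<subseteq> V" for F
    using that u b[of F] b[of "insert u F"] by (auto simp: b0_def b1_def intro!: polys_mult)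
  have "koszul_boundary J b1"
  proof (rule bnd)
    show "\<forall>F\<subseteq>V. card F < q \<longrightarrow> b1 F = 0"
    proof (intro allI impI)
      fix F assume "F \<subseteq> V" "card F < q"
      then have "card (insert u F) \<le> q" using fin_sub[of F] card_insert_le_m1 by (simp add: card_insert_if)
      then show "b1 F = 0" by (simp add: b1_def b_def)
    qed
  qed (use b0p bd1 in auto)
  then obtain c where c: "\<And>F. F \<subseteq> V \<Longrightarrow> c F \<in> polys V" "\<And>F. F \<subseteq> V \<Longrightarrow> b1 F - bd V c F \<in> J"
    unfolding koszul_boundary_def by blast
  have "\<forall>F. \<exists>d. F \<subseteq> V \<longrightarrow> d \<in> polys V \<and> b F = set_zero u (b F) + var u * d"
    using set_zero_remainder[OF b] by blast
  then obtain d where d: "\<And>F. F \<subseteq> V \<Longrightarrow> d F \<in> polys V" "\<And>F. F \<subseteq> V \<Longrightarrow> b F = set_zero u (b F) + var u * d F"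
    by metis
  have b01: "set_zero u (b F) = b0 F + hp u b1 F" for F
    by (simp add: b0_def b1_def hp_def insert_absorb ksign_square_left)
  have "koszul_boundary ?J' z"
    unfolding koszul_boundary_def
  proof (intro exI conjI allI impI)
    fix F assume F: "F \<subseteq> V"
    show "c F + d F \<in> polys V" using c d F by auto
    have zd: "z F - bd V (\<lambda>F. c F + d F) F \<in> polys V"
      using z(1) F c(1) d(1) by (auto intro!: polys_diff bd_polys)
    have "bd V b F = bd V (\<lambda>F. b0 F + (hp u b1 F + var u * d F)) F"
      using d(2) b01 F u by (intro bd_cong) (simp add: add.assoc)
    also have "\<dots> = bd V b0 F + (bd V (hp u b1) F + var u * bd V d F)"
      by (simp add: bd_add bd_mult)
    also have "bd V (hp u b1) F = var u * b1 F - hp u (bd V b1) F"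
      using bd_hp[OF u F, of b1] by (simp add: eq_diff_eq)
    \<comment> \<open>Since \<open>b\<close> equals \<open>b0 + hp u b1 + x\<^sub>u d\<close> and
      \<open>b1\<close> is the boundary of \<open>c\<close> modulo \<open>J\<close>, the chain
      \<open>x\<^sub>u z\<close> agrees modulo \<open>J\<close> with \<open>x\<^sub>u\<close> times
      the boundary of \<open>c + d\<close>. Each summand on the right lies in
      \<open>J\<close>.\<close>
    finally have decomp: "var u * (z F - bd V (\<lambda>F. c F + d F) F) =
        (var u * z F - bd V b F) + (bd V b0 F + (var u * (b1 F - bd V c F) - hp u (bd V b1) F))"
      by (simp add: bd_add algebra_simps)
    have h: "hp u (bd V b1) F \<in> J"
      using bd1[of "F - {u}"] F poly_ideal_zero[OF J] by (auto simp: hp_def intro!: poly_ideal_mult[OF J])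
    have "var u * (b1 F - bd V c F) \<in> J"
      using c(2)[OF F] u by (intro poly_ideal_mult[OF J]) auto
    from poly_ideal_add[OF J bz[OF F] poly_ideal_add[OF J bd0[OF F] poly_ideal_diff[OF J this h]]]
    have "var u * (z F - bd V (\<lambda>F. c F + d F) F) \<in> J" unfolding decomp .
    then show "z F - bd V (\<lambda>F. c F + d F) F \<in> ?J'" using zd by simp
  qed
  then show False using nz by simp
qed

section \<open>Explicit Koszul cycles that are not boundaries\<close>

lemma lookup_bd_zero: "lookup (bd A b F) 0 = 0"
  by (simp add: bd_def lookup_sum mult.assoc ksign_def lookup_neg_one_power_mult lookup_var_mult)

text \<open>The basis element \<open>e\<^sub>W\<close> is a cycle because its boundary has variables
  of \<open>W\<close> as coefficients, up to sign. It bounds nothing: neither boundaries nor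
  elements of \<open>J\<close> have constant terms.\<close>

lemma koszul_class_variables:
  fixes J :: "('v, 'k::field) mpoly set"
  assumes J: "ideal J (poly_ring V)" and W: "W \<subseteq> V" "\<And>v. v \<in> W \<Longrightarrow> var v \<in> J"
    and proper: "\<And>f. f \<in> J \<Longrightarrow> lookup f 0 = 0"
  shows "koszul_class J (card W)"
proof -
  define z :: "'v set \<Rightarrow> ('v, 'k) mpoly" where "z F = (if F = W then 1 else 0)" for F
  have "bd V z F \<in> J" for F
    unfolding bd_def
  proof (intro poly_ideal_sum[OF J])
    fix v assume "v \<in> V - F"
    show "ksign v F * var v * z (insert v F) \<in> J"
    proof (cases "insert v F = W")
      case True
      then show ?thesis using W(2)[of v] by (auto simp: z_def intro!: poly_ideal_mult[OF J])
    qed (simp add: z_def poly_ideal_zero[OF J])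
  qed
  moreover have "\<not> koszul_boundary J z"
  proof
    assume "koszul_boundary J z"
    then obtain b where "z W - bd V b W \<in> J" using W(1) unfolding koszul_boundary_def by blast
    from proper[OF this] show False by (simp add: lookup_minus lookup_bd_zero z_def)
  qed
  ultimately show ?thesis
    unfolding koszul_class_def by (intro exI[of _ z]) (auto simp: z_def)
qed

lemma lookup_bd_single:
  fixes b :: "'v set \<Rightarrow> ('v, 'k::field) mpoly"
  assumes "a \<in> A" "a \<notin> F" "finite A"
  shows "lookup (bd A b F) (single a 1) =
    (- 1) ^ card {w\<in>F. ix w < ix a} * lookup (b (insert a F)) 0"
proof -
  have "lookup (bd A b F) (single a 1) =
    (\<Sum>v\<in>A - F. if v = a then (- 1) ^ card {w\<in>F. ix w < ix v} * lookup (b (insert v F)) 0 else 0)"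
    unfolding bd_def lookup_sum mult.assoc ksign_def lookup_neg_one_power_mult lookup_var_mult
    by (intro sum.cong) auto
  then show ?thesis using assms by simp
qed

text \<open>The cycle is the boundary of \<open>e\<^sub>W\<close>, \<open>W = A \<union> B\<close>,
  taken along \<open>A\<close> only. Under the full boundary its part along \<open>A\<close> gives
  zero, and the rest gives products of a variable in \<open>A\<close> with one in \<open>B\<close>,
  which lie in \<open>J\<close>.\<close>

lemma koszul_class_complete_bipartite:
  fixes J :: "('v, 'k::field) mpoly set"
  assumes J: "ideal J (poly_ring V)" and AB: "A \<subseteq> V" "B \<subseteq> V" "A \<inter> B = {}" "A \<noteq> {}" "B \<noteq> {}"
    and edges: "\<And>a b. a \<in> A \<Longrightarrow> b \<in> B \<Longrightarrow> var a * var b \<in> J"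
    and no_linear: "\<And>f v. f \<in> J \<Longrightarrow> v \<in> V \<Longrightarrow> lookup f (single v 1) = 0"
  shows "koszul_class J (card A + card B - 1)"
proof -
  let ?W = "A \<union> B"
  define e :: "'v set \<Rightarrow> ('v, 'k) mpoly" where "e F = (if F = ?W then 1 else 0)" for F
  have finA: "finite A" "finite B" using AB fin_sub by auto
  have ep: "\<forall>F\<subseteq>V. bd A e F \<in> polys V"
    using AB by (auto intro!: bd_polys simp: e_def)
  have "bd A e F = 0" if F: "F \<subseteq> V" "card F < card A + card B - 1" for F
    unfolding bd_def
  proof (intro sum.neutral ballI)
    fix v assume "v \<in> A - F"
    then have "card (insert v F) < card ?W"
      using F fin_sub[OF F(1)] AB finA by (simp add: card_Un_disjoint)
    then show "ksign v F * var v * e (insert v F) = 0" by (auto simp: e_def)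
  qed
  moreover have "bd V (bd A e) F \<in> J" if F: "F \<subseteq> V" for F
  proof -
    have VF: "V - F = (A - F) \<union> (V - A - F)" using AB by auto
    have "bd V (bd A e) F = bd A (bd A e) F + bd (V - A) (bd A e) F"
      unfolding bd_def[of V] bd_def[of A "bd A e"] bd_def[of "V - A"] VF
      by (rule sum.union_disjoint) (use fin finA in auto)
    also have "\<dots> = bd (V - A) (bd A e) F" using bd_bd[OF AB(1) F] by simp
    also have "\<dots> \<in> J"
      unfolding bd_def sum_distrib_left
    proof (intro poly_ideal_sum[OF J])
      fix v a assume v: "v \<in> V - A - F" and a: "a \<in> A - insert v F"
      show "ksign v F * var v * (ksign a (insert v F) * var a * e (insert a (insert v F))) \<in> J"
      proof (cases "insert a (insert v F) = ?W")
        case True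
        then have "v \<in> B" using v by blast
        have "ksign v F * var v * (ksign a (insert v F) * var a * e (insert a (insert v F))) =
          ksign v F * ksign a (insert v F) * (var a * var v)" using True by (simp add: e_def mult_ac)
        also have "\<dots> \<in> J"
          using \<open>v \<in> B\<close> a by (intro poly_ideal_mult[OF J polys_mult[OF ksign_polys ksign_polys] edges]) auto
        finally show ?thesis .
      qed (simp add: e_def poly_ideal_zero[OF J])
    qed
    finally show ?thesis .
  qed
  moreover have "\<not> koszul_boundary J (bd A e)"
  proof
    assume "koszul_boundary J (bd A e)"
    then obtain b where b: "\<And>F. F \<subseteq> V \<Longrightarrow> bd A e F - bd V b F \<in> J" unfolding koszul_boundary_def by blast
    \<comment> \<open>A bounding chain \<open>b\<close> is refuted by the linear coefficients, which
      vanish on \<open>J\<close>: at \<open>W - {a}\<close> the coefficient of \<open>a\<close>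
      forces the constant term of \<open>b W\<close> to be 1, at \<open>W - {c}\<close> that of
      \<open>c\<close> forces it to be 0.\<close>
    obtain a where a: "a \<in> A" using AB by blast
    obtain c where c: "c \<in> B" using AB by blast
    have W: "insert a (?W - {a}) = ?W" "insert c (?W - {c}) = ?W" using a c by auto
    have sub: "?W - {a} \<subseteq> V" "?W - {c} \<subseteq> V" and V: "a \<in> V" "c \<in> V" using a c AB by auto
    have "A - (?W - {c}) = {}" using c AB(3) by blast
    then have ec: "bd A e (?W - {c}) = 0" by (simp only: bd_def sum.empty)
    have la: "lookup (bd A e (?W - {a})) (single a 1) =
        (- 1) ^ card {w\<in>?W - {a}. ix w < ix a} * lookup (e ?W) 0"
      "lookup (bd V b (?W - {a})) (single a 1) =
        (- 1) ^ card {w\<in>?W - {a}. ix w < ix a} * lookup (b ?W) 0"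
      "lookup (bd V b (?W - {c})) (single c 1) =
        (- 1) ^ card {w\<in>?W - {c}. ix w < ix c} * lookup (b ?W) 0"
      using lookup_bd_single[of a A "?W - {a}" e] lookup_bd_single[of a V "?W - {a}" b]
        lookup_bd_single[of c V "?W - {c}" b] a c V fin finA unfolding W by blast+
    have "lookup (b ?W) 0 = 1"
      using no_linear[OF b[OF sub(1)] V(1)] unfolding lookup_minus la by (simp add: e_def)
    moreover have "lookup (b ?W) 0 = 0"
      using no_linear[OF b[OF sub(2)] V(2)] unfolding lookup_minus la ec by simp
    ultimately have False by simp
    then show False by simp
  qed
  ultimately show ?thesis
    unfolding koszul_class_def using ep by blast
qed

end

section \<open>Primes generated by variables\<close>

definition var_ideal :: "'v set \<Rightarrow> 'v set \<Rightarrow> ('v, 'k::field) mpoly set" where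
  "var_ideal V D = mono_ideal V {t. keys t \<inter> D \<noteq> {}}"

text \<open>This replaces the leading monomials in the proof that the polynomial ring is a domain, since
  the type of the variables has no linear order.\<close>

lemma exists_unique_sum:
  fixes A B :: "('v \<Rightarrow>\<^sub>0 nat) set"
  assumes "finite V" "finite A" "A \<noteq> {}" "finite B" "B \<noteq> {}"
    and "\<And>s t. s \<in> A \<Longrightarrow> t \<in> A \<Longrightarrow> (\<And>v. v \<in> V \<Longrightarrow> lookup s v = lookup t v) \<Longrightarrow> s = t"
    and "\<And>s t. s \<in> B \<Longrightarrow> t \<in> B \<Longrightarrow> (\<And>v. v \<in> V \<Longrightarrow> lookup s v = lookup t v) \<Longrightarrow> s = t"
  shows "\<exists>a\<in>A. \<exists>b\<in>B. \<forall>s\<in>A. \<forall>t\<in>B. s + t = a + b \<longrightarrow> s = a \<and> t = b"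
  using assms
proof (induction V arbitrary: A B rule: finite_induct)
  case empty
  then show ?case by blast
next
  case (insert v V)
  \<comment> \<open>Restricting both sets to the largest exponent of \<open>v\<close> loses no
    decomposition of \<open>a + b\<close>: if two exponents of \<open>v\<close> add up to
    \<open>m + n\<close>, both are maximal.\<close>
  define m n where "m = Max ((\<lambda>s. lookup s v) ` A)" and "n = Max ((\<lambda>s. lookup s v) ` B)"
  have "m \<in> (\<lambda>s. lookup s v) ` A" "n \<in> (\<lambda>s. lookup s v) ` B"
    unfolding m_def n_def by (intro Max_in finite_imageI insert.prems, simp add: insert.prems)+
  have le: "lookup s v \<le> m" if "s \<in> A" for s
    unfolding m_def using that insert.prems(1) by (intro Max_ge) auto
  have le': "lookup s v \<le> n" if "s \<in> B" for s
    unfolding n_def using that insert.prems(3) by (intro Max_ge) auto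
  let ?A = "{s\<in>A. lookup s v = m}" and ?B = "{s\<in>B. lookup s v = n}"
  have "\<exists>a\<in>?A. \<exists>b\<in>?B. \<forall>s\<in>?A. \<forall>t\<in>?B. s + t = a + b \<longrightarrow> s = a \<and> t = b"
  proof (rule insert.IH)
    show "?A \<noteq> {}" "?B \<noteq> {}"
      using \<open>m \<in> (\<lambda>s. lookup s v) ` A\<close> \<open>n \<in> (\<lambda>s. lookup s v) ` B\<close> by auto
    show "finite ?A" "finite ?B" using insert.prems(1,3) by auto
    show "s = t" if "s \<in> ?A" "t \<in> ?A" "\<And>v. v \<in> V \<Longrightarrow> lookup s v = lookup t v" for s t
      using that by (intro insert.prems(5)) auto
    show "s = t" if "s \<in> ?B" "t \<in> ?B" "\<And>v. v \<in> V \<Longrightarrow> lookup s v = lookup t v" for s t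
      using that by (intro insert.prems(6)) auto
  qed
  then obtain a b where ab: "a \<in> ?A" "b \<in> ?B" and uniq: "\<And>s t. s \<in> ?A \<Longrightarrow> t \<in> ?B \<Longrightarrow> s + t = a + b \<Longrightarrow> s = a \<and> t = b"
    by blast
  have "s = a \<and> t = b" if st: "s \<in> A" "t \<in> B" "s + t = a + b" for s t
  proof -
    have "lookup s v + lookup t v = m + n"
      using st(3) ab by (metis (mono_tags, lifting) lookup_add mem_Collect_eq)
    then have "s \<in> ?A" "t \<in> ?B" using le[OF st(1)] le'[OF st(2)] st by auto
    then show ?thesis using uniq st(3) by blast
  qed
  then show ?case using ab by blast
qed

lemma ideal_var_ideal: "ideal (var_ideal V D) (poly_ring V)"
  unfolding var_ideal_def by (intro ideal_mono_ideal) (auto simp: up_closed_def keys_add_nat)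

lemma var_in_var_ideal: "v \<in> V \<Longrightarrow> var v \<in> var_ideal V D \<longleftrightarrow> v \<in> D"
  unfolding var_ideal_def by (simp add: var_in_mono_ideal_iff)

lemma var_ideal_subset:
  fixes J :: "('v, 'k::field) mpoly set"
  assumes J: "ideal J (poly_ring V)" and D: "\<And>v. v \<in> V \<inter> D \<Longrightarrow> var v \<in> J"
  shows "var_ideal V D \<subseteq> J"
proof
  fix f :: "('v, 'k) mpoly" assume f: "f \<in> var_ideal V D"
  have "single t (lookup f t) \<in> J" if t: "t \<in> keys f" for t
  proof -
    have tV: "keys t \<subseteq> V" and "keys t \<inter> D \<noteq> {}"
      using f t by (auto simp: var_ideal_def mono_ideal_def in_polys)
    then obtain v where v: "v \<in> keys t" "v \<in> V \<inter> D" by blast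
    have eq: "t = (t - single v 1) + single v 1"
      using v(1) by (intro poly_mapping_eqI) (auto simp: lookup_add lookup_minus lookup_single when_def in_keys_iff)
    have "single (t - single v 1) (lookup f t) * var v \<in> J"
      using tV by (intro poly_ideal_mult[OF J] D v polys_single) (metis Un_subset_iff eq keys_add_nat)
    then show ?thesis by (simp add: var_def mult_single eq[symmetric] del: One_nat_def)
  qed
  then show "f \<in> J"
    by (subst poly_eq_sum_single) (intro poly_ideal_sum[OF J])
qed

text \<open>If neither factor lies in the ideal, both have monomials avoiding \<open>D\<close>. Some
  pair of these has a sum that no other pair reaches, so its coefficient in the product is a product
  of nonzero coefficients.\<close>

lemma primeideal_var_ideal:
  assumes V: "finite V"
  shows "primeideal (var_ideal V D :: ('v, 'k::field) mpoly set) (poly_ring V)"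
proof (rule primeidealI[OF ideal_var_ideal cring_poly_ring])
  have "(1 :: ('v, 'k) mpoly) \<notin> var_ideal V D" by (simp add: var_ideal_def mono_ideal_def)
  then show "polys V \<noteq> (var_ideal V D :: ('v, 'k) mpoly set)" using polys_one by blast
  fix f g :: "('v, 'k) mpoly"
  assume fg: "f \<in> polys V" "g \<in> polys V" "f \<otimes>\<^bsub>poly_ring V\<^esub> g \<in> var_ideal V D"
  show "f \<in> var_ideal V D \<or> g \<in> var_ideal V D"
  proof (rule ccontr)
    assume neg: "\<not> (f \<in> var_ideal V D \<or> g \<in> var_ideal V D)"
    define A where "A = {t\<in>keys f. keys t \<inter> D = {}}"
    define B where "B = {t\<in>keys g. keys t \<inter> D = {}}"
    have ext: "s = t" if "keys s \<subseteq> V" "keys t \<subseteq> V"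
        "\<And>v. v \<in> V \<Longrightarrow> lookup s v = lookup t v" for s t :: "'v \<Rightarrow>\<^sub>0 nat"
      using that by (intro poly_mapping_eqI) (metis in_keys_iff subsetD)
    have "\<exists>a\<in>A. \<exists>b\<in>B. \<forall>s\<in>A. \<forall>t\<in>B. s + t = a + b \<longrightarrow> s = a \<and> t = b"
    proof (rule exists_unique_sum[OF V])
      show "finite A" "finite B" by (simp_all add: A_def B_def)
      show "A \<noteq> {}" "B \<noteq> {}" using neg fg by (auto simp: A_def B_def var_ideal_def mono_ideal_def)
      show "s = t" if "s \<in> A" "t \<in> A" "\<And>v. v \<in> V \<Longrightarrow> lookup s v = lookup t v" for s t
        using that fg(1) by (intro ext) (auto simp: A_def in_polys)
      show "s = t" if "s \<in> B" "t \<in> B" "\<And>v. v \<in> V \<Longrightarrow> lookup s v = lookup t v" for s t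
        using that fg(2) by (intro ext) (auto simp: B_def in_polys)
    qed
    then obtain a b where ab: "a \<in> A" "b \<in> B" and uniq: "\<And>s t. s \<in> A \<Longrightarrow> t \<in> B \<Longrightarrow> s + t = a + b \<Longrightarrow> s = a \<and> t = b"
      by blast
    have D: "keys (a + b) \<inter> D = {}" using ab by (auto simp: keys_add_nat A_def B_def)
    \<comment> \<open>Exponents do not cancel, so any two monomials that add up to
      \<open>a + b\<close> avoid \<open>D\<close> too; uniqueness therefore extends from
      \<open>A\<close> and \<open>B\<close> to all monomials of \<open>f\<close> and
      \<open>g\<close>.\<close>
    have uniq': "s = a \<and> t = b" if "s \<in> keys f" "t \<in> keys g" "s + t = a + b" for s t
    proof -
      have "(keys s \<union> keys t) \<inter> D = {}" using D that(3) by (metis keys_add_nat)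
      then show ?thesis using that by (intro uniq) (auto simp: A_def B_def)
    qed
    have "lookup (f * g) (a + b) =
      (\<Sum>s\<in>keys f. \<Sum>t\<in>keys g.
        if t = b then (if s = a then lookup f a * lookup g b else 0) else 0)"
      unfolding lookup_mult_sum by (intro sum.cong refl) (use uniq' in auto)
    also have "\<dots> = lookup f a * lookup g b"
      using ab by (simp add: A_def B_def)
    also have "\<dots> \<noteq> 0" using ab by (simp add: A_def B_def in_keys_iff)
    finally have "a + b \<in> keys (f * g)" by (simp add: in_keys_iff)
    then show False using fg(3) D by (auto simp: var_ideal_def mono_ideal_def)
  qed
qed

section \<open>The dimension of quotients of the polynomial ring\<close>

text \<open>Adjoining the variables outside \<open>D\<close> one at a time gives a chain of
  \<open>card (V - D)\<close> strict inclusions between primes above \<open>I\<close>.\<close>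

theorem krull_dim_ge_var_ideal:
  fixes I :: "('v, 'k::field) mpoly set"
  assumes V: "finite V" and I: "ideal I (poly_ring V)" and D: "D \<subseteq> V" "I \<subseteq> var_ideal V D"
  shows "enat (card (V - D)) \<le> krull_dim (poly_ring V Quot I)"
proof -
  let ?k = "card (V - D)"
  obtain h where h: "bij_betw h {0..<?k} (V - D)"
    using ex_bij_betw_nat_finite[of "V - D"] V by blast
  define P :: "nat \<Rightarrow> ('v, 'k) mpoly set" where "P i = var_ideal V (D \<union> h ` {0..<i})" for i
  have "P i \<subset> P (Suc i)" if i: "i < ?k" for i
  proof
    show "P i \<subseteq> P (Suc i)"
      unfolding P_def var_ideal_def by (intro mono_ideal_mono) auto
    have hi: "h i \<in> V - D" using h i by (auto simp: bij_betw_def)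
    have "h i \<notin> h ` {0..<i}"
    proof
      assume "h i \<in> h ` {0..<i}"
      then obtain j where "j < i" "h i = h j" by auto
      then show False using inj_onD[OF bij_betw_imp_inj_on[OF h], of i j] i by simp
    qed
    then have "var (h i) \<notin> P i" "var (h i) \<in> P (Suc i)"
      using hi by (auto simp: P_def var_in_var_ideal)
    then show "P i \<noteq> P (Suc i)" by blast
  qed
  moreover have "I \<subseteq> P i" for i
    using D(2) unfolding P_def var_ideal_def
    by (rule order_trans) (intro mono_ideal_mono, auto)
  moreover have "primeideal (P i) (poly_ring V)" for i
    unfolding P_def by (rule primeideal_var_ideal[OF V])
  ultimately show ?thesis
    unfolding cring.krull_dim_Quot[OF cring_poly_ring I] by (intro Sup_upper) blast
qed

section \<open>Polynomial relations from counting monomials, and prime chains\<close>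

lemma exists_linear_relation:
  fixes a :: "'x \<Rightarrow> 'y \<Rightarrow> 'k::field"
  assumes "finite Y" "finite X" "card Y < card X"
  shows "\<exists>c. (\<exists>x\<in>X. c x \<noteq> 0) \<and> (\<forall>y\<in>Y. (\<Sum>x\<in>X. c x * a x y) = 0)"
  using assms
proof (induction Y arbitrary: a X rule: finite_induct)
  case empty
  then have "X \<noteq> {}" by auto
  then show ?case by (intro exI[of _ "\<lambda>_. 1"]) auto
next
  case (insert y Y)
  show ?case
  proof (cases "\<forall>x\<in>X. a x y = 0")
    case True
    obtain c where "\<exists>x\<in>X. c x \<noteq> 0" "\<forall>y\<in>Y. (\<Sum>x\<in>X. c x * a x y) = 0"
      using insert.IH[of X a] insert.prems insert.hyps by auto
    then show ?thesis using True by (intro exI[of _ c]) simp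
  next
    case False
    then obtain x0 where x0: "x0 \<in> X" "a x0 y \<noteq> 0" by blast
    \<comment> \<open>Gaussian elimination with pivot \<open>x0\<close>: equation \<open>y\<close>
      is solved for the unknown at \<open>x0\<close>, with value \<open>c0\<close>, and its
      multiples are subtracted from the other equations.\<close>
    let ?X = "X - {x0}"
    let ?a = "\<lambda>x z. a x z - a x y / a x0 y * a x0 z"
    have "card Y < card ?X" using insert.prems insert.hyps x0(1) by simp
    then obtain c where c: "\<exists>x\<in>?X. c x \<noteq> 0" "\<And>z. z \<in> Y \<Longrightarrow> (\<Sum>x\<in>?X. c x * ?a x z) = 0"
      using insert.IH[of ?X ?a] insert.prems by auto
    define c0 where "c0 = - (\<Sum>x\<in>?X. c x * (a x y / a x0 y))"
    define d where "d x = (if x = x0 then c0 else c x)" for x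
    have d: "(\<Sum>x\<in>X. d x * a x z) = (\<Sum>x\<in>?X. c x * ?a x z)" for z
    proof -
      have "(\<Sum>x\<in>X. d x * a x z) = d x0 * a x0 z + (\<Sum>x\<in>?X. d x * a x z)"
        using x0 insert.prems by (simp add: sum.remove)
      also have "(\<Sum>x\<in>?X. d x * a x z) = (\<Sum>x\<in>?X. c x * a x z)"
        by (intro sum.cong) (auto simp: d_def)
      also have "d x0 * a x0 z = - (\<Sum>x\<in>?X. c x * (a x y / a x0 y * a x0 z))"
        by (simp add: d_def c0_def sum_distrib_right mult.assoc)
      finally show ?thesis by (simp add: right_diff_distrib sum_subtractf)
    qed
    have "(\<Sum>x\<in>?X. c x * ?a x y) = 0" using x0 by simp
    moreover have "\<exists>x\<in>X. d x \<noteq> 0" using c(1) by (auto simp: d_def)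
    ultimately show ?thesis using d c(2) by (intro exI[of _ d]) auto
  qed
qed

text \<open>Lists of unequal length are cut to the shorter one; the relations below only use
  exponent lists as long as the list of polynomials.\<close>

fun power_product :: "'a::comm_monoid_mult list \<Rightarrow> nat list \<Rightarrow> 'a" where
  "power_product (g # gs) (m # e) = g ^ m * power_product gs e"
| "power_product gs e = 1"

lemma power_product_polys:
  "set gs \<subseteq> polys V \<Longrightarrow> power_product gs e \<in> polys V"
proof (induction gs e rule: power_product.induct)
  case (1 g gs m e)
  have "g ^ m \<in> polys V" using 1 by (induction m) auto
  then show ?case using 1 by auto
qed auto

lemma prime_power_notin:
  assumes P: "primeideal P (poly_ring V)" and g: "g \<in> polys V" "g \<notin> P"
  shows "g ^ m \<in> polys V \<and> g ^ m \<notin> P"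
proof (induction m)
  case 0
  have "1 \<notin> P"
    using poly_ideal_one[OF primeideal.axioms(1)[OF P]] primeideal.I_notcarr[OF P] by metis
  then show ?case by simp
next
  case (Suc m)
  then show ?case using primeideal.I_prime[OF P, of g "g ^ m"] g by auto
qed

text \<open>A polynomial relation between elements \<open>g\<^sub>i \<in> P\<^sub>i\<^sub>+\<^sub>1 - P\<^sub>i\<close> can be written in the form
  \<open>g\<^sub>0\<^sup>m (g\<^sub>1\<^sup>n (\<dots> (c + g\<^sub>d r\<^sub>d) \<dots> + g\<^sub>1 r\<^sub>1) + g\<^sub>0 r\<^sub>0)\<close> with a nonzero constant \<open>c\<close>, starting from its
  lexicographically smallest monomial; moving up the chain, \<open>c\<close> ends up in the last prime.\<close>

lemma prime_chain_no_relation: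
  fixes gs :: "('v, 'k::field) mpoly list"
  assumes "\<And>i. i \<le> length gs \<Longrightarrow> primeideal (P i) (poly_ring V)"
    and "\<And>i. i < length gs \<Longrightarrow> P i \<subseteq> P (Suc i)"
    and "\<And>i. i < length gs \<Longrightarrow> gs ! i \<in> P (Suc i) - P i"
    and "finite X" "X \<noteq> {}" "\<And>e. e \<in> X \<Longrightarrow> length e = length gs \<and> c e \<noteq> 0"
  shows "(\<Sum>e\<in>X. single 0 (c e) * power_product gs e) \<notin> P 0"
  using assms
proof (induction gs arbitrary: P X c)
  case Nil
  have X: "X = {[]}" using Nil.prems(5,6) by fastforce
  have P: "primeideal (P 0) (poly_ring V)" using Nil.prems(1) by simp
  show ?case
  proof
    assume "(\<Sum>e\<in>X. single 0 (c e) * power_product [] e) \<in> P 0"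
    then have "single 0 (c []) \<in> P 0" unfolding X by simp
    then have "single 0 (inverse (c [])) * single 0 (c []) \<in> P 0"
      by (intro poly_ideal_mult[OF primeideal.axioms(1)[OF P]]) auto
    moreover have "c [] \<noteq> 0" using Nil.prems(6) X by simp
    ultimately have "1 \<in> P 0" by (simp add: mult_single)
    then show False
      using poly_ideal_one[OF primeideal.axioms(1)[OF P]] primeideal.I_notcarr[OF P] by metis
  qed
next
  case (Cons g gs)
  have P0: "primeideal (P 0) (poly_ring V)" and P1: "ideal (P 1) (poly_ring V)"
    using Cons.prems(1)[of 0] Cons.prems(1)[of 1, THEN primeideal.axioms(1)] by simp_all
  have g: "g \<in> P 1" "g \<notin> P 0" using Cons.prems(3)[of 0] by auto
  have gp: "g \<in> polys V" using g poly_ideal_subset[OF P1] by blast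
  have gsp: "set gs \<subseteq> polys V"
  proof
    fix h assume "h \<in> set gs"
    then obtain i where i: "i < length gs" "h = gs ! i" by (metis in_set_conv_nth)
    have "ideal (P (Suc (Suc i))) (poly_ring V)"
      using Cons.prems(1)[of "Suc (Suc i)", THEN primeideal.axioms(1)] i by simp
    then show "h \<in> polys V" using Cons.prems(3)[of "Suc i"] i poly_ideal_subset by auto
  qed
  \<comment> \<open>The least power of \<open>g\<close> is factored out: the terms with exactly this
    exponent form \<open>?A\<close>, all others keep a factor \<open>g\<close> and form
    \<open>g * ?R\<close>. As \<open>g\<close> is not in the prime \<open>P 0\<close>, the power can
    be cancelled there.\<close>
  define m where "m = Min (hd ` X)"
  have m: "m \<in> hd ` X" "\<And>e. e \<in> X \<Longrightarrow> m \<le> hd e"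
    unfolding m_def using Cons.prems(4,5) by (auto intro: Min_in)
  define X1 where "X1 = {e. m # e \<in> X}"
  have ne: "e = hd e # tl e" if "e \<in> X" for e using Cons.prems(6)[OF that] by (cases e) auto
  have X1: "(#) m ` X1 = {e\<in>X. hd e = m}" using ne by (force simp: X1_def)
  have "X1 = (#) m -` X" by (auto simp: X1_def)
  then have finX1: "finite X1" using Cons.prems(4) by (simp add: finite_vimageI)
  have "X1 \<noteq> {}" using m(1) X1 by blast
  have IH: "(\<Sum>e\<in>X1. single 0 (c (m # e)) * power_product gs e) \<notin> P 1"
  proof -
    have "(\<Sum>e\<in>X1. single 0 (c (m # e)) * power_product gs e) \<notin> P (Suc 0)"
    proof (rule Cons.IH[where P = "\<lambda>i. P (Suc i)" and c = "\<lambda>e. c (m # e)"])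
      show "primeideal (P (Suc i)) (poly_ring V)" if "i \<le> length gs" for i
        using Cons.prems(1)[of "Suc i"] that by simp
      show "P (Suc i) \<subseteq> P (Suc (Suc i))" if "i < length gs" for i
        using Cons.prems(2)[of "Suc i"] that by simp
      show "gs ! i \<in> P (Suc (Suc i)) - P (Suc i)" if "i < length gs" for i
        using Cons.prems(3)[of "Suc i"] that by simp
      show "length e = length gs \<and> c (m # e) \<noteq> 0" if "e \<in> X1" for e
        using Cons.prems(6)[of "m # e"] that by (simp add: X1_def)
    qed (use finX1 \<open>X1 \<noteq> {}\<close> in auto)
    then show ?thesis by simp
  qed
  let ?A = "\<Sum>e\<in>X1. single 0 (c (m # e)) * power_product gs e"
  let ?R = "\<Sum>e\<in>{e\<in>X. hd e \<noteq> m}. single 0 (c e) * (g ^ (hd e - m - 1) * power_product gs (tl e))"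
  have "(\<Sum>e\<in>X. single 0 (c e) * power_product (g # gs) e) =
      (\<Sum>e\<in>{e\<in>X. hd e = m}. single 0 (c e) * power_product (g # gs) e) +
      (\<Sum>e\<in>{e\<in>X. hd e \<noteq> m}. single 0 (c e) * power_product (g # gs) e)"
    using Cons.prems(4) by (subst sum.union_disjoint[symmetric]) (auto intro!: sum.cong)
  also have "(\<Sum>e\<in>{e\<in>X. hd e = m}. single 0 (c e) * power_product (g # gs) e) = g ^ m * ?A"
    unfolding X1[symmetric] sum_distrib_left
    by (subst sum.reindex) (auto intro!: sum.cong simp: mult_ac)
  also have "(\<Sum>e\<in>{e\<in>X. hd e \<noteq> m}. single 0 (c e) * power_product (g # gs) e) = g ^ m * (g * ?R)"
    unfolding sum_distrib_left
  proof (intro sum.cong refl)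
    fix e assume e: "e \<in> {e\<in>X. hd e \<noteq> m}"
    have "power_product (g # gs) e = g ^ hd e * power_product gs (tl e)"
      using ne[of e] e by (metis mem_Collect_eq power_product.simps(1))
    also have "hd e = m + Suc (hd e - m - 1)" using m(2)[of e] e by simp
    finally have "power_product (g # gs) e = g ^ m * (g * (g ^ (hd e - m - 1) * power_product gs (tl e)))"
      by (simp add: power_add mult_ac)
    then show "single 0 (c e) * power_product (g # gs) e =
      g ^ m * (g * (single 0 (c e) * (g ^ (hd e - m - 1) * power_product gs (tl e))))"
      by (simp add: mult_ac)
  qed
  finally have sum: "(\<Sum>e\<in>X. single 0 (c e) * power_product (g # gs) e) = g ^ m * (?A + g * ?R)"
    by (simp add: ring_distribs)
  have gm: "g ^ n \<in> polys V" for n using prime_power_notin[OF P0 gp g(2)] by simp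
  have A: "?A \<in> polys V" using power_product_polys[OF gsp] by (intro polys_sum polys_mult polys_single) auto
  have R: "?R \<in> polys V" using power_product_polys[OF gsp] gm by (intro polys_sum polys_mult polys_single) auto
  show ?case
  proof
    assume "(\<Sum>e\<in>X. single 0 (c e) * power_product (g # gs) e) \<in> P 0"
    then have "g ^ m * (?A + g * ?R) \<in> P 0" unfolding sum .
    then have "?A + g * ?R \<in> P 0"
      using primeideal.I_prime[OF P0, of "g ^ m" "?A + g * ?R"] prime_power_notin[OF P0 gp g(2), of m] A R gp
      by (auto intro!: polys_add polys_mult)
    \<comment> \<open>In \<open>P 1\<close> the multiple of \<open>g\<close> drops out, and what
      remains contradicts the induction hypothesis for the chain shifted by one.\<close>
    then have "?A + g * ?R \<in> P 1" using Cons.prems(2)[of 0] by auto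
    moreover have "g * ?R \<in> P 1"
      using poly_ideal_mult[OF P1 R g(1)] by (simp only: mult.commute)
    ultimately have "(?A + g * ?R) - g * ?R \<in> P 1" by (rule poly_ideal_diff[OF P1])
    then show False using IH by simp
  qed
qed

text \<open>Exponents are bounded variable by variable instead of by total degree, so that the
  number of admissible monomials is bounded by a plain power.\<close>

definition exponents_le :: "nat \<Rightarrow> ('v, 'k::field) mpoly \<Rightarrow> bool" where
  "exponents_le B f \<longleftrightarrow> (\<forall>t\<in>keys f. \<forall>v. lookup t v \<le> B)"

lemma exponents_le_mult:
  assumes "exponents_le B f" "exponents_le B' g"
  shows "exponents_le (B + B') (f * g)"
  unfolding exponents_le_def
proof (intro ballI allI)
  fix t v assume "t \<in> keys (f * g)"
  then obtain a b where "a \<in> keys f" "b \<in> keys g" "t = a + b"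
    using keys_mult_subset by blast
  then show "lookup t v \<le> B + B'"
    using assms by (simp add: exponents_le_def lookup_add add_mono)
qed

lemma exponents_le_power:
  fixes f :: "('v, 'k::field) mpoly"
  shows "exponents_le B f \<Longrightarrow> exponents_le (B * m) (f ^ m)"
proof (induction m)
  case 0
  show ?case by (simp add: exponents_le_def)
next
  case (Suc m)
  then show ?case using exponents_le_mult[of B f "B * m" "f ^ m"] by simp
qed

lemma exponents_le_power_product:
  fixes gs :: "('v, 'k::field) mpoly list"
  shows "(\<And>g. g \<in> set gs \<Longrightarrow> exponents_le B g) \<Longrightarrow> exponents_le (B * sum_list e) (power_product gs e)"
proof (induction gs e rule: power_product.induct)
  case (1 g gs m e)
  have "exponents_le (B * m + B * sum_list e) (g ^ m * power_product gs e)"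
    using 1 by (intro exponents_le_mult exponents_le_power) auto
  then show ?case by (simp add: ring_distribs)
qed (auto simp: exponents_le_def)

lemma card_bounded_monomials:
  assumes "finite U"
  shows "finite {t. keys t \<subseteq> U \<and> (\<forall>v. lookup t v < B)}"
    and "card {t. keys t \<subseteq> U \<and> (\<forall>v. lookup t v < B)} \<le> B ^ card U"
proof -
  let ?Y = "{t. keys t \<subseteq> U \<and> (\<forall>v. lookup t v < B)}"
  let ?F = "U \<rightarrow>\<^sub>E {..<B}"
  have inj: "inj_on (\<lambda>t. restrict (lookup t) U) ?Y"
  proof (rule inj_onI)
    fix s t assume st: "s \<in> ?Y" "t \<in> ?Y" "restrict (lookup s) U = restrict (lookup t) U"
    show "s = t"
    proof (rule poly_mapping_eqI)
      fix v show "lookup s v = lookup t v"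
      proof (cases "v \<in> U")
        case True
        then show ?thesis using st(3) by (metis restrict_apply')
      next
        case False
        then have "v \<notin> keys s" "v \<notin> keys t" using st by auto
        then show ?thesis by (simp add: in_keys_iff)
      qed
    qed
  qed
  have sub: "(\<lambda>t. restrict (lookup t) U) ` ?Y \<subseteq> ?F" by auto
  have fin: "finite ?F" using assms by (intro finite_PiE) auto
  show "finite ?Y" using inj sub fin by (rule inj_on_finite)
  show "card ?Y \<le> B ^ card U"
    using card_inj_on_le[OF inj sub fin] assms by (simp add: card_PiE)
qed

text \<open>With \<open>d\<close> polynomials, there are \<open>N ^ d\<close> power products with
  exponents below \<open>N\<close>, but the monomials occurring in them number at most a constant
  times \<open>N ^ card U\<close>. For large \<open>N\<close> the former exceed the latter, and
  linear algebra gives a relation.\<close>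

lemma exists_polynomial_relation:
  fixes gs :: "('v, 'k::field) mpoly list"
  assumes U: "finite U" "card U < length gs" and gs: "set gs \<subseteq> polys U"
  shows "\<exists>X c. finite X \<and> X \<noteq> {} \<and> (\<forall>e\<in>X. length e = length gs \<and> c e \<noteq> 0) \<and>
    (\<Sum>e\<in>X. single 0 (c e) * power_product gs e) = 0"
proof -
  let ?d = "length gs"
  define T where "T = (\<Union>g\<in>set gs. keys g)"
  \<comment> \<open>Inserting 0 keeps the maximum defined when the polynomials involve no
    variable.\<close>
  define B where "B = Max (insert 0 (\<Union>t\<in>T. Poly_Mapping.range t))"
  have finT: "finite (insert 0 (\<Union>t\<in>T. Poly_Mapping.range t))" by (simp add: T_def)
  have B: "exponents_le B g" if "g \<in> set gs" for g
    unfolding exponents_le_def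
  proof (intro ballI allI)
    fix t v assume t: "t \<in> keys g"
    show "lookup t v \<le> B"
    proof (cases "v \<in> keys t")
      case True
      then have "lookup t v \<in> (\<Union>t\<in>T. Poly_Mapping.range t)"
        using t that in_keys_lookup_in_range[OF True] unfolding T_def by blast
      then show ?thesis unfolding B_def using finT by (intro Max_ge) auto
    next
      case False
      then show ?thesis by (simp add: in_keys_iff)
    qed
  qed
  \<comment> \<open>An exponent in a power product is at most \<open>B * (d * N)\<close>, hence
    below \<open>K * N\<close>. With \<open>N\<close> above \<open>K ^ card U\<close>, the number
    \<open>(K * N) ^ card U\<close> stays below \<open>N ^ Suc (card U)\<close>, which is at most
    the number of exponent lists.\<close>
  define K where "K = Suc (B * ?d)"
  define N where "N = Suc (K ^ card U)"
  have "N > 0" by (simp add: N_def)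
  define X0 where "X0 = {e. set e \<subseteq> {..<N} \<and> length e = ?d}"
  define Y where "Y = {t :: 'v \<Rightarrow>\<^sub>0 nat. keys t \<subseteq> U \<and> (\<forall>v. lookup t v < K * N)}"
  have finX: "finite X0" unfolding X0_def by (intro finite_lists_length_eq) simp
  have finY: "finite Y" unfolding Y_def by (rule card_bounded_monomials(1)[OF U(1)])
  have "card Y \<le> (K * N) ^ card U" unfolding Y_def by (rule card_bounded_monomials(2)[OF U(1)])
  also have "\<dots> = K ^ card U * N ^ card U" by (simp add: power_mult_distrib)
  also have "\<dots> < N * N ^ card U" by (simp add: N_def)
  also have "\<dots> = N ^ Suc (card U)" by simp
  also have "\<dots> \<le> N ^ ?d" using U(2) by (intro power_increasing) (simp_all add: N_def)
  also have "\<dots> = card X0" unfolding X0_def using card_lists_length_eq[of "{..<N}" ?d] by simp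
  finally have less: "card Y < card X0" .
  have keysY: "keys (power_product gs e) \<subseteq> Y" if e: "e \<in> X0" for e
  proof
    fix t assume t: "t \<in> keys (power_product gs e)"
    have "keys t \<subseteq> U" using power_product_polys[OF gs, of e] t by (simp add: in_polys)
    moreover have "lookup t v < K * N" for v
    proof -
      have "lookup t v \<le> B * sum_list e"
        using exponents_le_power_product[OF B, of gs e] t unfolding exponents_le_def by auto
      also have "\<dots> \<le> B * (?d * N)"
      proof -
        have "sum_list e \<le> (\<Sum>x\<leftarrow>e. N)"
          using sum_list_mono[of e "\<lambda>x. x" "\<lambda>_. N"] e by (fastforce simp: X0_def)
        also have "\<dots> = ?d * N" using e by (simp add: X0_def sum_list_triv)
        finally show ?thesis by simp
      qed
      also have "\<dots> < K * N" using \<open>N > 0\<close> by (simp add: K_def)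
      finally show ?thesis by simp
    qed
    ultimately show "t \<in> Y" by (simp add: Y_def)
  qed
  obtain c where c: "\<exists>e\<in>X0. c e \<noteq> 0"
      "\<And>t. t \<in> Y \<Longrightarrow> (\<Sum>e\<in>X0. c e * lookup (power_product gs e) t) = 0"
    using exists_linear_relation[OF finY finX less, of "\<lambda>e. lookup (power_product gs e)"] by blast
  let ?X = "{e\<in>X0. c e \<noteq> 0}"
  have "(\<Sum>e\<in>?X. single 0 (c e) * power_product gs e) = 0"
  proof (rule poly_mapping_eqI)
    fix t
    have "lookup (\<Sum>e\<in>?X. single 0 (c e) * power_product gs e) t =
        (\<Sum>e\<in>?X. c e * lookup (power_product gs e) t)"
      by (simp add: lookup_sum lookup_const_mult)
    also have "\<dots> = (\<Sum>e\<in>X0. c e * lookup (power_product gs e) t)"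
      using finX by (intro sum.mono_neutral_left) auto
    also have "\<dots> = 0"
    proof (cases "t \<in> Y")
      case False
      then have "lookup (power_product gs e) t = 0" if "e \<in> X0" for e
        using keysY[OF that] by (metis in_keys_iff subsetD)
      then show ?thesis by simp
    qed (rule c(2))
    finally show "lookup (\<Sum>e\<in>?X. single 0 (c e) * power_product gs e) t =
        lookup 0 t" by simp
  qed
  moreover have "finite ?X" using finX by simp
  moreover have "?X \<noteq> {}" using c(1) by blast
  moreover have "\<forall>e\<in>?X. length e = ?d \<and> c e \<noteq> 0" by (simp add: X0_def)
  ultimately show ?thesis by blast
qed

text \<open>Modulo the smallest prime of a chain only the variables outside it matter, so the
  witnesses of the strict inclusions can be taken as polynomials in at most \<open>d\<close>
  variables. More than \<open>d\<close> witnesses satisfy a relation, which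
  \<open>prime_chain_no_relation\<close> forbids.\<close>

theorem krull_dim_le:
  fixes I :: "('v, 'k::field) mpoly set"
  assumes V: "finite V" and I: "ideal I (poly_ring V)"
    and card: "\<And>P. primeideal P (poly_ring V) \<Longrightarrow> I \<subseteq> P \<Longrightarrow> card {v\<in>V. var v \<notin> P} \<le> d"
  shows "krull_dim (poly_ring V Quot I) \<le> enat d"
proof -
  have bound: "k \<le> d" if P: "\<And>i. i \<le> k \<Longrightarrow> primeideal (P i) (poly_ring V)" "\<And>i. i \<le> k \<Longrightarrow> I \<subseteq> P i"
      "\<And>i. i < k \<Longrightarrow> P i \<subset> P (Suc i)" for k and P :: "nat \<Rightarrow> ('v, 'k) mpoly set"
  proof (rule ccontr)
    assume "\<not> k \<le> d"
    let ?U = "{v\<in>V. var v \<notin> P 0}"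
    have PI: "ideal (P i) (poly_ring V)" if "i \<le> k" for i
      using P(1)[OF that] by (rule primeideal.axioms)
    have U: "card ?U < k" using card[OF P(1,2), of 0] \<open>\<not> k \<le> d\<close> by simp
    have V0: "var_ideal V (V - ?U) \<subseteq> P 0" by (rule var_ideal_subset) (use PI[of 0] in auto)
    have mono: "P 0 \<subseteq> P i" if "i \<le> k" for i
      using that
    proof (induction i)
      case (Suc i)
      then show ?case using P(3)[of i] by auto
    qed simp
    have "\<exists>g. g \<in> P (Suc i) - P i \<and> g \<in> polys ?U" if i: "i < k" for i
    proof -
      obtain f where f: "f \<in> P (Suc i)" "f \<notin> P i" using P(3)[OF i] by blast
      have fV: "f \<in> polys V" using f(1) poly_ideal_subset[OF PI[of "Suc i"]] i by auto
      \<comment> \<open>\<open>g\<close> keeps the monomials of \<open>f\<close> in the variables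
        outside \<open>P 0\<close>. The discarded rest lies in \<open>P 0\<close>, hence in every
        prime of the chain, so \<open>g\<close> separates the same two primes as
        \<open>f\<close>.\<close>
      define g where "g = (\<Sum>t\<in>{t\<in>keys f. keys t \<subseteq> ?U}. single t (lookup f t))"
      have lg: "lookup g t = (if keys t \<subseteq> ?U then lookup f t else 0)" for t
        by (auto simp: g_def lookup_sum lookup_single when_def in_keys_iff)
      have gU: "g \<in> polys ?U" unfolding g_def by (intro polys_sum polys_single) auto
      have gV: "g \<in> polys V" using gU by (auto simp: in_polys)
      have "f - g \<in> var_ideal V (V - ?U)"
        unfolding var_ideal_def mono_ideal_def
      proof (intro CollectI conjI subsetI)
        show fg: "f - g \<in> polys V" using fV gV by (rule polys_diff)
        fix t assume t: "t \<in> keys (f - g)"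
        then have "\<not> keys t \<subseteq> ?U" unfolding in_keys_iff lookup_minus lg by auto
        moreover have "keys t \<subseteq> V" using fg t by (simp add: in_polys)
        ultimately show "keys t \<inter> (V - ?U) \<noteq> {}" by blast
      qed
      then have fg: "f - g \<in> P j" if "j \<le> k" for j using V0 mono[OF that] by blast
      have "f - (f - g) \<in> P (Suc i)" using poly_ideal_diff[OF PI[of "Suc i"] f(1) fg] i by simp
      moreover have "g \<notin> P i"
      proof
        assume "g \<in> P i"
        from poly_ideal_add[OF PI[of i] fg[of i] this] f(2) i show False by simp
      qed
      ultimately show ?thesis using gU by auto
    qed
    then have "\<forall>i. \<exists>g. i < k \<longrightarrow> g \<in> P (Suc i) - P i \<and> g \<in> polys ?U" by simp
    from choice[OF this] obtain g where "\<forall>i. i < k \<longrightarrow> g i \<in> P (Suc i) - P i \<and> g i \<in> polys ?U"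
      by (elim exE)
    then have g: "\<And>i. i < k \<Longrightarrow> g i \<in> P (Suc i) - P i" "\<And>i. i < k \<Longrightarrow> g i \<in> polys ?U" by simp_all
    let ?gs = "map g [0..<k]"
    have "finite ?U" "card ?U < length ?gs" "set ?gs \<subseteq> polys ?U" using V U g(2) by auto
    from exists_polynomial_relation[OF this]
    obtain X c where X: "finite X" "X \<noteq> {}" "\<forall>e\<in>X. length e = length ?gs \<and> c e \<noteq> 0"
      and rel: "(\<Sum>e\<in>X. single 0 (c e) * power_product ?gs e) = 0"
      by (elim exE conjE)
    have "(\<Sum>e\<in>X. single 0 (c e) * power_product ?gs e) \<notin> P 0"
    proof (rule prime_chain_no_relation[where V = V])
      show "primeideal (P i) (poly_ring V)" if "i \<le> length ?gs" for i using P(1) that by simp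
      show "P i \<subseteq> P (Suc i)" if "i < length ?gs" for i using P(3)[of i] that by auto
      show "?gs ! i \<in> P (Suc i) - P i" if "i < length ?gs" for i using g(1) that by simp
    qed (use X in auto)
    then show False using rel poly_ideal_zero[OF PI[of 0]] by simp
  qed
  then show ?thesis
    unfolding cring.krull_dim_Quot[OF cring_poly_ring I]
  proof (intro Sup_least, elim CollectE exE conjE)
    fix x k and P :: "nat \<Rightarrow> ('v, 'k) mpoly set"
    assume "x = enat k" "\<forall>i\<le>k. primeideal (P i) (poly_ring V) \<and> I \<subseteq> P i" "\<forall>i<k. P i \<subset> P (Suc i)"
    then show "x \<le> enat d" using bound[of k P] by simp
  qed
qed

section \<open>Regular sequences from merging variables\<close>

text \<open>Pushforward along \<open>h\<close>, adding the values on each fibre. It is used at two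
  levels: on exponent vectors along a map of variables, and on polynomials along the induced map of
  monomials.\<close>

definition push :: "('a \<Rightarrow> 'b) \<Rightarrow> ('a \<Rightarrow>\<^sub>0 'c) \<Rightarrow> 'b \<Rightarrow>\<^sub>0 'c::comm_monoid_add" where
  "push h f = (\<Sum>t\<in>keys f. single (h t) (lookup f t))"

lemma push_superset:
  assumes "finite A" "keys f \<subseteq> A"
  shows "push h f = (\<Sum>t\<in>A. single (h t) (lookup f t))"
  unfolding push_def using assms by (intro sum.mono_neutral_left) (auto simp: in_keys_iff)

lemma push_add: "push h (f + g) = push h f + push h g"
proof -
  let ?A = "keys f \<union> keys g"
  have fin: "finite ?A" by simp
  have "push h (f + g) = (\<Sum>t\<in>?A. single (h t) (lookup (f + g) t))"
    by (rule push_superset[OF fin Poly_Mapping.keys_add])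
  also have "\<dots> = (\<Sum>t\<in>?A. single (h t) (lookup f t)) +
      (\<Sum>t\<in>?A. single (h t) (lookup g t))"
    by (simp add: lookup_add single_add sum.distrib)
  also have "\<dots> = push h f + push h g"
    using push_superset[OF fin, of f h] push_superset[OF fin, of g h] by simp
  finally show ?thesis .
qed

lemma push_single [simp]: "push h (single t c) = single (h t) c"
  by (simp add: push_def)

lemma push_zero [simp]: "push h 0 = 0"
  by (simp add: push_def)

lemma push_sum: "push h (\<Sum>i\<in>A. f i) = (\<Sum>i\<in>A. push h (f i))"
  by (induction A rule: infinite_finite_induct) (simp_all add: push_add)

lemma push_diff:
  fixes f g :: "'a \<Rightarrow>\<^sub>0 'c::ab_group_add"
  shows "push h (f - g) = push h f - push h g"
  using push_add[of h "f - g" g] by simp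

lemma keys_push: "keys (push h f) \<subseteq> h ` keys f"
proof
  fix t assume "t \<in> keys (push h f)"
  then have "t \<in> (\<Union>s\<in>keys f. keys (single (h s) (lookup f s)))"
    using keys_sum[of "\<lambda>t. single (h t) (lookup f t)" "keys f"]
    unfolding push_def by blast
  then show "t \<in> h ` keys f" by (auto split: if_splits)
qed

lemma lookup_push_nat:
  fixes t :: "'v \<Rightarrow>\<^sub>0 nat"
  assumes "finite A" "keys t \<subseteq> A"
  shows "lookup (push \<sigma> t) u = (\<Sum>v\<in>A. if \<sigma> v = u then lookup t v else 0)"
  by (simp add: push_superset[OF assms] lookup_sum lookup_single when_def)

lemma keys_push_nat: "keys (push \<sigma> (t :: 'v \<Rightarrow>\<^sub>0 nat)) = \<sigma> ` keys t"
proof (rule Set.set_eqI)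
  fix u
  have "u \<in> keys (push \<sigma> t) \<longleftrightarrow>
      (\<Sum>v\<in>keys t. if \<sigma> v = u then lookup t v else 0) \<noteq> 0"
    unfolding in_keys_iff[of u] by (subst lookup_push_nat[of "keys t"]) auto
  also have "\<dots> \<longleftrightarrow> (\<exists>v\<in>keys t. \<sigma> v = u)"
  proof -
    have "lookup t v > 0" if "v \<in> keys t" for v using that by (simp add: in_keys_iff)
    then show ?thesis by (auto simp: sum_eq_0_iff)
  qed
  finally show "u \<in> keys (push \<sigma> t) \<longleftrightarrow> u \<in> \<sigma> ` keys t" by auto
qed

definition ren :: "('v \<Rightarrow> 'v) \<Rightarrow> ('v, 'k::field) mpoly \<Rightarrow> ('v, 'k) mpoly" where
  "ren \<sigma> = push (push \<sigma>)"

lemma ren_add: "ren \<sigma> (f + g) = ren \<sigma> f + ren \<sigma> g"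
  and ren_diff: "ren \<sigma> (f - g) = ren \<sigma> f - ren \<sigma> g"
  and ren_zero [simp]: "ren \<sigma> 0 = 0"
  and ren_single: "ren \<sigma> (single t c) = single (push \<sigma> t) c"
  by (simp_all add: ren_def push_add push_diff)

lemma ren_sum: "ren \<sigma> (\<Sum>i\<in>A. f i) = (\<Sum>i\<in>A. ren \<sigma> (f i))"
  by (simp add: ren_def push_sum)

lemma ren_one [simp]: "ren \<sigma> 1 = 1"
proof -
  have "ren \<sigma> (single 0 1) = single 0 1" by (simp only: ren_single push_zero)
  then show ?thesis by simp
qed

lemma ren_var: "ren \<sigma> (var v) = var (\<sigma> v)"
  by (simp add: var_def ren_single)

lemma ren_mult:
  fixes f g :: "('v, 'k::field) mpoly"
  shows "ren \<sigma> (f * g) = ren \<sigma> f * ren \<sigma> g"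
proof -
  have "ren \<sigma> (single s c * single t d) =
      ren \<sigma> (single s c) * ren \<sigma> (single t d)" for s t and c d :: 'k
    by (simp add: mult_single ren_single push_add)
  then have sums: "ren \<sigma> ((\<Sum>s\<in>A. single s (c s)) * (\<Sum>t\<in>B. single t (d t))) =
      ren \<sigma> (\<Sum>s\<in>A. single s (c s)) * ren \<sigma> (\<Sum>t\<in>B. single t (d t))"
    for A B and c d :: "('v \<Rightarrow>\<^sub>0 nat) \<Rightarrow> 'k"
    by (simp add: sum_product ren_sum)
  show ?thesis
    using sums[where A = "keys f" and c = "lookup f"
        and B = "keys g" and d = "lookup g"]
    unfolding poly_eq_sum_single[symmetric] .
qed

lemma ren_polys:
  assumes "f \<in> polys V" "\<sigma> ` V \<subseteq> V"
  shows "ren \<sigma> f \<in> polys V"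
  unfolding in_polys ren_def
proof
  fix t assume "t \<in> keys (push (push \<sigma>) f)"
  then obtain s where "s \<in> keys f" "t = push \<sigma> s"
    using keys_push[of "push \<sigma>" f] by blast
  then show "keys t \<subseteq> V" using assms by (auto simp: keys_push_nat in_polys)
qed

definition multiples :: "('v \<Rightarrow>\<^sub>0 nat) set \<Rightarrow> ('v \<Rightarrow>\<^sub>0 nat) set" where
  "multiples T = {s + t | s t. t \<in> T}"

lemma up_closed_multiples: "up_closed (multiples T)"
  unfolding up_closed_def
proof (intro allI ballI)
  fix s u assume "u \<in> multiples T"
  then obtain r t where "u = r + t" "t \<in> T" unfolding multiples_def by blast
  then have "s + u = (s + r) + t" "t \<in> T" by (simp_all add: add.assoc)
  then show "s + u \<in> multiples T" unfolding multiples_def by blast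
qed

lemma multiples_iff: "u \<in> multiples T \<longleftrightarrow> (\<exists>t\<in>T. \<forall>v. lookup t v \<le> lookup u v)"
proof
  assume "\<exists>t\<in>T. \<forall>v. lookup t v \<le> lookup u v"
  then obtain t where t: "t \<in> T" "\<And>v. lookup t v \<le> lookup u v" by blast
  then have "u = (u - t) + t" by (intro poly_mapping_eqI) (simp add: lookup_add lookup_minus)
  then show "u \<in> multiples T" using t(1) unfolding multiples_def by blast
next
  assume "u \<in> multiples T"
  then obtain s t where "u = s + t" "t \<in> T" unfolding multiples_def by blast
  then show "\<exists>t\<in>T. \<forall>v. lookup t v \<le> lookup u v"
    by (intro bexI[of _ t]) (simp_all add: lookup_add)
qed

lemma push_multiples: "t \<in> multiples T \<Longrightarrow> push \<sigma> t \<in> multiples (push \<sigma> ` T)"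
  unfolding multiples_def using push_add by blast

lemma ren_in_mono_ideal:
  assumes "f \<in> mono_ideal V (multiples T)" "\<sigma> ` V \<subseteq> V"
  shows "ren \<sigma> f \<in> mono_ideal V (multiples (push \<sigma> ` T))"
  using assms ren_polys[of f V \<sigma>] keys_push[of "push \<sigma>" f] push_multiples[of _ T \<sigma>]
  unfolding mono_ideal_def ren_def by blast

text \<open>Monomials are treated by induction on the degree, splitting off one variable
  \<open>v\<close>: if \<open>p'\<close> is the renamed \<open>p\<close>, then
  \<open>var v * p - var (\<sigma> v) * p'\<close> equals
  \<open>var v * (p - p') + p' * (var v - var (\<sigma> v))\<close>.\<close>

lemma minus_ren_in_ideal:
  fixes L :: "('v, 'k::field) mpoly set"
  assumes V: "finite V" and L: "ideal L (poly_ring V)" and \<sigma>: "\<sigma> ` V \<subseteq> V"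
    and var: "\<And>v. v \<in> V \<Longrightarrow> var v - var (\<sigma> v) \<in> L" and f: "f \<in> polys V"
  shows "f - ren \<sigma> f \<in> L"
proof -
  have mono: "single t c - ren \<sigma> (single t c) \<in> L"
    if "keys t \<subseteq> V" for t and c :: 'k
    using that
  proof (induction "\<Sum>v\<in>V. lookup t v" arbitrary: t rule: less_induct)
    case less
    show ?case
    proof (cases "t = 0")
      case True
      then show ?thesis by (simp add: ren_single poly_ideal_zero[OF L])
    next
      case False
      then obtain v where v: "v \<in> keys t" using keys_eq_empty[of t] by blast
      define s where "s = t - single v 1"
      have t: "t = single v 1 + s"
        using v unfolding s_def
        by (intro poly_mapping_eqI) (auto simp: lookup_add lookup_minus lookup_single when_def in_keys_iff)
      have sV: "keys s \<subseteq> V" "v \<in> V"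
        using less.prems unfolding t keys_add_nat by auto
      have "(\<Sum>u\<in>V. lookup s u) < (\<Sum>u\<in>V. lookup t u)"
        using V sV(2) by (intro sum_strict_mono_ex1) (auto simp: t lookup_add lookup_single intro!: bexI[of _ v])
      then have IH: "single s c - ren \<sigma> (single s c) \<in> L"
        by (rule less.hyps) (rule sV)
      let ?p = "single s c"
      have "single t c = var v * ?p" by (simp add: var_def mult_single t)
      then have "single t c - ren \<sigma> (single t c) =
          var v * (?p - ren \<sigma> ?p) + ren \<sigma> ?p * (var v - var (\<sigma> v))"
        by (simp add: ren_mult ren_var algebra_simps)
      also have "\<dots> \<in> L"
        using IH var[OF sV(2)] sV ren_polys[OF polys_single[OF sV(1)] \<sigma>, of c]
        by (intro poly_ideal_add[OF L] poly_ideal_mult[OF L]) auto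
      finally show ?thesis .
    qed
  qed
  have "f - ren \<sigma> f = (\<Sum>t\<in>keys f. single t (lookup f t) -
      ren \<sigma> (single t (lookup f t)))"
    unfolding sum_subtractf ren_sum[symmetric] poly_eq_sum_single[symmetric] ..
  also have "\<dots> \<in> L"
    using f by (intro poly_ideal_sum[OF L] mono) (simp add: in_polys)
  finally show ?thesis .
qed

text \<open>At stage \<open>i\<close> the variables \<open>b 0\<close>, ...,
  \<open>b (i - 1)\<close> have been replaced; each replacement acts on the outcome of the earlier
  ones.\<close>

primrec merge :: "(nat \<Rightarrow> 'v) \<Rightarrow> (nat \<Rightarrow> 'v) \<Rightarrow> nat \<Rightarrow> 'v \<Rightarrow> 'v" where
  "merge a b 0 x = x"
| "merge a b (Suc i) x = (if merge a b i x = b i then a i else merge a b i x)"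

lemma merge_other: "x \<notin> b ` {..<i} \<Longrightarrow> merge a b i x = x"
  by (induction i) (auto simp: lessThan_Suc)

lemma merge_merged:
  assumes "\<And>i j. i < r \<Longrightarrow> j < r \<Longrightarrow> a i \<noteq> b j" "inj_on b {..<r}" "i \<le> r" "j < i"
  shows "merge a b i (b j) = a j"
  using assms(3,4)
proof (induction i)
  case (Suc i)
  show ?case
  proof (cases "j = i")
    case True
    have "b i \<notin> b ` {..<i}" using inj_onD[OF assms(2), of i] Suc.prems by fastforce
    then show ?thesis using True by (simp add: merge_other)
  next
    case False
    then have "merge a b i (b j) = a j" using Suc by simp
    then show ?thesis using assms(1)[of j i] Suc.prems False by simp
  qed
qed simp

lemma merge_eq_cases:
  assumes "\<And>i j. i < r \<Longrightarrow> j < r \<Longrightarrow> a i \<noteq> b j" "inj_on b {..<r}" "i \<le> r" "merge a b i u = z"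
  shows "u = z \<or> (\<exists>j<i. u = b j \<and> z = a j)"
  using merge_merged[OF assms(1-3)] merge_other[of u b i a] assms(4) by fastforce

text \<open>Merging the variable \<open>b i\<close> into \<open>a i\<close> in step \<open>i\<close> presents the quotient by the differences
  \<open>a j - b j\<close>, \<open>j < i\<close>, as a quotient by a monomial ideal in fewer variables.\<close>

theorem regular_mod_merge:
  fixes T :: "('v \<Rightarrow>\<^sub>0 nat) set" and a b :: "nat \<Rightarrow> 'v"
  assumes V: "finite V" and T: "\<And>t. t \<in> T \<Longrightarrow> keys t \<subseteq> V" "0 \<notin> T"
    and abV: "\<And>i. i < r \<Longrightarrow> a i \<in> V \<and> b i \<in> V"
    and disjoint: "\<And>i j. i < r \<Longrightarrow> j < r \<Longrightarrow> a i \<noteq> b j" and inj: "inj_on b {..<r}"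
    and reg: "\<And>i f. i < r \<Longrightarrow> f \<in> polys V \<Longrightarrow>
      (var (a i) - var (b i)) * f \<in> mono_ideal V (multiples (push (merge a b i) ` T)) \<Longrightarrow>
      f \<in> (mono_ideal V (multiples (push (merge a b i) ` T)) :: ('v, 'k::field) mpoly set)"
  shows "regular_mod (poly_ring V) (mono_ideal V (multiples T) :: ('v, 'k) mpoly set)
    (map (\<lambda>i. var (a i) - var (b i)) [0..<r])"
proof -
  define \<sigma> where "\<sigma> = merge a b"
  have \<sigma>V: "\<sigma> i ` V \<subseteq> V" if "i \<le> r" for i
    using that unfolding \<sigma>_def by (induction i) (use abV in auto)
  have ab: "a i \<in> V \<and> b i \<in> V \<and> \<sigma> i (a i) = a i \<and> \<sigma> i (b i) = b i" if i: "i < r" for i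
  proof -
    have "a i \<noteq> b j \<and> b i \<noteq> b j" if "j < i" for j
      using disjoint[OF i, of j] inj_onD[OF inj, of i j] i that by auto
    then have "a i \<notin> b ` {..<i}" "b i \<notin> b ` {..<i}" by auto
    then show ?thesis using abV[OF i] by (simp add: \<sigma>_def merge_other)
  qed
  have step: "\<sigma> (Suc i) x = (if \<sigma> i x = b i then a i else \<sigma> i x)" for i x by (simp add: \<sigma>_def)
  have merged: "\<sigma> i (a j) = \<sigma> i (b j)" if "j < i" "i \<le> r" for i j
  proof -
    have "a j \<noteq> b k" if "k < i" for k using disjoint[of j k] that \<open>j < i\<close> \<open>i \<le> r\<close> by simp
    then have "a j \<notin> b ` {..<i}" by auto
    then show ?thesis using merge_merged[OF disjoint inj that(2,1)] by (simp add: \<sigma>_def merge_other)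
  qed
  let ?S = "poly_ring V :: ('v, 'k) mpoly ring"
  let ?I = "mono_ideal V (multiples T) :: ('v, 'k) mpoly set"
  let ?x = "\<lambda>i. var (a i) - var (b i) :: ('v, 'k) mpoly"
  let ?L = "\<lambda>i. Idl\<^bsub>?S\<^esub> (?I \<union> ?x ` {0..<i})"
  let ?M = "\<lambda>i. mono_ideal V (multiples (push (\<sigma> i) ` T)) :: ('v, 'k) mpoly set"
  have I: "ideal ?I ?S" by (rule ideal_mono_ideal[OF up_closed_multiples])
  have M: "ideal (?M i) ?S" for i by (rule ideal_mono_ideal[OF up_closed_multiples])
  have xV: "?x i \<in> polys V" if "i < r" for i using ab[OF that] by auto
  have sub: "?I \<union> ?x ` {0..<i} \<subseteq> polys V" if "i \<le> r" for i
    using poly_ideal_subset[OF I] xV that by auto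
  have L: "ideal (?L i) ?S" if "i \<le> r" for i by (rule poly_genideal_ideal[OF sub[OF that]])
  have supL: "?I \<union> ?x ` {0..<i} \<subseteq> ?L i" if "i \<le> r" for i by (rule poly_genideal_superset[OF sub[OF that]])
  have varL: "var v - var (\<sigma> i v) \<in> ?L i" if "v \<in> V" "i \<le> r" for v i
    using that(2)
  proof (induction i)
    case 0
    then show ?case using poly_ideal_zero[OF L[of 0]] by (simp add: \<sigma>_def)
  next
    case (Suc i)
    have "?L i \<subseteq> ?L (Suc i)"
      using supL[of "Suc i"] Suc.prems by (intro poly_genideal_least L) auto
    then have "var v - var (\<sigma> i v) \<in> ?L (Suc i)" using Suc by auto
    moreover have "var (\<sigma> i v) - var (\<sigma> (Suc i) v) \<in> ?L (Suc i)"
    proof (cases "\<sigma> i v = b i")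
      case True
      have "?x i \<in> ?L (Suc i)" using supL[of "Suc i"] Suc.prems by auto
      then have "- ?x i \<in> ?L (Suc i)" using Suc.prems by (intro poly_ideal_uminus[OF L])
      then show ?thesis using True step[of i v] by simp
    next
      case False
      then show ?thesis using step[of i v] poly_ideal_zero[OF L[OF Suc.prems]] by simp
    qed
    ultimately have "(var v - var (\<sigma> i v)) + (var (\<sigma> i v) - var (\<sigma> (Suc i) v)) \<in> ?L (Suc i)"
      by (rule poly_ideal_add[OF L[OF Suc.prems]])
    then show ?case by simp
  qed
  \<comment> \<open>The ideal generated by \<open>?I\<close> and the first \<open>i\<close>
    differences is the preimage of a monomial ideal under the renaming. One inclusion is checked on
    generators. For the other, \<open>f\<close> differs from its renaming by an element of
    \<open>?L i\<close>, and so do the generators of \<open>?I\<close>, whose renamings generate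
    \<open>?M i\<close>.\<close>
  have memL: "f \<in> ?L i \<longleftrightarrow> ren (\<sigma> i) f \<in> ?M i" if i: "i \<le> r" and f: "f \<in> polys V" for i f
  proof
    let ?J = "{f \<in> polys V. ren (\<sigma> i) f \<in> ?M i}"
    have "?L i \<subseteq> ?J"
    proof (rule poly_genideal_least)
      show "ideal ?J ?S"
        using M[of i] by (intro poly_idealI)
          (auto simp: ren_add ren_mult poly_ideal_zero[OF M] intro!: poly_ideal_add[OF M] poly_ideal_mult[OF M] ren_polys \<sigma>V[OF i])
      show "?I \<union> ?x ` {0..<i} \<subseteq> ?J"
      proof
        fix g assume "g \<in> ?I \<union> ?x ` {0..<i}"
        then show "g \<in> ?J"
        proof
          assume g: "g \<in> ?I"
          then have "g \<in> polys V" using poly_ideal_subset[OF I] by blast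
          then show ?thesis using ren_in_mono_ideal[OF g \<sigma>V[OF i]] by blast
        next
          assume "g \<in> ?x ` {0..<i}"
          then obtain j where j: "j < i" "g = ?x j" by auto
          then have "ren (\<sigma> i) g = 0" using merged[OF j(1) i] by (simp add: ren_diff ren_var)
          then show ?thesis using xV[of j] j i poly_ideal_zero[OF M] by simp
        qed
      qed
    qed
    then show "ren (\<sigma> i) f \<in> ?M i" if "f \<in> ?L i" using that by blast
    have minus: "g - ren (\<sigma> i) g \<in> ?L i" if "g \<in> polys V" for g
      using that varL i by (intro minus_ren_in_ideal[OF V L[OF i] \<sigma>V[OF i]]) auto
    have "?M i \<subseteq> ?L i"
    proof -
      have "(\<lambda>t. single t 1) ` push (\<sigma> i) ` T \<subseteq> ?L i"
      proof clarify
        fix t assume t: "t \<in> T"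
        let ?p = "single t (1::'k)"
        have "?p \<in> polys V" using T(1)[OF t] by auto
        moreover have "t \<in> multiples T" using t by (auto simp: multiples_iff)
        then have "?p \<in> ?L i" using supL[OF i] T(1)[OF t] by (auto simp: single_in_mono_ideal_iff)
        ultimately have "?p - (?p - ren (\<sigma> i) ?p) \<in> ?L i"
          using poly_ideal_diff[OF L[OF i]] minus by blast
        then show "single (push (\<sigma> i) t) 1 \<in> ?L i" by (simp add: ren_single)
      qed
      then have "Idl\<^bsub>?S\<^esub> ((\<lambda>t. single t 1) ` push (\<sigma> i) ` T) \<subseteq> ?L i"
        by (rule poly_genideal_least[OF L[OF i]])
      moreover have "Idl\<^bsub>?S\<^esub> ((\<lambda>t. single t 1) ` push (\<sigma> i) ` T) = ?M i"
        unfolding multiples_def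
      proof (rule genideal_monomials)
        fix s assume "s \<in> push (\<sigma> i) ` T"
        then obtain t where "t \<in> T" "s = push (\<sigma> i) t" by blast
        then show "keys s \<subseteq> V"
          using image_mono[OF T(1), of t "\<sigma> i"] \<sigma>V[OF i] by (simp add: keys_push_nat)
      qed
      ultimately show ?thesis by simp
    qed
    then have "(f - ren (\<sigma> i) f) + ren (\<sigma> i) f \<in> ?L i" if "ren (\<sigma> i) f \<in> ?M i"
      using that by (intro poly_ideal_add[OF L[OF i]] minus f) auto
    then show "f \<in> ?L i" if "ren (\<sigma> i) f \<in> ?M i" using that by simp
  qed
  \<comment> \<open>Renaming keeps nonempty supports nonempty, so 1 stays outside the last monomial
    ideal and the quotient by the whole sequence is nonzero.\<close>
  have "0 \<notin> multiples (push (\<sigma> r) ` T)"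
  proof
    assume "0 \<in> multiples (push (\<sigma> r) ` T)"
    then obtain t where t: "t \<in> T" "\<forall>v. lookup (push (\<sigma> r) t) v \<le> 0"
      by (auto simp: multiples_iff)
    then have "push (\<sigma> r) t = 0" by (intro poly_mapping_eqI) simp
    then have "keys t = {}" using keys_push_nat[of "\<sigma> r" t] by simp
    then show False using t(1) T(2) by simp
  qed
  then have "1 \<notin> ?M r" by (simp add: mono_ideal_def)
  then have one: "1 \<notin> ?L r" using memL[of r 1] by simp
  have tk: "set (take i (map ?x [0..<r])) = ?x ` {0..<i}" if "i \<le> r" for i
    using that by (simp add: take_map take_upt)
  show ?thesis
    unfolding regular_mod_def
  proof (intro conjI allI impI ballI)
    show "set (map ?x [0..<r]) \<subseteq> polys V" using xV by auto
    have "set (map ?x [0..<r]) = ?x ` {0..<r}" by simp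
    then show "Idl\<^bsub>?S\<^esub> (?I \<union> set (map ?x [0..<r])) \<noteq> polys V"
      using one polys_one[of V] by metis
    fix i y assume i: "i < length (map ?x [0..<r])" and y: "y \<in> polys V"
      and xy: "map ?x [0..<r] ! i \<otimes>\<^bsub>?S\<^esub> y \<in> Idl\<^bsub>?S\<^esub> (?I \<union> set (take i (map ?x [0..<r])))"
    have ir: "i < r" using i by simp
    have "?x i * y \<in> ?L i" using xy ir tk[of i] by simp
    then have "ren (\<sigma> i) (?x i * y) \<in> ?M i" using memL[of i "?x i * y"] ir xV[OF ir] y by auto
    then have "?x i * ren (\<sigma> i) y \<in> ?M i" using ab[OF ir] by (simp add: ren_mult ren_diff ren_var)
    then have "ren (\<sigma> i) y \<in> ?M i" using reg[OF ir] ren_polys[OF y \<sigma>V] ir unfolding \<sigma>_def by simp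
    then show "y \<in> Idl\<^bsub>?S\<^esub> (?I \<union> set (take i (map ?x [0..<r])))"
      using memL[of i y] ir y tk[of i] by simp
  qed
qed

text \<open>The product has at \<open>t + single x 1\<close> the coefficient of \<open>f\<close> at
  \<open>t\<close> minus that at \<open>t + single x 1 - single v 1\<close>. Outside
  \<open>M\<close> this is zero, so the coefficient is carried along the line that trades
  \<open>v\<close> for \<open>x\<close>, until \<open>v\<close> is used up and it must
  vanish.\<close>

lemma coefficient_zero_if_var_diff_mult:
  fixes f :: "('v, 'k::field) mpoly"
  assumes f: "keys ((var x - var v) * f) \<subseteq> M" and "x \<noteq> v"
  shows "(\<And>j. j \<le> lookup t v \<Longrightarrow>
      t + single x (Suc j) - single v j \<notin> M) \<Longrightarrow> lookup f t = 0"
proof (induction "lookup t v" arbitrary: t)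
  case (0 t)
  let ?u = "t + single x 1"
  have "?u \<notin> M" using 0(2)[of 0] by simp
  then have "lookup ((var x - var v) * f) ?u = 0" using f by (metis in_keys_iff subsetD)
  moreover have "v \<notin> keys ?u" "x \<in> keys ?u" "?u - single x 1 = t"
    using 0(1) \<open>x \<noteq> v\<close> by (auto simp: in_keys_iff lookup_add lookup_single when_def)
  ultimately show ?case by (simp add: left_diff_distrib lookup_minus lookup_var_mult del: One_nat_def)
next
  case (Suc n t)
  let ?u = "t + single x 1"
  have "?u \<notin> M" using Suc(3)[of 0] by simp
  then have "lookup ((var x - var v) * f) ?u = 0" using f by (metis in_keys_iff subsetD)
  moreover have "v \<in> keys ?u" "x \<in> keys ?u" "?u - single x 1 = t"
    using Suc(2) \<open>x \<noteq> v\<close> by (auto simp: in_keys_iff lookup_add lookup_single when_def)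
  moreover have "lookup f (?u - single v 1) = 0"
  proof (rule Suc(1))
    show "n = lookup (?u - single v 1) v"
      using Suc(2) \<open>x \<noteq> v\<close> by (simp add: lookup_minus lookup_add lookup_single)
    fix j assume "j \<le> lookup (?u - single v 1) v"
    then have "Suc j \<le> lookup t v"
      using Suc(2) \<open>x \<noteq> v\<close> by (simp add: lookup_minus lookup_add lookup_single)
    moreover have "?u - single v 1 + single x (Suc j) - single v j =
        t + single x (Suc (Suc j)) - single v (Suc j)"
      using \<open>x \<noteq> v\<close> by (intro poly_mapping_eqI) (auto simp: lookup_minus lookup_add lookup_single when_def)
    ultimately show "?u - single v 1 + single x (Suc j) - single v j \<notin> M"
      using Suc(3) by metis
  qed
  ultimately show ?case by (simp add: left_diff_distrib lookup_minus lookup_var_mult del: One_nat_def)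
qed

text \<open>Exchanging \<open>x\<close> and \<open>v\<close> only changes the sign of the product,
  so for each monomial outside \<open>M\<close> it is enough that one of the two directions of
  trading never enters \<open>M\<close>.\<close>

lemma var_diff_regular_mono_ideal:
  fixes f :: "('v, 'k::field) mpoly"
  assumes "x \<noteq> v" and f: "f \<in> polys V" "(var x - var v) * f \<in> mono_ideal V M"
    and M: "\<And>t. t \<notin> M \<Longrightarrow>
      (\<forall>j\<le>lookup t v. t + single x (Suc j) - single v j \<notin> M) \<or>
      (\<forall>j\<le>lookup t x. t + single v (Suc j) - single x j \<notin> M)"
  shows "f \<in> mono_ideal V M"
proof -
  have 1: "keys ((var x - var v) * f) \<subseteq> M" using f(2) by (simp add: mono_ideal_def)
  have "(var v - var x) * f = - ((var x - var v) * f)" by (simp add: algebra_simps)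
  then have 2: "keys ((var v - var x) * f) \<subseteq> M" using 1 by simp
  have "t \<in> M" if "t \<in> keys f" for t
  proof (rule ccontr)
    assume "t \<notin> M"
    then have "lookup f t = 0"
      using M[of t] coefficient_zero_if_var_diff_mult[OF 1 \<open>x \<noteq> v\<close>, of t]
        coefficient_zero_if_var_diff_mult[OF 2 \<open>x \<noteq> v\<close>[symmetric], of t] by blast
    then show False using that by (simp add: in_keys_iff)
  qed
  then show ?thesis using f(1) by (auto simp: mono_ideal_def)
qed

lemma depth_ge_regular_mod:
  fixes I :: "('v, 'k::field) mpoly set"
  assumes I: "ideal I (poly_ring V)" and "regular_mod (poly_ring V) I xs" "set xs \<subseteq> irrelevant_ideal V"
  shows "enat (length xs) \<le> depth_quot V I"
proof -
  have sub: "irrelevant_ideal V \<subseteq> (polys V :: ('v, 'k) mpoly set)"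
    by (auto simp: irrelevant_ideal_eq mono_ideal_def)
  show ?thesis
    unfolding cring.depth_Quot[OF cring_poly_ring I sub] using assms by (intro Sup_upper) blast
qed

lemma var_diff_irrelevant:
  assumes "a \<in> V" "b \<in> V"
  shows "(var a - var b :: ('v, 'k::field) mpoly) \<in> irrelevant_ideal V"
proof -
  have "var ` V \<subseteq> (polys V :: ('v, 'k) mpoly set)" by auto
  from poly_ideal_diff[OF poly_genideal_ideal[OF this]] poly_genideal_superset[OF this] assms
  show ?thesis unfolding irrelevant_ideal_def by blast
qed

section \<open>Edge ideals and their Alexander duals\<close>

definition sqfree :: "'v set \<Rightarrow> 'v \<Rightarrow>\<^sub>0 nat" where
  "sqfree C = (\<Sum>v\<in>C. single v 1)"

lemma lookup_sqfree: "finite C \<Longrightarrow> lookup (sqfree C) u = (if u \<in> C then 1 else 0)"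
  by (simp add: sqfree_def lookup_sum lookup_single when_def)

lemma keys_sqfree: "finite C \<Longrightarrow> keys (sqfree C) = C"
  by (simp add: sqfree_def keys_sum_single del: One_nat_def)

lemma multiples_sqfree:
  assumes "\<And>C. C \<in> \<C> \<Longrightarrow> finite C"
  shows "multiples (sqfree ` \<C>) = {t. \<exists>C\<in>\<C>. C \<subseteq> keys t}"
proof (rule Set.set_eqI)
  fix t
  have "t \<in> multiples (sqfree ` \<C>) \<longleftrightarrow> (\<exists>C\<in>\<C>. \<exists>s. t = s + sqfree C)"
    unfolding multiples_def by blast
  also have "\<dots> \<longleftrightarrow> (\<exists>C\<in>\<C>. C \<subseteq> keys t)"
    using exists_add_sum_single_iff[OF assms, of _ t] by (simp only: sqfree_def cong: bex_cong)
  finally show "t \<in> multiples (sqfree ` \<C>) \<longleftrightarrow> t \<in> {t. \<exists>C\<in>\<C>. C \<subseteq> keys t}" by simp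
qed

lemma genideal_sqfree:
  assumes "finite V" "\<And>C. C \<in> \<C> \<Longrightarrow> C \<subseteq> V"
  shows "Idl\<^bsub>poly_ring V\<^esub> ((\<lambda>C. \<Prod>v\<in>C. var v) ` \<C>) =
    (mono_ideal V {t. \<exists>C\<in>\<C>. C \<subseteq> keys t} :: ('v, 'k::field) mpoly set)"
proof -
  have fin: "finite C" if "C \<in> \<C>" for C using assms that finite_subset by blast
  have "(\<lambda>C. \<Prod>v\<in>C. var v) ` \<C> = (\<lambda>t. single t (1::'k)) ` sqfree ` \<C>"
    using fin by (auto simp: prod_var sqfree_def image_image)
  moreover have "Idl\<^bsub>poly_ring V\<^esub> ((\<lambda>t. single t (1::'k)) ` sqfree ` \<C>) =
      mono_ideal V (multiples (sqfree ` \<C>))"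
    unfolding multiples_def
    by (rule genideal_monomials) (use keys_sqfree[OF fin] assms(2) in auto)
  ultimately show ?thesis by (simp only: multiples_sqfree[OF fin])
qed

lemma edge_ideal_eq:
  assumes V: "finite V" and E: "simple_graph V E"
  shows "edge_ideal V E = (mono_ideal V {t. \<exists>e\<in>E. e \<subseteq> keys t} :: ('v, 'k::field) mpoly set)"
proof -
  have "{var v * var w | v w. {v, w} \<in> E} = (\<lambda>C. \<Prod>v\<in>C. var v :: ('v, 'k) mpoly) ` E"
  proof safe
    fix v w assume vw: "{v, w} \<in> E"
    then have "v \<noteq> w" using E by (fastforce simp: simple_graph_def)
    then show "(var v * var w :: ('v, 'k) mpoly) \<in> (\<lambda>C. \<Prod>v\<in>C. var v) ` E"
      using vw by (intro image_eqI[OF _ vw]) simp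
  next
    fix e assume e: "e \<in> E"
    then obtain v w where "e = {v, w}" "v \<noteq> w"
      using E by (auto simp: simple_graph_def card_2_iff)
    then show "\<exists>v w. (\<Prod>v\<in>e. var v :: ('v, 'k) mpoly) = var v * var w \<and> {v, w} \<in> E"
      using e by (intro exI[of _ v] exI[of _ w]) simp
  qed
  then show ?thesis
    unfolding edge_ideal_def using genideal_sqfree[OF V, of E] E by (auto simp: simple_graph_def)
qed

lemma ideal_edge_ideal:
  assumes "finite V" "simple_graph V E"
  shows "ideal (edge_ideal V E :: ('v, 'k::field) mpoly set) (poly_ring V)"
  unfolding edge_ideal_eq[OF assms]
  by (rule ideal_mono_ideal) (auto simp: up_closed_def keys_add_nat)

text \<open>Spanned by the monomials whose support is a vertex cover. This describes the Alexander
  dual of the edge ideal (\<open>alexander_dual_edge_ideal\<close>) without its minimal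
  primes.\<close>

definition cover_ideal :: "'v set \<Rightarrow> 'v set set \<Rightarrow> ('v, 'k::field) mpoly set" where
  "cover_ideal V E = mono_ideal V {t. \<forall>e\<in>E. e \<inter> keys t \<noteq> {}}"

lemma ideal_cover_ideal: "ideal (cover_ideal V E) (poly_ring V)"
  unfolding cover_ideal_def
  by (rule ideal_mono_ideal) (simp add: up_closed_def keys_add_nat Int_Un_distrib)

lemma edge_ideal_subset_var_ideal:
  assumes "finite V" "simple_graph V E" "\<And>e. e \<in> E \<Longrightarrow> e \<inter> D \<noteq> {}"
  shows "edge_ideal V E \<subseteq> var_ideal V D"
  unfolding edge_ideal_eq[OF assms(1,2)] var_ideal_def
  using assms(3) by (intro mono_ideal_mono) blast

lemma prime_over_edge_ideal_cover:
  fixes P :: "('v, 'k::field) mpoly set"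
  assumes "finite V" "simple_graph V E" "primeideal P (poly_ring V)" "edge_ideal V E \<subseteq> P" "e \<in> E"
  shows "e \<inter> {v\<in>V. var v \<in> P} \<noteq> {}"
proof -
  obtain v w where e: "e = {v, w}" "v \<in> V" "w \<in> V"
    using assms(2,5) by (auto simp: simple_graph_def card_2_iff)
  have "v \<in> V \<and> w \<in> V" if "{v, w} \<in> E" for v w
    using that assms(2) unfolding simple_graph_def by blast
  then have "{var v * var w | v w. {v, w} \<in> E} \<subseteq> (polys V :: ('v, 'k) mpoly set)" by blast
  from poly_genideal_superset[OF this] have "var v * var w \<in> P"
    using assms(4,5) e unfolding edge_ideal_def by blast
  then show ?thesis using primeideal.I_prime[OF assms(3), of "var v" "var w"] e by auto
qed

text \<open>The variables in a prime above the edge ideal form a vertex cover, and an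
  inclusion-minimal cover generates a minimal prime whose variables are exactly this cover. Since
  every cover contains a minimal one, both ideals have the same monomials.\<close>

lemma alexander_dual_edge_ideal:
  assumes V: "finite V" and E: "simple_graph V E"
  shows "alexander_dual V (edge_ideal V E) = (cover_ideal V E :: ('v, 'k::field) mpoly set)"
proof -
  let ?D = "\<lambda>P :: ('v, 'k) mpoly set. {v\<in>V. var v \<in> P}"
  let ?I = "edge_ideal V E :: ('v, 'k) mpoly set"
  let ?\<C> = "{?D P | P. minimal_prime (poly_ring V) ?I P}"
  have "{\<Prod>v\<in>?D P. var v | P. minimal_prime (poly_ring V) ?I P} = (\<lambda>C. \<Prod>v\<in>C. var v :: ('v, 'k) mpoly) ` ?\<C>"
    by blast
  then have "alexander_dual V ?I = mono_ideal V {t. \<exists>C\<in>?\<C>. C \<subseteq> keys t}"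
    unfolding alexander_dual_def by (simp only:) (rule genideal_sqfree[OF V], blast)
  also have "\<dots> = cover_ideal V E"
    unfolding cover_ideal_def
  proof (rule mono_ideal_cong)
    fix t :: "'v \<Rightarrow>\<^sub>0 nat" assume t: "keys t \<subseteq> V"
    have "\<exists>C\<in>?\<C>. C \<subseteq> keys t" if cov: "\<forall>e\<in>E. e \<inter> keys t \<noteq> {}"
    proof -
      define F where "F = {C. C \<subseteq> keys t \<and> (\<forall>e\<in>E. e \<inter> C \<noteq> {})}"
      have "finite F" "keys t \<in> F" using cov by (auto simp: F_def)
      then have "\<exists>C\<in>F. \<forall>D\<in>F. D \<subseteq> C \<longrightarrow> C = D" by (intro finite_has_minimal) auto
      then obtain C where CF: "C \<in> F" and min: "\<And>D. D \<in> F \<Longrightarrow> D \<subseteq> C \<Longrightarrow> C = D" by blast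
      have C: "C \<subseteq> keys t" "\<And>e. e \<in> E \<Longrightarrow> e \<inter> C \<noteq> {}" using CF by (auto simp: F_def)
      have CV: "C \<subseteq> V" using C t by blast
      let ?P = "var_ideal V C :: ('v, 'k) mpoly set"
      have D: "?D ?P = C" using CV var_in_var_ideal[of _ V C] by blast
      have "minimal_prime (poly_ring V) ?I ?P"
        unfolding minimal_prime_def
      proof (intro conjI allI impI)
        show "primeideal ?P (poly_ring V)" by (rule primeideal_var_ideal[OF V])
        show "?I \<subseteq> ?P" using C(2) by (intro edge_ideal_subset_var_ideal[OF V E])
        fix Q assume Q: "primeideal Q (poly_ring V) \<and> ?I \<subseteq> Q \<and> Q \<subseteq> ?P"
        have DQ: "?D Q \<subseteq> C" using Q D by blast
        moreover have "\<forall>e\<in>E. e \<inter> ?D Q \<noteq> {}" using prime_over_edge_ideal_cover[OF V E] Q by blast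
        ultimately have "?D Q \<in> F" using C(1) unfolding F_def by blast
        then have CQ: "C = ?D Q" using DQ by (rule min)
        then have "?P \<subseteq> Q"
          using Q CQ by (intro var_ideal_subset primeideal.axioms(1)) auto
        then show "Q = ?P" using Q by blast
      qed
      then have "C \<in> ?\<C>" using D by blast
      then show ?thesis using C(1) by blast
    qed
    moreover have "\<forall>e\<in>E. e \<inter> keys t \<noteq> {}" if "\<exists>C\<in>?\<C>. C \<subseteq> keys t"
    proof
      fix e assume "e \<in> E"
      obtain P where P: "minimal_prime (poly_ring V) ?I P" "?D P \<subseteq> keys t"
        using \<open>\<exists>C\<in>?\<C>. C \<subseteq> keys t\<close> by blast
      then have "e \<inter> ?D P \<noteq> {}"
        using prime_over_edge_ideal_cover[OF V E _ _ \<open>e \<in> E\<close>, of P] unfolding minimal_prime_def by blast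
      then show "e \<inter> keys t \<noteq> {}" using P(2) by blast
    qed
    ultimately show "t \<in> {t. \<exists>C\<in>?\<C>. C \<subseteq> keys t} \<longleftrightarrow>
        t \<in> {t. \<forall>e\<in>E. e \<inter> keys t \<noteq> {}}" by blast
  qed
  finally show ?thesis .
qed

section \<open>Koszul cycles for edge ideals and their duals\<close>

lemma colon_var_mono_ideal:
  assumes u: "u \<in> V"
  shows "{f \<in> polys V. var u * f \<in> mono_ideal V M} =
    (mono_ideal V {t. single u 1 + t \<in> M} :: ('v, 'k::field) mpoly set)"
proof -
  have "keys (var u * f) \<subseteq> M \<longleftrightarrow> keys f \<subseteq> {t. single u 1 + t \<in> M}"
    for f :: "('v, 'k) mpoly"
  proof
    assume M: "keys (var u * f) \<subseteq> M"
    show "keys f \<subseteq> {t. single u 1 + t \<in> M}"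
    proof
      fix t assume "t \<in> keys f"
      then have "lookup (var u * f) (single u 1 + t) \<noteq> 0"
        unfolding var_def lookup_single_mult by (simp add: in_keys_iff)
      then show "t \<in> {t. single u 1 + t \<in> M}" using M by (auto simp: in_keys_iff)
    qed
  next
    assume M: "keys f \<subseteq> {t. single u 1 + t \<in> M}"
    show "keys (var u * f) \<subseteq> M"
    proof
      fix t assume "t \<in> keys (var u * f)"
      then obtain s where "s \<in> keys f" "t = single u 1 + s"
        using keys_mult_subset[of t "var u" f] by (auto simp: var_def)
      then show "t \<in> M" using M by blast
    qed
  qed
  then show ?thesis using u by (auto simp: mono_ideal_def)
qed

context koszul
begin

text \<open>A monomial times \<open>var u\<close> covers all edges as soon as the monomial covers
  those that avoid \<open>u\<close>. So the colon by \<open>var u\<close> deletes the edges at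
  \<open>u\<close>, and \<open>koszul_class_colon\<close> treats the vertices of \<open>U\<close>
  one by one.\<close>

lemma koszul_class_cover_ideal_avoid:
  assumes "finite U" "U \<subseteq> V"
    and "koszul_class (cover_ideal V {e\<in>E. e \<inter> U = {}} :: ('v, 'k::field) mpoly set) q"
  shows "koszul_class (cover_ideal V E :: ('v, 'k) mpoly set) q"
  using assms
proof (induction U rule: finite_induct)
  case empty
  then show ?case by simp
next
  case (insert u U)
  let ?E = "{e\<in>E. e \<inter> U = {}}"
  have "{f \<in> polys V. var u * f \<in> cover_ideal V ?E} =
      (cover_ideal V {e\<in>E. e \<inter> insert u U = {}} :: ('v, 'k) mpoly set)"
    unfolding cover_ideal_def using insert.prems(1)
    by (subst colon_var_mono_ideal) (auto intro!: mono_ideal_cong simp: keys_add_nat)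
  then have "koszul_class (cover_ideal V ?E :: ('v, 'k) mpoly set) q"
    using insert.prems
    by (intro koszul_class_colon[OF ideal_cover_ideal, where u = u])
       (auto simp: cover_ideal_def intro: set_zero_mono_ideal)
  then show ?case using insert by simp
qed

text \<open>Deleting all edges that meet \<open>V - W\<close> leaves the subgraph induced on
  \<open>W\<close>, so cycles may be sought on a few vertices.\<close>

lemma koszul_class_cover_ideal:
  assumes "W \<subseteq> V" "\<And>e. e \<in> E \<Longrightarrow> e \<subseteq> V"
    and "koszul_class (cover_ideal V {e\<in>E. e \<subseteq> W} :: ('v, 'k::field) mpoly set) q"
  shows "koszul_class (cover_ideal V E :: ('v, 'k) mpoly set) q"
proof -
  have "{e\<in>E. e \<subseteq> W} = {e\<in>E. e \<inter> (V - W) = {}}" using assms(1,2) by blast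
  then show ?thesis
    using koszul_class_cover_ideal_avoid[of "V - W" E q] assms(3) fin by auto
qed

text \<open>The dual of a single edge is generated by its two variables. This caps the depth of the
  dual quotient at \<open>card V - 2\<close>, its dimension.\<close>

lemma koszul_class_cover_ideal_edge:
  assumes E: "simple_graph V E" and e: "e \<in> E"
  shows "koszul_class (cover_ideal V E :: ('v, 'k::field) mpoly set) 2"
proof (rule koszul_class_cover_ideal)
  have eV: "e \<subseteq> V" "card e = 2" using E e by (auto simp: simple_graph_def)
  then show "e \<subseteq> V" by simp
  show "e' \<subseteq> V" if "e' \<in> E" for e' using E that by (auto simp: simple_graph_def)
  have "e' = e" if "e' \<in> E" "e' \<subseteq> e" for e'
    using that eV E card_subset_eq[of e e'] by (metis card.infinite simple_graph_def zero_neq_numeral)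
  then have "{e'\<in>E. e' \<subseteq> e} = {e}" using e by blast
  moreover have "koszul_class (cover_ideal V {e} :: ('v, 'k) mpoly set) (card e)"
  proof (rule koszul_class_variables[OF ideal_cover_ideal eV(1)])
    show "var v \<in> (cover_ideal V {e} :: ('v, 'k) mpoly set)" if "v \<in> e" for v
      using that eV by (auto simp: cover_ideal_def var_in_mono_ideal_iff)
    show "lookup f 0 = 0" if "f \<in> cover_ideal V {e}" for f :: "('v, 'k) mpoly"
      using that by (auto simp: cover_ideal_def mono_ideal_def in_keys_iff)
  qed
  ultimately show "koszul_class (cover_ideal V {e'\<in>E. e' \<subseteq> e} :: ('v, 'k) mpoly set) 2"
    using eV(2) by simp
qed

text \<open>To cover two disjoint edges means to take a vertex from each, so their dual is the edge
  ideal of the complete bipartite graph between \<open>e1\<close> and \<open>e2\<close>; hence the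
  degree 2 + 2 - 1.\<close>

lemma koszul_class_cover_ideal_gap:
  assumes E: "simple_graph V E" and e: "e1 \<in> E" "e2 \<in> E" "e1 \<inter> e2 = {}"
    and gap: "\<And>e. e \<in> E \<Longrightarrow> e \<subseteq> e1 \<union> e2 \<Longrightarrow> e = e1 \<or> e = e2"
  shows "koszul_class (cover_ideal V E :: ('v, 'k::field) mpoly set) 3"
proof (rule koszul_class_cover_ideal)
  have eV: "e1 \<subseteq> V" "card e1 = 2" "e2 \<subseteq> V" "card e2 = 2" using E e by (auto simp: simple_graph_def)
  then show "e1 \<union> e2 \<subseteq> V" by simp
  show "e' \<subseteq> V" if "e' \<in> E" for e' using E that by (auto simp: simple_graph_def)
  have "{e\<in>E. e \<subseteq> e1 \<union> e2} = {e1, e2}" using e gap by blast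
  moreover have "koszul_class (cover_ideal V {e1, e2} :: ('v, 'k) mpoly set) (card e1 + card e2 - 1)"
  proof (rule koszul_class_complete_bipartite[OF ideal_cover_ideal eV(1,3) e(3)])
    show "e1 \<noteq> {}" "e2 \<noteq> {}" using eV by auto
    show "var a * var b \<in> (cover_ideal V {e1, e2} :: ('v, 'k) mpoly set)" if "a \<in> e1" "b \<in> e2" for a b
    proof -
      have "a \<in> V" "b \<in> V" using that eV by auto
      then show ?thesis
        unfolding var_mult_var cover_ideal_def using that
        by (subst single_in_mono_ideal_iff) (auto simp: keys_add_nat)
    qed
    show "lookup f (single v 1) = 0" if "f \<in> cover_ideal V {e1, e2}" "v \<in> V"
      for f :: "('v, 'k) mpoly" and v
    proof (rule ccontr)
      assume "lookup f (single v 1) \<noteq> 0"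
      then have "single v 1 \<in> keys f" by (simp add: in_keys_iff)
      then have "v \<in> e1 \<and> v \<in> e2" using that by (auto simp: cover_ideal_def mono_ideal_def)
      then show False using e(3) by blast
    qed
  qed
  ultimately show "koszul_class (cover_ideal V {e\<in>E. e \<subseteq> e1 \<union> e2} :: ('v, 'k) mpoly set) 3"
    using eV by simp
qed

lemma koszul_class_edge_ideal:
  assumes E: "simple_graph V E" and AB: "A \<noteq> {}" "B \<noteq> {}" "\<And>a b. a \<in> A \<Longrightarrow> b \<in> B \<Longrightarrow> {a, b} \<in> E"
  shows "koszul_class (edge_ideal V E :: ('v, 'k::field) mpoly set) (card A + card B - 1)"
proof (rule koszul_class_complete_bipartite[OF ideal_edge_ideal[OF fin E]])
  show sub: "A \<subseteq> V" "B \<subseteq> V" using E AB unfolding simple_graph_def by blast+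
  show "A \<inter> B = {}"
  proof (rule ccontr)
    assume "A \<inter> B \<noteq> {}"
    then obtain a where "{a, a} \<in> E" using AB(3) by blast
    then show False using E by (fastforce simp: simple_graph_def)
  qed
  show "A \<noteq> {}" "B \<noteq> {}" by fact+
  show "var a * var b \<in> (edge_ideal V E :: ('v, 'k) mpoly set)" if "a \<in> A" "b \<in> B" for a b
  proof -
    have "a \<in> V" "b \<in> V" using that sub by auto
    then show ?thesis
      unfolding var_mult_var edge_ideal_eq[OF fin E] using AB(3)[OF that]
      by (subst single_in_mono_ideal_iff) (auto simp: keys_add_nat intro!: bexI[of _ "{a, b}"])
  qed
  show "lookup f (single v 1) = 0" if "f \<in> edge_ideal V E" "v \<in> V"
    for f :: "('v, 'k) mpoly" and v
  proof (rule ccontr)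
    assume "lookup f (single v 1) \<noteq> 0"
    then have "single v 1 \<in> keys f" by (simp add: in_keys_iff)
    moreover have "keys f \<subseteq> {t. \<exists>e\<in>E. e \<subseteq> keys t}"
      using that(1) by (simp add: edge_ideal_eq[OF fin E] mono_ideal_def)
    ultimately have "single v (1::nat) \<in> {t. \<exists>e\<in>E. e \<subseteq> keys t}"
      by (rule rev_subsetD)
    then obtain e where e: "e \<in> E" "e \<subseteq> {v}" by auto
    then have "card e \<le> 1" using card_mono[of "{v}" e] by simp
    then show False using e(1) E by (auto simp: simple_graph_def)
  qed
qed

end

section \<open>Dimensions of the two quotients\<close>

lemma koszul_exists: "finite V \<Longrightarrow> \<exists>ix. koszul V ix"
  using finite_imp_inj_to_nat_seg[of V] by (auto simp: koszul_def)

text \<open>The complement of an independent set is a vertex cover, and its variables generate a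
  prime above the edge ideal.\<close>

lemma krull_dim_edge_ideal_ge:
  assumes V: "finite V" and E: "simple_graph V E" and A: "A \<subseteq> V" "independent_set E A"
  shows "enat (card A) \<le> krull_dim (poly_ring V Quot (edge_ideal V E :: ('v, 'k::field) mpoly set))"
proof -
  have "e \<inter> (V - A) \<noteq> {}" if "e \<in> E" for e
  proof -
    have "e \<subseteq> V" "\<not> e \<subseteq> A" using that E A(2) by (auto simp: simple_graph_def independent_set_def)
    then show ?thesis by blast
  qed
  then have "enat (card (V - (V - A))) \<le> krull_dim (poly_ring V Quot (edge_ideal V E :: ('v, 'k) mpoly set))"
    by (intro krull_dim_ge_var_ideal[OF V ideal_edge_ideal[OF V E]] edge_ideal_subset_var_ideal[OF V E]) auto
  moreover have "V - (V - A) = A" using A(1) by blast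
  ultimately show ?thesis by simp
qed

lemma krull_dim_edge_ideal_le:
  assumes V: "finite V" and E: "simple_graph V E"
    and A: "\<And>A. A \<subseteq> V \<Longrightarrow> independent_set E A \<Longrightarrow> card A \<le> d"
  shows "krull_dim (poly_ring V Quot (edge_ideal V E :: ('v, 'k::field) mpoly set)) \<le> enat d"
proof (rule krull_dim_le[OF V ideal_edge_ideal[OF V E]])
  fix P :: "('v, 'k) mpoly set" assume P: "primeideal P (poly_ring V)" "edge_ideal V E \<subseteq> P"
  have "independent_set E {v\<in>V. var v \<notin> P}"
    unfolding independent_set_def
    using prime_over_edge_ideal_cover[OF V E P] by blast
  then show "card {v\<in>V. var v \<notin> P} \<le> d" by (intro A) auto
qed

lemma krull_dim_cover_ideal_ge:
  assumes V: "finite V" and E: "simple_graph V E" and e: "e \<in> E"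
  shows "enat (card V - 2) \<le> krull_dim (poly_ring V Quot (cover_ideal V E :: ('v, 'k::field) mpoly set))"
proof -
  have eV: "e \<subseteq> V" "card e = 2" using E e by (auto simp: simple_graph_def)
  have "(cover_ideal V E :: ('v, 'k) mpoly set) \<subseteq> var_ideal V e"
    unfolding cover_ideal_def var_ideal_def using e by (intro mono_ideal_mono) blast
  from krull_dim_ge_var_ideal[OF V ideal_cover_ideal eV(1) this] show ?thesis
    using eV card_Diff_subset[of e V] V finite_subset by metis
qed

lemma prime_prod_var:
  assumes P: "primeideal P (poly_ring V)" and "finite C" "C \<subseteq> V" "(\<Prod>v\<in>C. var v) \<in> P"
  shows "\<exists>v\<in>C. var v \<in> P"
  using assms(2-4)
proof (induction C rule: finite_induct)
  case empty
  then have "1 \<in> P" by simp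
  then show ?case
    using poly_ideal_one[OF primeideal.axioms(1)[OF P]] primeideal.I_notcarr[OF P] by metis
next
  case (insert v C)
  have "var v \<in> P \<or> (\<Prod>v\<in>C. var v) \<in> P"
    using insert.prems insert.hyps primeideal.I_prime[OF P, of "var v" "\<Prod>v\<in>C. var v"] by auto
  then show ?case using insert.IH insert.prems by blast
qed

text \<open>The variables outside a prime above the cover ideal cannot form a cover, since the prime
  would contain their product and hence one of them. So they miss both ends of some edge.\<close>

lemma krull_dim_cover_ideal_le:
  assumes V: "finite V" and E: "simple_graph V E"
  shows "krull_dim (poly_ring V Quot (cover_ideal V E :: ('v, 'k::field) mpoly set)) \<le> enat (card V - 2)"
proof (rule krull_dim_le[OF V ideal_cover_ideal])
  fix P :: "('v, 'k) mpoly set" assume P: "primeideal P (poly_ring V)" "cover_ideal V E \<subseteq> P"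
  let ?C = "{v\<in>V. var v \<notin> P}"
  have C: "finite ?C" "?C \<subseteq> V" using V by auto
  have "\<exists>e\<in>E. e \<inter> ?C = {}"
  proof (rule ccontr)
    assume "\<not> (\<exists>e\<in>E. e \<inter> ?C = {})"
    then have "(\<Prod>v\<in>?C. var v) \<in> (cover_ideal V E :: ('v, 'k) mpoly set)"
      unfolding prod_var[OF C(1)] cover_ideal_def
      by (subst single_in_mono_ideal_iff) (use keys_sum_single[OF C(1)] in auto)
    then have "(\<Prod>v\<in>?C. var v) \<in> P" using P(2) by blast
    then show False using prime_prod_var[OF P(1) C] by blast
  qed
  then obtain e where e: "e \<in> E" "e \<inter> ?C = {}" by blast
  then have eV: "e \<subseteq> V" "card e = 2" using E by (auto simp: simple_graph_def)
  have "card ?C \<le> card (V - e)" using e(2) V by (intro card_mono) auto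
  also have "\<dots> = card V - 2" using eV card_Diff_subset[of e V] V finite_subset by metis
  finally show "card ?C \<le> card V - 2" .
qed

section \<open>From Cohen-Macaulayness to the staircase labeling\<close>

text \<open>The hypothesis \<open>count\<close> is the form in which the Cohen-Macaulay property enters: \<open>C \<union> D\<close> is an
  independent set, a lower bound for the dimension, and \<open>X\<close>, \<open>Y\<close> span a complete bipartite subgraph,
  which bounds the depth from above.\<close>

lemma nested_degrees_injective:
  fixes r :: "'a \<Rightarrow> 'b \<Rightarrow> bool"
  assumes fin: "finite A" "finite B" and ne: "A \<noteq> {}"
    and right: "\<And>a. a \<in> A \<Longrightarrow> \<exists>b\<in>B. r a b" and left: "\<And>b. b \<in> B \<Longrightarrow> \<exists>a\<in>A. r a b"
    and no_gap: "\<And>a a' b b'. a \<in> A \<Longrightarrow> a' \<in> A \<Longrightarrow> b \<in> B \<Longrightarrow> b' \<in> B \<Longrightarrow> r a b \<Longrightarrow> r a' b' \<Longrightarrow> r a b' \<or> r a' b"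
    and count: "\<And>C D X Y. C \<subseteq> A \<Longrightarrow> D \<subseteq> B \<Longrightarrow> (\<And>a b. a \<in> C \<Longrightarrow> b \<in> D \<Longrightarrow> \<not> r a b) \<Longrightarrow>
      X \<subseteq> A \<Longrightarrow> Y \<subseteq> B \<Longrightarrow> X \<noteq> {} \<Longrightarrow> Y \<noteq> {} \<Longrightarrow> (\<And>a b. a \<in> X \<Longrightarrow> b \<in> Y \<Longrightarrow> r a b) \<Longrightarrow>
      card C + card D + card X + card Y \<le> card A + card B + 1"
  shows "card B \<le> card A" "inj_on (\<lambda>a. card {b\<in>B. r a b}) A"
    and "\<And>a a'. a \<in> A \<Longrightarrow> a' \<in> A \<Longrightarrow> card {b\<in>B. r a b} \<le> card {b\<in>B. r a' b} \<Longrightarrow> {b\<in>B. r a b} \<subseteq> {b\<in>B. r a' b}"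
proof -
  let ?N = "\<lambda>a. {b\<in>B. r a b}"
  have chain: "?N a \<subseteq> ?N a' \<or> ?N a' \<subseteq> ?N a" if "a \<in> A" "a' \<in> A" for a a'
    using no_gap[OF that] by blast
  show le: "?N a \<subseteq> ?N a'" if "a \<in> A" "a' \<in> A" "card (?N a) \<le> card (?N a')" for a a'
  proof -
    have "?N a' = ?N a" if "?N a' \<subseteq> ?N a"
      using that fin(2) \<open>card (?N a) \<le> card (?N a')\<close> by (intro card_seteq) auto
    then show ?thesis using chain[OF that(1,2)] by blast
  qed
  obtain a0 where a0: "a0 \<in> A" "\<And>a. a \<in> A \<Longrightarrow> card (?N a) \<le> card (?N a0)"
  proof -
    have "Max ((\<lambda>a. card (?N a)) ` A) \<in> (\<lambda>a. card (?N a)) ` A" using fin ne by (intro Max_in) auto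
    then obtain a0 where a0: "a0 \<in> A" "Max ((\<lambda>a. card (?N a)) ` A) = card (?N a0)" by blast
    have "card (?N a) \<le> card (?N a0)" if "a \<in> A" for a
      unfolding a0(2)[symmetric] using that fin by (intro Max_ge) auto
    then show thesis using that a0(1) by blast
  qed
  have full: "r a0 b" if b: "b \<in> B" for b
  proof -
    obtain a where a: "a \<in> A" "r a b" using left[OF b] by blast
    then show ?thesis using le[OF a(1) a0(1) a0(2)[OF a(1)]] b by blast
  qed
  have Bne: "B \<noteq> {}" using right[OF a0(1)] by blast
  \<comment> \<open>The independent set \<open>B\<close> is compared with the star that joins
    \<open>a0\<close> to all of \<open>B\<close>.\<close>
  have "card ({} :: 'a set) + card B + card {a0} + card B \<le> card A + card B + 1"
    using a0(1) Bne full by (intro count) auto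
  then show "card B \<le> card A" by simp
  show "inj_on (\<lambda>a. card (?N a)) A"
  proof (rule inj_onI, rule ccontr)
    fix a a' assume aa: "a \<in> A" "a' \<in> A" "card (?N a) = card (?N a')" "a \<noteq> a'"
    \<comment> \<open>\<open>?S\<close> and \<open>?L\<close> cut the chain of neighbourhoods at
      that of \<open>a\<close>. Together they are \<open>A\<close>, and both contain
      \<open>a\<close> and \<open>a'\<close>, so their sizes add up to at least
      \<open>|A| + 2\<close>.\<close>
    let ?S = "{c\<in>A. ?N c \<subseteq> ?N a}" and ?L = "{c\<in>A. ?N a \<subseteq> ?N c}"
    have "?N a = ?N a'" using le aa by (intro equalityI) auto
    then have sub: "{a, a'} \<subseteq> ?S \<inter> ?L" using aa by blast
    have "?S \<union> ?L = A" using chain[OF _ aa(1)] by blast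
    then have "card A + card (?S \<inter> ?L) = card ?S + card ?L"
      using fin by (metis (no_types, lifting) card_Un_Int finite_Un)
    moreover have "2 \<le> card (?S \<inter> ?L)"
      using card_mono[OF _ sub] fin aa(4) by simp
    \<comment> \<open>This instance gives \<open>|L| \<le> |B| - |N a| + 1\<close>, the next one
      \<open>|S| \<le> |A| - |B - N a|\<close>, so \<open>|S| + |L| \<le> |A| + 1\<close>.\<close>
    moreover have "card A + card ({} :: 'b set) + card ?L + card (?N a) \<le> card A + card B + 1"
      using right[OF aa(1)] aa(1) by (intro count) auto
    moreover have "card ?S + card (B - ?N a) + card {a0} + card B \<le> card A + card B + 1"
      using a0(1) Bne full by (intro count) auto
    moreover have "card (B - ?N a) + card (?N a) = card B"
      using fin card_mono[of B "?N a"] by (subst card_Diff_subset) auto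
    ultimately show False by simp
  qed
qed

text \<open>On each side the degrees are distinct numbers between 1 and \<open>n\<close>, hence all
  of them. A neighbourhood contains with a vertex all those of larger degree, so adjacency is a
  threshold condition on the sum of the two degrees.\<close>

lemma staircase_relation:
  fixes r :: "'a \<Rightarrow> 'b \<Rightarrow> bool"
  assumes fin: "finite A" "finite B" and ne: "A \<noteq> {}" "B \<noteq> {}"
    and right: "\<And>a. a \<in> A \<Longrightarrow> \<exists>b\<in>B. r a b" and left: "\<And>b. b \<in> B \<Longrightarrow> \<exists>a\<in>A. r a b"
    and no_gap: "\<And>a a' b b'. a \<in> A \<Longrightarrow> a' \<in> A \<Longrightarrow> b \<in> B \<Longrightarrow> b' \<in> B \<Longrightarrow> r a b \<Longrightarrow> r a' b' \<Longrightarrow> r a b' \<or> r a' b"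
    and count: "\<And>C D X Y. C \<subseteq> A \<Longrightarrow> D \<subseteq> B \<Longrightarrow> (\<And>a b. a \<in> C \<Longrightarrow> b \<in> D \<Longrightarrow> \<not> r a b) \<Longrightarrow>
      X \<subseteq> A \<Longrightarrow> Y \<subseteq> B \<Longrightarrow> X \<noteq> {} \<Longrightarrow> Y \<noteq> {} \<Longrightarrow> (\<And>a b. a \<in> X \<Longrightarrow> b \<in> Y \<Longrightarrow> r a b) \<Longrightarrow>
      card C + card D + card X + card Y \<le> card A + card B + 1"
    and n: "n = card A"
  shows "card B = n" and "\<exists>v w. bij_betw v {1..n} A \<and> bij_betw w {1..n} B \<and>
      (\<forall>i\<in>{1..n}. \<forall>j\<in>{1..n}. r (v i) (w j) \<longleftrightarrow> i \<le> j)"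
proof -
  let ?N = "\<lambda>a. {b\<in>B. r a b}" and ?M = "\<lambda>b. {a\<in>A. r a b}"
  note h1 = nested_degrees_injective[OF fin ne(1) right left no_gap count]
  have count': "card D + card C + card Y + card X \<le> card B + card A + 1"
    if "D \<subseteq> B" "C \<subseteq> A" "\<And>b a. b \<in> D \<Longrightarrow> a \<in> C \<Longrightarrow> \<not> r a b"
      "Y \<subseteq> B" "X \<subseteq> A" "Y \<noteq> {}" "X \<noteq> {}" "\<And>b a. b \<in> Y \<Longrightarrow> a \<in> X \<Longrightarrow> r a b" for C D X Y
    using count[of C D X Y] that by (simp add: add_ac)
  have no_gap': "r a b' \<or> r a' b" if "b \<in> B" "b' \<in> B" "a \<in> A" "a' \<in> A" "r a b" "r a' b'" for a a' b b'
    using no_gap[of a a' b b'] that by blast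
  \<comment> \<open>The hypotheses are symmetric, so the same argument with the sides exchanged
    yields the reverse inequality of sizes and distinct degrees in \<open>B\<close>.\<close>
  note h2 = nested_degrees_injective[of B A "\<lambda>b a. r a b", OF fin(2,1) ne(2) left right _ count']
  have h2': "card A \<le> card B" "inj_on (\<lambda>b. card (?M b)) B"
    by (rule h2; use no_gap' in blast)+
  have h1': "card B \<le> card A" "inj_on (\<lambda>a. card (?N a)) A" by (rule h1; assumption)+
  show Bn: "card B = n" using h1'(1) h2'(1) n by simp
  have bij: "bij_betw f D {1..n}" if "inj_on f D" "\<And>x. x \<in> D \<Longrightarrow> 1 \<le> f x \<and> f x \<le> n" "card D = n" "finite D"
    for f and D :: "'d set"
  proof -
    have "f ` D = {1..n}" using that by (intro card_seteq) (auto simp: card_image)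
    then show ?thesis using that(1) by (simp add: bij_betw_def)
  qed
  have degN: "1 \<le> card (?N a) \<and> card (?N a) \<le> n" if "a \<in> A" for a
    using right[OF that] card_mono[of B "?N a"] fin Bn card_gt_0_iff[of "?N a"] by (auto simp: Suc_le_eq)
  have degM: "1 \<le> card (?M b) \<and> card (?M b) \<le> n" if "b \<in> B" for b
    using left[OF that] card_mono[of A "?M b"] fin n card_gt_0_iff[of "?M b"] by (auto simp: Suc_le_eq)
  have bN: "bij_betw (\<lambda>a. card (?N a)) A {1..n}" using h1'(2) degN n fin by (intro bij) auto
  have bM: "bij_betw (\<lambda>b. card (?M b)) B {1..n}" using h2'(2) degM Bn fin by (intro bij) auto
  \<comment> \<open>For \<open>1 \<le> k\<close>, \<open>n + 1 - k\<close> vertices of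
    \<open>A\<close> have degree at least \<open>k\<close>. If \<open>a\<close> is adjacent to
    \<open>b\<close>, all those of degree at least that of \<open>a\<close> are neighbours of
    \<open>b\<close>; otherwise every neighbour of \<open>b\<close> has strictly larger degree than
    \<open>a\<close>.\<close>
  have edge: "r a b \<longleftrightarrow> n + 1 \<le> card (?N a) + card (?M b)" if a: "a \<in> A" and b: "b \<in> B" for a b
  proof -
    let ?k = "card (?N a)"
    have up: "a' \<in> ?M b" if "a'' \<in> A" "a' \<in> A" "r a'' b" "card (?N a'') \<le> card (?N a')" for a' a''
    proof -
      have "?N a'' \<subseteq> ?N a'" by (rule h1(3); (assumption | rule that))
      then show ?thesis using that b by blast
    qed
    have card_ge: "card {a'\<in>A. k \<le> card (?N a')} = n + 1 - k" if "1 \<le> k" for k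
    proof -
      have img: "(\<lambda>a. card (?N a)) ` {a'\<in>A. k \<le> card (?N a')} = {k..n}"
      proof
        show "{k..n} \<subseteq> (\<lambda>a. card (?N a)) ` {a'\<in>A. k \<le> card (?N a')}"
        proof
          fix i assume i: "i \<in> {k..n}"
          then have "i \<in> (\<lambda>a. card (?N a)) ` A" using bN that by (auto simp: bij_betw_def)
          then obtain c where "c \<in> A" "i = card (?N c)" by blast
          then show "i \<in> (\<lambda>a. card (?N a)) ` {a'\<in>A. k \<le> card (?N a')}" using i by auto
        qed
      qed (use degN in auto)
      have "inj_on (\<lambda>a. card (?N a)) {a'\<in>A. k \<le> card (?N a')}"
        using h1'(2) by (rule inj_on_subset) auto
      from card_image[OF this] show ?thesis unfolding img by simp
    qed
    show ?thesis
    proof (cases "r a b")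
      case True
      have "{a'\<in>A. ?k \<le> card (?N a')} \<subseteq> ?M b" using up[OF a _ True] by blast
      then have "n + 1 - ?k \<le> card (?M b)"
        using card_mono[of "?M b" "{a'\<in>A. ?k \<le> card (?N a')}"] fin card_ge[of ?k] degN[OF a] by simp
      then show ?thesis using True by linarith
    next
      case False
      have "?M b \<subseteq> {a'\<in>A. Suc ?k \<le> card (?N a')}"
      proof
        fix c assume c: "c \<in> ?M b"
        show "c \<in> {a'\<in>A. Suc ?k \<le> card (?N a')}"
          using up[of c a] a c False by (cases "Suc ?k \<le> card (?N c)") auto
      qed
      then have "card (?M b) \<le> n + 1 - Suc ?k"
        using card_mono[of "{a'\<in>A. Suc ?k \<le> card (?N a')}" "?M b"] fin card_ge[of "Suc ?k"] by simp
      then have "\<not> n + 1 \<le> ?k + card (?M b)" using degN[OF a] by linarith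
      then show ?thesis using False by simp
    qed
  qed
  \<comment> \<open>\<open>v i\<close> has degree \<open>n + 1 - i\<close> and \<open>w j\<close>
    has degree \<open>j\<close>, so the threshold \<open>n + 1\<close> on the sum becomes
    \<open>i \<le> j\<close>.\<close>
  define v where "v i = inv_into A (\<lambda>a. card (?N a)) (n + 1 - i)" for i
  define w where "w = inv_into B (\<lambda>b. card (?M b))"
  have rev: "bij_betw (\<lambda>i. n + 1 - i) {1..n} {1..n}"
    by (rule bij_betw_byWitness[of _ "\<lambda>i. n + 1 - i"]) auto
  have bv: "bij_betw v {1..n} A"
    using bij_betw_trans[OF rev bij_betw_inv_into[OF bN]] unfolding v_def comp_def .
  have bw: "bij_betw w {1..n} B" unfolding w_def by (rule bij_betw_inv_into[OF bM])
  have "r (v i) (w j) \<longleftrightarrow> i \<le> j" if "i \<in> {1..n}" "j \<in> {1..n}" for i j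
  proof -
    have "card (?N (v i)) = n + 1 - i"
      unfolding v_def using that(1) bN by (intro bij_betw_inv_into_right[OF bN]) auto
    moreover have "card (?M (w j)) = j"
      unfolding w_def using that(2) by (intro bij_betw_inv_into_right[OF bM])
    moreover have "v i \<in> A" "w j \<in> B" using bv bw that by (auto simp: bij_betw_def)
    ultimately show ?thesis using edge[of "v i" "w j"] that by auto
  qed
  then show "\<exists>v w. bij_betw v {1..n} A \<and> bij_betw w {1..n} B \<and>
      (\<forall>i\<in>{1..n}. \<forall>j\<in>{1..n}. r (v i) (w j) \<longleftrightarrow> i \<le> j)"
    using bv bw by blast
qed

lemma bipartite_edge:
  assumes "simple_graph V E" "bipartition V E V1 V2" "e \<in> E"
  shows "\<exists>a\<in>V1. \<exists>b\<in>V2. e = {a, b}"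
proof -
  obtain x y where e: "e = {x, y}" "x \<noteq> y" "x \<in> V" "y \<in> V"
    using assms(1,3) by (auto simp: simple_graph_def card_2_iff)
  have "\<not> {x, y} \<subseteq> V1" "\<not> {x, y} \<subseteq> V2"
    using assms(2,3) e(1) by (auto simp: bipartition_def independent_set_def)
  moreover have "x \<in> V1 \<union> V2" "y \<in> V1 \<union> V2" using e assms(2) by (auto simp: bipartition_def)
  ultimately show ?thesis using e(1) by (metis Un_iff empty_subsetI insert_commute insert_subset)
qed

theorem staircase_if_bi_cohen_macaulay:
  fixes V V1 V2 :: "'v set" and E :: "'v set set"
  assumes V: "finite V" and E: "simple_graph V E" and ne: "V \<noteq> {}"
    and iso: "no_isolated_vertices V E" and bip: "bipartition V E V1 V2"
    and cm: "bi_cohen_macaulay TYPE('k::field) V E"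
    and n: "n = card V1"
  shows "card V2 = n \<and> (\<exists>v w :: nat \<Rightarrow> 'v. bij_betw v {1..n} V1 \<and> bij_betw w {1..n} V2 \<and>
       E = {{v i, w j} | i j. 1 \<le> i \<and> i \<le> j \<and> j \<le> n})"
proof -
  obtain ix where "koszul V ix" using koszul_exists[OF V] by blast
  then interpret koszul V ix .
  let ?S = "poly_ring V :: ('v, 'k) mpoly ring"
  let ?I = "edge_ideal V E :: ('v, 'k) mpoly set" and ?J = "cover_ideal V E :: ('v, 'k) mpoly set"
  have cmI: "depth_quot V ?I = krull_dim (?S Quot ?I)"
    and cmJ: "depth_quot V ?J = krull_dim (?S Quot ?J)"
    using cm unfolding bi_cohen_macaulay_def cohen_macaulay_ideal_def alexander_dual_edge_ideal[OF V E]
    by auto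
  have V12: "V = V1 \<union> V2" "V1 \<inter> V2 = {}" and fin12: "finite V1" "finite V2"
    using bip V by (auto simp: bipartition_def)
  have cardV: "card V = card V1 + card V2" using V12 fin12 by (simp add: card_Un_disjoint)
  note edge = bipartite_edge[OF E bip]
  have right: "\<exists>b\<in>V2. {a, b} \<in> E" if a: "a \<in> V1" for a
  proof -
    obtain e where e: "e \<in> E" "a \<in> e" using iso a V12 by (auto simp: no_isolated_vertices_def)
    obtain x y where "x \<in> V1" "y \<in> V2" "e = {x, y}" using edge[OF e(1)] by blast
    then show ?thesis using e a V12(2) by blast
  qed
  have left: "\<exists>a\<in>V1. {a, b} \<in> E" if b: "b \<in> V2" for b
  proof -
    obtain e where e: "e \<in> E" "b \<in> e" using iso b V12 by (auto simp: no_isolated_vertices_def)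
    obtain x y where "x \<in> V1" "y \<in> V2" "e = {x, y}" using edge[OF e(1)] by blast
    then show ?thesis using e b V12(2) by blast
  qed
  have ne12: "V1 \<noteq> {}" "V2 \<noteq> {}" using ne V12 left right by blast+
  have no_gap: "{a, b'} \<in> E \<or> {a', b} \<in> E"
    if "a \<in> V1" "a' \<in> V1" "b \<in> V2" "b' \<in> V2" and ab: "{a, b} \<in> E" "{a', b'} \<in> E" for a a' b b'
  proof (rule ccontr)
    assume no: "\<not> ({a, b'} \<in> E \<or> {a', b} \<in> E)"
    have disj: "a \<noteq> a'" "b \<noteq> b'" "a \<noteq> b" "a \<noteq> b'" "a' \<noteq> b" "a' \<noteq> b'"
      using that no V12(2) by auto
    have "koszul_class ?J 3"
    proof (rule koszul_class_cover_ideal_gap[OF E ab])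
      show "{a, b} \<inter> {a', b'} = {}" using disj by auto
      fix e assume e: "e \<in> E" "e \<subseteq> {a, b} \<union> {a', b'}"
      obtain x y where xy: "x \<in> V1" "y \<in> V2" "e = {x, y}" using edge[OF e(1)] by blast
      then have "x = a \<or> x = a'" "y = b \<or> y = b'" using e(2) that V12(2) by blast+
      then show "e = {a, b} \<or> e = {a', b'}" using xy(3) e(1) no by auto
    qed
    then have "depth_quot V ?J \<le> enat (card V - 3)"
      by (rule depth_le_koszul_class[OF ideal_cover_ideal])
    then have "enat (card V - 2) \<le> enat (card V - 3)"
      using krull_dim_cover_ideal_ge[OF V E ab(1), where 'k = 'k] unfolding cmJ by (rule order_trans[rotated])
    \<comment> \<open>Four distinct vertices ensure that the truncated differences
      \<open>card V - 2\<close> and \<open>card V - 3\<close> are different.\<close>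
    moreover have "card {a, b, a', b'} \<le> card V" using that V12 V by (intro card_mono) auto
    ultimately show False using disj by simp
  qed
  have count: "card C + card D + card X + card Y \<le> card V1 + card V2 + 1"
    if CD: "C \<subseteq> V1" "D \<subseteq> V2" "\<And>a b. a \<in> C \<Longrightarrow> b \<in> D \<Longrightarrow> {a, b} \<notin> E"
      and XY: "X \<subseteq> V1" "Y \<subseteq> V2" "X \<noteq> {}" "Y \<noteq> {}" "\<And>a b. a \<in> X \<Longrightarrow> b \<in> Y \<Longrightarrow> {a, b} \<in> E" for C D X Y
  proof -
    have ind: "independent_set E (C \<union> D)"
      unfolding independent_set_def
    proof (intro ballI notI)
      fix e assume e: "e \<in> E" "e \<subseteq> C \<union> D"
      obtain x y where xy: "x \<in> V1" "y \<in> V2" "e = {x, y}" using edge[OF e(1)] by blast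
      then have "x \<in> C" "y \<in> D" using e(2) CD(1,2) V12(2) by blast+
      then show False using CD(3) e(1) xy(3) by blast
    qed
    have kc: "koszul_class ?I (card X + card Y - 1)" by (rule koszul_class_edge_ideal[OF E XY(3-5)])
    then have "depth_quot V ?I \<le> enat (card V - (card X + card Y - 1))"
      by (rule depth_le_koszul_class[OF ideal_edge_ideal[OF V E]])
    moreover have "enat (card (C \<union> D)) \<le> krull_dim (?S Quot ?I)"
      using CD V12 by (intro krull_dim_edge_ideal_ge[OF V E _ ind]) auto
    ultimately have "enat (card (C \<union> D)) \<le> enat (card V - (card X + card Y - 1))"
      unfolding cmI by (rule order_trans[rotated])
    then have "card (C \<union> D) \<le> card V - (card X + card Y - 1)" by simp
    \<comment> \<open>This turns the truncated difference into an inequality between sums.\<close>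
    moreover have "card X + card Y - 1 \<le> card V"
      by (rule koszul_class_le[OF ideal_edge_ideal[OF V E] kc])
    moreover have "card (C \<union> D) = card C + card D"
    proof (rule card_Un_disjoint)
      show "finite C" "finite D" "C \<inter> D = {}" using CD(1,2) fin12 V12(2) finite_subset by blast+
    qed
    ultimately show ?thesis unfolding cardV by linarith
  qed
  note stair = staircase_relation[OF fin12 ne12 right left no_gap count n]
  have "card V2 = n" by (rule stair; assumption)
  moreover have "\<exists>v w. bij_betw v {1..n} V1 \<and> bij_betw w {1..n} V2 \<and>
      (\<forall>i\<in>{1..n}. \<forall>j\<in>{1..n}. {v i, w j} \<in> E \<longleftrightarrow> i \<le> j)"
    by (rule stair; assumption)
  then obtain v w where bij: "bij_betw v {1..n} V1" "bij_betw w {1..n} V2"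
    and vw: "\<And>i j. i \<in> {1..n} \<Longrightarrow> j \<in> {1..n} \<Longrightarrow> {v i, w j} \<in> E \<longleftrightarrow> i \<le> j" by blast
  have "E = {{v i, w j} | i j. 1 \<le> i \<and> i \<le> j \<and> j \<le> n}"
  proof
    show "E \<subseteq> {{v i, w j} | i j. 1 \<le> i \<and> i \<le> j \<and> j \<le> n}"
    proof
      fix e assume e: "e \<in> E"
      obtain x y where xy: "x \<in> V1" "y \<in> V2" "e = {x, y}" using edge[OF e] by blast
      then obtain i j where ij: "i \<in> {1..n}" "j \<in> {1..n}" "x = v i" "y = w j"
        using bij unfolding bij_betw_def by blast
      then have "i \<le> j" using vw[of i j] e xy by simp
      then show "e \<in> {{v i, w j} | i j. 1 \<le> i \<and> i \<le> j \<and> j \<le> n}" using ij xy by auto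
    qed
    show "{{v i, w j} | i j. 1 \<le> i \<and> i \<le> j \<and> j \<le> n} \<subseteq> E"
    proof clarify
      fix i j :: nat assume "1 \<le> i" "i \<le> j" "j \<le> n"
      then show "{v i, w j} \<in> E" using vw[of i j] by simp
    qed
  qed
  ultimately show ?thesis using bij by blast
qed

section \<open>Regular sequences for the staircase graph\<close>

text \<open>Merging destroys squarefreeness: several elements of \<open>C\<close> may land on the
  same variable. Divisibility by a merged generator thus becomes a comparison of fibre sizes with
  exponents.\<close>

lemma lookup_push_sqfree:
  assumes "finite C"
  shows "lookup (push \<sigma> (sqfree C)) z = card {u\<in>C. \<sigma> u = z}"
proof -
  have "lookup (push \<sigma> (sqfree C)) z =
      (\<Sum>u\<in>C. if \<sigma> u = z then lookup (sqfree C) u else 0)"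
    by (rule lookup_push_nat) (use assms in \<open>simp_all add: keys_sqfree\<close>)
  also have "\<dots> = (\<Sum>u\<in>C. if \<sigma> u = z then 1 else 0)"
    using assms by (intro sum.cong) (auto simp: lookup_sqfree)
  also have "\<dots> = card {u\<in>C. \<sigma> u = z}"
    using assms by (simp add: sum.If_cases Int_def)
  finally show ?thesis .
qed

lemma push_sqfree_multiples_iff:
  assumes "\<And>C. C \<in> \<C> \<Longrightarrow> finite C"
  shows "t \<in> multiples (push \<sigma> ` sqfree ` \<C>) \<longleftrightarrow>
    (\<exists>C\<in>\<C>. \<forall>z. card {u\<in>C. \<sigma> u = z} \<le> lookup t z)"
  unfolding multiples_iff using assms by (simp add: lookup_push_sqfree)

text \<open>Let \<open>?c\<close> be the size of the fibre over \<open>a\<close>. If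
  \<open>t\<close> has exponent at least \<open>?c\<close> at \<open>a\<close>, more factors
  \<open>a\<close> help no generator, so trading \<open>b\<close> for \<open>a\<close> stays
  outside. Otherwise trading \<open>a\<close> for \<open>b\<close> does: a generator using
  \<open>b\<close> would need the whole fibre over \<open>a\<close>, for which the exponent is too
  small.\<close>

lemma var_diff_regular_block:
  fixes f :: "('v, 'k::field) mpoly"
  assumes V: "finite V" and \<C>: "\<And>C. C \<in> \<C> \<Longrightarrow> C \<subseteq> V" and "a \<noteq> b"
    and b: "\<And>u. u \<in> V \<Longrightarrow> \<sigma> u = b \<Longrightarrow> u = b"
    and block: "\<And>C. C \<in> \<C> \<Longrightarrow> b \<in> C \<Longrightarrow> {u\<in>V. \<sigma> u = a} \<subseteq> C"
    and f: "f \<in> polys V" "(var a - var b) * f \<in> mono_ideal V (multiples (push \<sigma> ` sqfree ` \<C>))"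
  shows "f \<in> mono_ideal V (multiples (push \<sigma> ` sqfree ` \<C>))"
proof (rule var_diff_regular_mono_ideal[OF \<open>a \<noteq> b\<close> f])
  let ?M = "multiples (push \<sigma> ` sqfree ` \<C>)"
  let ?c = "card {u\<in>V. \<sigma> u = a}"
  have fin: "finite C" if "C \<in> \<C>" for C using V \<C>[OF that] by (rule finite_subset[rotated])
  have M: "t \<in> ?M \<longleftrightarrow> (\<exists>C\<in>\<C>. \<forall>z. card {u\<in>C. \<sigma> u = z} \<le> lookup t z)" for t
    by (rule push_sqfree_multiples_iff[OF fin])
  have le: "card {u\<in>C. \<sigma> u = a} \<le> ?c" if "C \<in> \<C>" for C
    using V \<C>[OF that] by (intro card_mono) auto
  have full: "card {u\<in>C. \<sigma> u = a} = ?c" if "C \<in> \<C>" "card {u\<in>C. \<sigma> u = b} \<noteq> 0" for C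
  proof -
    have "{u\<in>C. \<sigma> u = b} \<noteq> {}" using that(2) by (metis card.empty)
    then obtain u where u: "u \<in> C" "\<sigma> u = b" by blast
    then have "b \<in> C" using b[of u] \<C>[OF that(1)] by auto
    then have "{u\<in>C. \<sigma> u = a} = {u\<in>V. \<sigma> u = a}" using block[OF that(1)] \<C>[OF that(1)] by blast
    then show ?thesis by simp
  qed
  fix t assume t: "t \<notin> ?M"
  show "(\<forall>j\<le>lookup t b. t + single a (Suc j) - single b j \<notin> ?M) \<or>
      (\<forall>j\<le>lookup t a. t + single b (Suc j) - single a j \<notin> ?M)"
  proof (cases "?c \<le> lookup t a")
    case True
    have "t + single a (Suc j) - single b j \<notin> ?M" for j
    proof
      assume "t + single a (Suc j) - single b j \<in> ?M"
      then obtain C where C: "C \<in> \<C>" and *: "\<And>z. card {u\<in>C. \<sigma> u = z} \<le>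
          lookup (t + single a (Suc j) - single b j) z"
        unfolding M by blast
      have "card {u\<in>C. \<sigma> u = z} \<le> lookup t z" for z
      proof (cases "z = a")
        case True
        then show ?thesis using le[OF C] \<open>?c \<le> lookup t a\<close> by simp
      next
        case False
        then show ?thesis using *[of z] by (simp add: lookup_add lookup_minus lookup_single)
      qed
      then show False using t C unfolding M by blast
    qed
    then show ?thesis by blast
  next
    case False
    have "t + single b (Suc j) - single a j \<notin> ?M" for j
    proof
      assume "t + single b (Suc j) - single a j \<in> ?M"
      then obtain C where C: "C \<in> \<C>" and *: "\<And>z. card {u\<in>C. \<sigma> u = z} \<le>
          lookup (t + single b (Suc j) - single a j) z"
        unfolding M by blast
      have la: "card {u\<in>C. \<sigma> u = a} \<le> lookup t a"
        using *[of a] \<open>a \<noteq> b\<close> by (simp add: lookup_add lookup_minus lookup_single)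
      have "card {u\<in>C. \<sigma> u = z} \<le> lookup t z" for z
      proof (cases "z = b")
        case True
        have "card {u\<in>C. \<sigma> u = b} = 0"
          using full[OF C] la False by linarith
        then show ?thesis using True by simp
      next
        case zb: False
        then show ?thesis using *[of z] la by (cases "z = a") (simp_all add: lookup_add lookup_minus lookup_single)
      qed
      then show False using t C unfolding M by blast
    qed
    then show ?thesis by blast
  qed
qed

lemma depth_ge_merge:
  fixes a b :: "nat \<Rightarrow> 'v"
  assumes V: "finite V" and \<C>: "\<And>C. C \<in> \<C> \<Longrightarrow> C \<subseteq> V" "{} \<notin> \<C>"
    and abV: "\<And>i. i < r \<Longrightarrow> a i \<in> V \<and> b i \<in> V"
    and disjoint: "\<And>i j. i < r \<Longrightarrow> j < r \<Longrightarrow> a i \<noteq> b j" and inj: "inj_on b {..<r}"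
    and reg: "\<And>i f. i < r \<Longrightarrow> f \<in> polys V \<Longrightarrow>
      (var (a i) - var (b i)) * f \<in> mono_ideal V (multiples (push (merge a b i) ` sqfree ` \<C>)) \<Longrightarrow>
      f \<in> (mono_ideal V (multiples (push (merge a b i) ` sqfree ` \<C>)) :: ('v, 'k::field) mpoly set)"
    and I: "I = (mono_ideal V (multiples (sqfree ` \<C>)) :: ('v, 'k) mpoly set)"
  shows "enat r \<le> depth_quot V I"
proof -
  have fin: "finite C" if "C \<in> \<C>" for C using \<C>(1)[OF that] V by (rule finite_subset)
  have keys: "keys t \<subseteq> V \<and> t \<noteq> 0" if t: "t \<in> sqfree ` \<C>" for t
  proof -
    obtain C where C: "C \<in> \<C>" "t = sqfree C" using t by blast
    then have "keys t = C" using keys_sqfree[OF fin] by simp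
    moreover have "C \<noteq> {}" using C(1) \<C>(2) by blast
    ultimately show ?thesis using \<C>(1)[OF C(1)] by auto
  qed
  have "regular_mod (poly_ring V) I (map (\<lambda>i. var (a i) - var (b i)) [0..<r])"
    unfolding I by (rule regular_mod_merge[OF V _ _ abV disjoint inj reg]) (use keys in auto)
  moreover have "set (map (\<lambda>i. var (a i) - var (b i)) [0..<r]) \<subseteq> irrelevant_ideal V"
    using abV by (auto intro!: var_diff_irrelevant)
  moreover have "ideal I (poly_ring V)"
    unfolding I by (rule ideal_mono_ideal[OF up_closed_multiples])
  ultimately have "enat (length (map (\<lambda>i. var (a i) - var (b i) :: ('v, 'k) mpoly) [0..<r])) \<le>
      depth_quot V I"
    by (intro depth_ge_regular_mod)
  then show ?thesis by simp
qed

locale staircase =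
  fixes n :: nat and v w :: "nat \<Rightarrow> 'v" and V1 V2 V :: "'v set" and E :: "'v set set"
  assumes n: "n \<ge> 1"
    and bv: "bij_betw v {1..n} V1" and bw: "bij_betw w {1..n} V2"
    and V: "V = V1 \<union> V2" "V1 \<inter> V2 = {}"
    and E: "E = {{v i, w j} | i j. 1 \<le> i \<and> i \<le> j \<and> j \<le> n}"
begin

lemma v_eq [simp]: "i \<in> {1..n} \<Longrightarrow> j \<in> {1..n} \<Longrightarrow> v i = v j \<longleftrightarrow> i = j"
  by (rule inj_on_eq_iff[OF bij_betw_imp_inj_on[OF bv]])

lemma w_eq [simp]: "i \<in> {1..n} \<Longrightarrow> j \<in> {1..n} \<Longrightarrow> w i = w j \<longleftrightarrow> i = j"
  by (rule inj_on_eq_iff[OF bij_betw_imp_inj_on[OF bw]])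

lemma v_in [simp]: "i \<in> {1..n} \<Longrightarrow> v i \<in> V1" and w_in [simp]: "i \<in> {1..n} \<Longrightarrow> w i \<in> V2"
  using bv bw by (auto simp: bij_betw_def)

lemma V1_eq: "V1 = v ` {1..n}" and V2_eq: "V2 = w ` {1..n}"
  using bv bw by (auto simp: bij_betw_def)

lemma v_neq_w [simp]: "i \<in> {1..n} \<Longrightarrow> j \<in> {1..n} \<Longrightarrow> v i \<noteq> w j"
  using v_in[of i] w_in[of j] V(2) by (metis disjoint_iff)

lemma v_notin_w_image: "i \<in> {1..n} \<Longrightarrow> A \<subseteq> {1..n} \<Longrightarrow> v i \<notin> w ` A"
  using v_in[of i] image_mono[of A "{1..n}" w] V(2) unfolding V2_eq by blast

lemma w_notin_v_image: "i \<in> {1..n} \<Longrightarrow> A \<subseteq> {1..n} \<Longrightarrow> w i \<notin> v ` A"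
  using w_in[of i] image_mono[of A "{1..n}" v] V(2) unfolding V1_eq by blast

lemma finV: "finite V" "card V = 2 * n"
proof -
  have "card V1 = n" "card V2 = n" "finite V1" "finite V2"
    using bij_betw_same_card[OF bv] bij_betw_same_card[OF bw] by (simp_all add: V1_eq V2_eq)
  then show "finite V" "card V = 2 * n" using V by (simp_all add: card_Un_disjoint)
qed

lemma V_cases:
  assumes "x \<in> V"
  obtains i where "i \<in> {1..n}" "x = v i" | i where "i \<in> {1..n}" "x = w i"
  using assms V V1_eq V2_eq by auto

lemma edgeI: "1 \<le> i \<Longrightarrow> i \<le> j \<Longrightarrow> j \<le> n \<Longrightarrow> {v i, w j} \<in> E"
  unfolding E by blast

lemma edgeE:
  assumes "e \<in> E"
  obtains i j where "i \<in> {1..n}" "j \<in> {1..n}" "i \<le> j" "e = {v i, w j}"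
  using assms unfolding E by auto

lemma simple: "simple_graph V E"
  unfolding simple_graph_def
proof (intro ballI conjI)
  fix e assume "e \<in> E"
  then obtain i j where "i \<in> {1..n}" "j \<in> {1..n}" "e = {v i, w j}" by (rule edgeE)
  then show "e \<subseteq> V" "card e = 2" by (simp_all add: V)
qed

lemma edge_sub: "e \<in> E \<Longrightarrow> e \<subseteq> V"
  using simple by (auto simp: simple_graph_def)

text \<open>Step \<open>i\<close> merges \<open>w (Suc i)\<close> into \<open>v (Suc i)\<close>. The
  order of the indices makes it regular: if \<open>t\<close> enters the ideal through
  \<open>{v (Suc i), w l}\<close> in one direction and through \<open>{v k, w (Suc i)}\<close> in
  the other, then \<open>k \<le> Suc i \<le> l\<close>, so the edge \<open>{v k, w l}\<close>
  already divides \<open>t\<close>.\<close>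

lemma depth_edge_ideal_ge:
  "enat n \<le> depth_quot V (edge_ideal V E :: ('v, 'k::field) mpoly set)"
proof -
  let ?I = "edge_ideal V E :: ('v, 'k) mpoly set"
  let ?a = "\<lambda>i. v (Suc i)" and ?b = "\<lambda>i. w (Suc i)"
  define \<sigma> where "\<sigma> = merge ?a ?b"
  have disjoint: "?a i \<noteq> ?b j" if "i < n" "j < n" for i j using that by (intro v_neq_w) auto
  have inj: "inj_on ?b {..<n}"
  proof (rule inj_onI)
    fix i j assume "i \<in> {..<n}" "j \<in> {..<n}" "?b i = ?b j"
    then show "i = j" using w_eq[of "Suc i" "Suc j"] by simp
  qed
  have edge_fin: "finite e" if "e \<in> E" for e using that by (auto elim: edgeE)
  have I: "?I = mono_ideal V (multiples (sqfree ` E))"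
    by (simp add: edge_ideal_eq[OF finV(1) simple] multiples_sqfree[OF edge_fin])
  have "{} \<notin> E" by (auto elim: edgeE)
  show ?thesis
  proof (rule depth_ge_merge[where a = ?a and b = ?b, OF finV(1) edge_sub \<open>{} \<notin> E\<close> _ disjoint inj _ I], unfold \<sigma>_def[symmetric])
    show "v (Suc i) \<in> V \<and> w (Suc i) \<in> V" if "i < n" for i
      using that V v_in[of "Suc i"] w_in[of "Suc i"] by auto
    fix i and f :: "('v, 'k) mpoly"
    let ?M = "multiples (push (\<sigma> i) ` sqfree ` E)"
    let ?x = "v (Suc i)" and ?y = "w (Suc i)"
    let ?cnt = "\<lambda>e z. card {u\<in>e. \<sigma> i u = z}"
    assume i: "i < n" and f: "f \<in> polys V" "(var ?x - var ?y) * f \<in> mono_ideal V ?M"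
    have Si: "Suc i \<in> {1..n}" using i by simp
    have xy: "?x \<noteq> ?y" by (rule v_neq_w[OF Si Si])
    have M: "t \<in> ?M \<longleftrightarrow> (\<exists>e\<in>E. \<forall>z. ?cnt e z \<le> lookup t z)" for t
      by (rule push_sqfree_multiples_iff[OF edge_fin])
    have cases: "u = z \<or> (\<exists>j<i. u = ?b j \<and> z = ?a j)" if "\<sigma> i u = z" for u z
      by (rule merge_eq_cases[OF disjoint inj]) (use i that in \<open>simp_all add: \<sigma>_def\<close>)
    have \<sigma>v: "\<sigma> i (v j) = v j" if "j \<in> {1..n}" for j
    proof -
      have "v j \<noteq> ?b k" if "k < i" for k using \<open>j \<in> {1..n}\<close> that i by (intro v_neq_w) auto
      then show ?thesis unfolding \<sigma>_def by (intro merge_other) auto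
    qed
    have \<sigma>w: "\<sigma> i (w j) = w j" if "j \<in> {Suc i..n}" for j
    proof -
      have "w j \<noteq> ?b k" if "k < i" for k using w_eq[of j "Suc k"] \<open>j \<in> {Suc i..n}\<close> that by simp
      then show ?thesis unfolding \<sigma>_def by (intro merge_other) auto
    qed
    \<comment> \<open>Earlier steps merged nothing into \<open>?x\<close> or \<open>?y\<close>, so
      every edge uses each of them with exponent at most 1.\<close>
    have pre: "u = z" if "\<sigma> i u = z" "z = ?x \<or> z = ?y" for u z
    proof -
      have "z \<noteq> ?a j" if "j < i" for j
        using \<open>z = ?x \<or> z = ?y\<close> v_eq[OF Si, of "Suc j"] v_neq_w[of "Suc j" "Suc i"] that i by auto
      then show ?thesis using cases[OF that(1)] by blast
    qed
    have cnt1: "?cnt e z \<le> (if z \<in> e then 1 else 0)" if "e \<in> E" "z = ?x \<or> z = ?y" for e z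
    proof -
      have "{u\<in>e. \<sigma> i u = z} \<subseteq> {u\<in>e. u = z}"
        using pre[OF _ that(2)] by blast
      also have "\<dots> = (if z \<in> e then {z} else {})" by auto
      finally have "{u\<in>e. \<sigma> i u = z} \<subseteq> (if z \<in> e then {z} else {})" .
      then have "?cnt e z \<le> card (if z \<in> e then {z} else {})" by (intro card_mono) auto
      then show ?thesis by (auto split: if_splits)
    qed
    have cnt2: "?cnt {p, q} z \<le> lookup t z"
      if "\<sigma> i p \<noteq> \<sigma> i q" "lookup t (\<sigma> i p) \<ge> 1" "lookup t (\<sigma> i q) \<ge> 1" for p q z t
    proof -
      have "{u\<in>{p, q}. \<sigma> i u = z} \<subseteq> (if z = \<sigma> i p then {p} else if z = \<sigma> i q then {q} else {})"
        using that(1) by auto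
      then have "?cnt {p, q} z \<le> card (if z = \<sigma> i p then {p} else if z = \<sigma> i q then {q} else {})"
        by (intro card_mono) auto
      also have "\<dots> \<le> lookup t z" using that(2,3) by auto
      finally show ?thesis .
    qed
    have exy: "{?x, ?y} \<in> E" using i by (intro edgeI) auto
    have \<sigma>xy: "\<sigma> i ?x = ?x" "\<sigma> i ?y = ?y" using \<sigma>v[OF Si] \<sigma>w[of "Suc i"] i by simp_all
    show "f \<in> mono_ideal V ?M"
    proof (rule var_diff_regular_mono_ideal[OF xy f])
      fix t assume t: "t \<notin> ?M"
      have tM: "\<exists>z. lookup t z < ?cnt e z" if "e \<in> E" for e
        using t that unfolding M by (meson not_le)
      have txy: "lookup t ?x = 0 \<or> lookup t ?y = 0"
      proof (rule ccontr)
        assume "\<not> ?thesis"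
        then have "?cnt {?x, ?y} z \<le> lookup t z" for z
          using \<sigma>xy xy by (intro cnt2) auto
        then show False using tM[OF exy] by (simp add: not_le[symmetric])
      qed
      have shift: "lookup t z = 0 \<and> z \<in> e \<and>
          (\<forall>z'. z' \<noteq> z \<longrightarrow> ?cnt e z' \<le> lookup t z')"
        if z: "z = ?x \<or> z = ?y" and e: "e \<in> E" and le: "\<And>z'. ?cnt e z' \<le> lookup (t + single z 1) z'" for z e
      proof -
        have other: "?cnt e z' \<le> lookup t z'" if "z' \<noteq> z" for z'
          using le[of z'] that by (simp add: lookup_add lookup_single)
        then have "lookup t z < ?cnt e z" using tM[OF e] by (metis not_le)
        then show ?thesis using cnt1[OF e z] other by (auto split: if_splits)
      qed
      have both_zero: "t + single ?x 1 \<notin> ?M \<or> t + single ?y 1 \<notin> ?M"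
        if t0: "lookup t ?x = 0" "lookup t ?y = 0"
      proof (rule ccontr)
        assume neg: "\<not> ?thesis"
        obtain e1 where e1: "e1 \<in> E" "\<And>z. ?cnt e1 z \<le> lookup (t + single ?x 1) z"
          using neg unfolding M by blast
        obtain e2 where e2: "e2 \<in> E" "\<And>z. ?cnt e2 z \<le> lookup (t + single ?y 1) z"
          using neg unfolding M by blast
        have s1: "?x \<in> e1" "\<And>z. z \<noteq> ?x \<Longrightarrow> ?cnt e1 z \<le> lookup t z"
          using shift[OF _ e1] by blast+
        have s2: "?y \<in> e2" "\<And>z. z \<noteq> ?y \<Longrightarrow> ?cnt e2 z \<le> lookup t z"
          using shift[OF _ e2] by blast+
        obtain k l where kl: "k \<in> {1..n}" "l \<in> {1..n}" "k \<le> l" "e1 = {v k, w l}" using e1(1) by (rule edgeE)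
        have "k = Suc i" using s1(1) kl v_eq[OF Si kl(1)] v_neq_w[OF Si kl(2)] by auto
        obtain k' l' where kl': "k' \<in> {1..n}" "l' \<in> {1..n}" "k' \<le> l'" "e2 = {v k', w l'}" using e2(1) by (rule edgeE)
        have "l' = Suc i" using s2(1) kl' w_eq[OF Si kl'(2)] v_neq_w[OF kl'(1) Si] by auto
        have pos: "1 \<le> ?cnt e (\<sigma> i u)" if "e \<in> E" "u \<in> e" for e u
          using that edge_fin[OF that(1)] card_gt_0_iff[of "{u'\<in>e. \<sigma> i u' = \<sigma> i u}"] by (auto simp: Suc_le_eq)
        have \<sigma>l: "\<sigma> i (w l) = w l" using kl(2,3) \<open>k = Suc i\<close> by (intro \<sigma>w) simp
        have \<sigma>k: "\<sigma> i (v k') = v k'" by (rule \<sigma>v[OF kl'(1)])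
        have wl: "lookup t (w l) \<ge> 1"
          using s1(2)[of "w l"] pos[OF e1(1), of "w l"] v_neq_w[OF Si kl(2)] kl(4) unfolding \<sigma>l by auto
        have vk: "lookup t (v k') \<ge> 1"
          using s2(2)[of "v k'"] pos[OF e2(1), of "v k'"] v_neq_w[OF kl'(1) Si] kl'(4) unfolding \<sigma>k by auto
        have "{v k', w l} \<in> E" using kl kl' \<open>k = Suc i\<close> \<open>l' = Suc i\<close> by (intro edgeI) auto
        moreover have "?cnt {v k', w l} z \<le> lookup t z" for z
          using wl vk v_neq_w[OF kl'(1) kl(2)] by (intro cnt2) (simp_all only: \<sigma>l \<sigma>k simp_thms)
        ultimately show False using tM by (metis not_le)
      qed
      have nonzero: "t + single z 1 \<notin> ?M" if "lookup t z \<noteq> 0" "z = ?x \<or> z = ?y" for z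
      proof
        assume "t + single z 1 \<in> ?M"
        then obtain e where "e \<in> E" "\<And>z'. ?cnt e z' \<le> lookup (t + single z 1) z'"
          unfolding M by blast
        from shift[OF that(2) this] that(1) show False by blast
      qed
      \<comment> \<open>The variable that is traded away has exponent zero, so in the chosen
        direction only \<open>j = 0\<close> is to be checked.\<close>
      consider "lookup t ?y = 0" "t + single ?x 1 \<notin> ?M"
        | "lookup t ?x = 0" "t + single ?y 1 \<notin> ?M"
        using txy both_zero nonzero[of ?x] nonzero[of ?y] by argo
      then show "(\<forall>j\<le>lookup t ?y. t + single ?x (Suc j) - single ?y j \<notin> ?M) \<or>
          (\<forall>j\<le>lookup t ?x. t + single ?y (Suc j) - single ?x j \<notin> ?M)"
        by cases simp_all
    qed
  qed
qed

text \<open>The generators are the minimal vertex covers. For a given cover take the largest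
  \<open>i\<close> such that it contains \<open>v 1\<close>, ..., \<open>v i\<close>; if
  \<open>i < n\<close>, it misses \<open>v (Suc i)\<close> and must contain all its neighbours
  \<open>w (Suc i)\<close>, ..., \<open>w n\<close>.\<close>

lemma cover_ideal_eq:
  "cover_ideal V E = mono_ideal V (multiples (sqfree ` (\<lambda>i. v ` {1..i} \<union> w ` {Suc i..n}) ` {0..n}))"
proof -
  let ?\<C> = "(\<lambda>i. v ` {1..i} \<union> w ` {Suc i..n}) ` {0..n}"
  have M: "multiples (sqfree ` ?\<C>) = {t. \<exists>C\<in>?\<C>. C \<subseteq> keys t}"
    by (rule multiples_sqfree) auto
  show ?thesis
    unfolding cover_ideal_def M
  proof (rule mono_ideal_cong)
    fix t :: "'v \<Rightarrow>\<^sub>0 nat"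
    let ?K = "keys t"
    have "(\<forall>e\<in>E. e \<inter> ?K \<noteq> {}) \<longleftrightarrow> (\<exists>i\<in>{0..n}. v ` {1..i} \<union> w ` {Suc i..n} \<subseteq> ?K)"
    proof
      assume cov: "\<forall>e\<in>E. e \<inter> ?K \<noteq> {}"
      define i where "i = Max {i\<in>{0..n}. v ` {1..i} \<subseteq> ?K}"
      have "0 \<in> {i\<in>{0..n}. v ` {1..i} \<subseteq> ?K}" by simp
      then have "i \<in> {i\<in>{0..n}. v ` {1..i} \<subseteq> ?K}" unfolding i_def by (intro Max_in) auto
      then have i: "i \<le> n" "v ` {1..i} \<subseteq> ?K" by auto
      have "w l \<in> ?K" if l: "l \<in> {Suc i..n}" for l
      proof -
        have "v (Suc i) \<notin> ?K"
        proof
          assume "v (Suc i) \<in> ?K"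
          then have "v ` {1..Suc i} \<subseteq> ?K" using i(2) by (auto simp: atLeastAtMostSuc_conv)
          then have "Suc i \<in> {i\<in>{0..n}. v ` {1..i} \<subseteq> ?K}" using l by auto
          then have "Suc i \<le> Max {i\<in>{0..n}. v ` {1..i} \<subseteq> ?K}" by (intro Max_ge) auto
          then show False by (simp add: i_def)
        qed
        moreover have "{v (Suc i), w l} \<in> E" using l by (intro edgeI) auto
        ultimately show ?thesis using bspec[OF cov, of "{v (Suc i), w l}"] by auto
      qed
      then show "\<exists>i\<in>{0..n}. v ` {1..i} \<union> w ` {Suc i..n} \<subseteq> ?K" using i by (intro bexI[of _ i]) auto
    next
      assume "\<exists>i\<in>{0..n}. v ` {1..i} \<union> w ` {Suc i..n} \<subseteq> ?K"
      then obtain i where i: "v ` {1..i} \<union> w ` {Suc i..n} \<subseteq> ?K" by blast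
      show "\<forall>e\<in>E. e \<inter> ?K \<noteq> {}"
      proof
        fix e assume "e \<in> E"
        then obtain k l where kl: "k \<in> {1..n}" "l \<in> {1..n}" "k \<le> l" "e = {v k, w l}" by (rule edgeE)
        show "e \<inter> ?K \<noteq> {}"
        proof (cases "k \<le> i")
          case True
          then have "v k \<in> ?K" using i kl by auto
          then show ?thesis using kl by blast
        next
          case False
          then have "w l \<in> ?K" using i kl by auto
          then show ?thesis using kl by blast
        qed
      qed
    qed
    then show "t \<in> {t. \<forall>e\<in>E. e \<inter> keys t \<noteq> {}} \<longleftrightarrow>
        t \<in> {t. \<exists>C\<in>?\<C>. C \<subseteq> keys t}" by simp
  qed
qed

text \<open>A generating cover with \<open>v k\<close> contains \<open>v 1\<close>, ...,
  \<open>v k\<close>, and one with \<open>w k\<close> contains \<open>w k\<close>, ...,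
  \<open>w n\<close>. The merging follows these blocks: a cover that uses the variable to be merged
  next contains everything already merged into its partner, as \<open>var_diff_regular_block\<close>
  requires.\<close>

lemma depth_cover_ideal_ge:
  "enat (2 * n - 2) \<le> depth_quot V (cover_ideal V E :: ('v, 'k::field) mpoly set)"
proof -
  let ?J = "cover_ideal V E :: ('v, 'k) mpoly set"
  define \<C> where "\<C> = (\<lambda>i. v ` {1..i} \<union> w ` {Suc i..n}) ` {0..n}"
  let ?r = "2 * n - 2"
  \<comment> \<open>The indices below \<open>n - 1\<close> merge \<open>v 2\<close>, ...,
    \<open>v n\<close> into \<open>v 1\<close>; the remaining \<open>n - 1\<close> indices merge
    \<open>w (n - 1)\<close>, ..., \<open>w 1\<close>, in this order, into
    \<open>w n\<close>.\<close>
  define a where "a i = (if Suc i < n then v 1 else w n)" for i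
  define b where "b i = (if Suc i < n then v (i + 2) else w (?r - i))" for i
  have one_n: "1 \<in> {1..n}" "n \<in> {1..n}" using n by auto
  have early: "a i = v 1" "b i = v (i + 2)" "i + 2 \<in> {1..n}" if "Suc i < n" for i
    using that by (auto simp: a_def b_def)
  have late: "a i = w n" "b i = w (?r - i)" "?r - i \<in> {1..n}" "?r - i < n" if "\<not> Suc i < n" "i < ?r" for i
    using that by (auto simp: a_def b_def)
  have CV: "C \<subseteq> V" if C: "C \<in> \<C>" for C
    using C V1_eq V2_eq V by (auto simp: \<C>_def)
  have "{} \<notin> \<C>"
  proof
    assume "{} \<in> \<C>"
    then obtain i where "i \<le> n" "v ` {1..i} \<union> w ` {Suc i..n} = {}" by (auto simp: \<C>_def)
    then show False using n by (cases i) auto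
  qed
  have disjoint: "a i \<noteq> b j" if "i < ?r" "j < ?r" for i j
  proof (cases "Suc i < n"; cases "Suc j < n")
    assume "Suc i < n" "Suc j < n"
    then show ?thesis using early[of i] early[of j] v_eq[OF one_n(1), of "j + 2"] by simp
  next
    assume "Suc i < n" "\<not> Suc j < n"
    then show ?thesis using early[of i] late[of j] that v_neq_w[OF one_n(1), of "?r - j"] by simp
  next
    assume "\<not> Suc i < n" "Suc j < n"
    then show ?thesis using late[of i] early[of j] that v_neq_w[OF _ one_n(2), of "j + 2"] by metis
  next
    assume "\<not> Suc i < n" "\<not> Suc j < n"
    then show ?thesis using late[of i] late[of j] that w_eq[OF one_n(2), of "?r - j"] by simp
  qed
  have inj: "inj_on b {..<?r}"
  proof (rule inj_onI)
    fix i j assume ij: "i \<in> {..<?r}" "j \<in> {..<?r}" "b i = b j"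
    show "i = j"
    proof (cases "Suc i < n"; cases "Suc j < n")
      assume h: "Suc i < n" "Suc j < n"
      then have "v (i + 2) = v (j + 2)" using ij(3) early(2) by simp
      then show ?thesis using v_eq[OF early(3)[OF h(1)] early(3)[OF h(2)]] by simp
    next
      assume h: "Suc i < n" "\<not> Suc j < n"
      then have "v (i + 2) = w (?r - j)" using ij(2,3) early(2)[of i] late(2)[of j] by simp
      then show ?thesis using v_neq_w[OF early(3)[OF h(1)] late(3)[OF h(2)]] ij(2) by simp
    next
      assume h: "\<not> Suc i < n" "Suc j < n"
      then have "v (j + 2) = w (?r - i)" using ij(1,3) early(2)[of j] late(2)[of i] by simp
      then show ?thesis using v_neq_w[OF early(3)[OF h(2)] late(3)[OF h(1)]] ij(1) by simp
    next
      assume h: "\<not> Suc i < n" "\<not> Suc j < n"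
      then have "w (?r - i) = w (?r - j)" using ij late(2)[of i] late(2)[of j] by simp
      then have "?r - i = ?r - j" using w_eq[OF late(3)[OF h(1)] late(3)[OF h(2)]] ij(1,2) by simp
      then show ?thesis using ij(1,2) by simp
    qed
  qed
  have J: "?J = mono_ideal V (multiples (sqfree ` \<C>))" by (simp add: cover_ideal_eq \<C>_def)
  show ?thesis
  proof (rule depth_ge_merge[OF finV(1) CV \<open>{} \<notin> \<C>\<close> _ disjoint inj _ J])
    show "a i \<in> V \<and> b i \<in> V" if "i < ?r" for i
      using early[of i] late[of i] that v_in[OF one_n(1)] w_in[OF one_n(2)] v_in[of "i + 2"] w_in[of "?r - i"] V(1)
      by (cases "Suc i < n") auto
    fix i and f :: "('v, 'k) mpoly"
    assume i: "i < ?r" and f: "f \<in> polys V"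
      "(var (a i) - var (b i)) * f \<in> mono_ideal V (multiples (push (merge a b i) ` sqfree ` \<C>))"
    have cases: "u = z \<or> (\<exists>j<i. u = b j \<and> z = a j)" if "merge a b i u = z" for u z
      by (rule merge_eq_cases[OF disjoint inj]) (use i that in simp_all)
    show "f \<in> mono_ideal V (multiples (push (merge a b i) ` sqfree ` \<C>))"
    proof (rule var_diff_regular_block[OF finV(1) CV disjoint[OF i i] _ _ f])
      show "u = b i" if "merge a b i u = b i" for u
      proof -
        have "b i \<noteq> a j" if "j < i" for j using disjoint[of j i] that i by simp
        then show ?thesis using cases[OF that] by blast
      qed
      show "{u\<in>V. merge a b i u = a i} \<subseteq> C" if C: "C \<in> \<C>" "b i \<in> C" for C
      proof
        obtain c where c: "c \<le> n" "C = v ` {1..c} \<union> w ` {Suc c..n}" using C(1) by (auto simp: \<C>_def)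
        have vC: "v k \<in> C \<longleftrightarrow> k \<le> c" if k: "k \<in> {1..n}" for k
        proof
          assume "v k \<in> C"
          moreover have "v k \<notin> w ` {Suc c..n}" by (rule v_notin_w_image[OF k]) auto
          ultimately obtain l where "l \<in> {1..c}" "v k = v l" using c(2) by blast
          then show "k \<le> c" using v_eq[OF k, of l] c(1) by simp
        qed (use k c(2) in auto)
        have wC: "w k \<in> C \<longleftrightarrow> c < k" if k: "k \<in> {1..n}" for k
        proof
          assume "w k \<in> C"
          moreover have "w k \<notin> v ` {1..c}" by (rule w_notin_v_image[OF k]) (use c(1) in auto)
          ultimately obtain l where "l \<in> {Suc c..n}" "w k = w l" using c(2) by blast
          then show "c < k" using w_eq[OF k, of l] by simp
        qed (use k c(2) in auto)
        fix u assume "u \<in> {u\<in>V. merge a b i u = a i}"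
        then have u: "u = a i \<or> (\<exists>j<i. u = b j \<and> a i = a j)" using cases by blast
        show "u \<in> C"
        proof (cases "Suc i < n")
          case True
          have "i + 2 \<le> c" using C(2) early[OF True] vC[of "i + 2"] by simp
          moreover have "b j \<in> C" if "j < i" for j using early[of j] that True vC[of "j + 2"] \<open>i + 2 \<le> c\<close> by simp
          moreover have "a i \<in> C" using early[OF True] vC[OF one_n(1)] \<open>i + 2 \<le> c\<close> by simp
          ultimately show ?thesis using u by blast
        next
          case False
          have l: "c < ?r - i" using C(2) late[OF False i] wC[of "?r - i"] by simp
          have "b j \<in> C" if "j < i" "a i = a j" for j
          proof -
            have "\<not> Suc j < n" using early(1)[of j] late(1)[OF False i] that(2) v_neq_w[OF one_n] by auto
            then show ?thesis using late[of j] that(1) i wC[of "?r - j"] l by simp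
          qed
          moreover have "a i \<in> C" using late[OF False i] wC[OF one_n(2)] l by simp
          ultimately show ?thesis using u by blast
        qed
      qed
    qed
  qed
qed

theorem bi_cohen_macaulay: "bi_cohen_macaulay TYPE('k::field) V E"
proof -
  obtain ix where "koszul V ix" using koszul_exists[OF finV(1)] by blast
  then interpret koszul V ix .
  let ?S = "poly_ring V :: ('v, 'k) mpoly ring"
  let ?I = "edge_ideal V E :: ('v, 'k) mpoly set" and ?J = "cover_ideal V E :: ('v, 'k) mpoly set"
  have cards: "card V1 = n" "card V2 = n"
    using bij_betw_same_card[OF bv] bij_betw_same_card[OF bw] by simp_all
  have I: "ideal ?I ?S" by (rule ideal_edge_ideal[OF finV(1) simple])
  \<comment> \<open>The star joining \<open>v 1\<close> to all of \<open>V2\<close> gives degree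
    \<open>1 + n - 1\<close>, so the depth is at most \<open>2 * n - n\<close>.\<close>
  have "koszul_class ?I (card {v 1} + card V2 - 1)"
  proof (rule koszul_class_edge_ideal[OF simple])
    have "w 1 \<in> V2" using n by (intro w_in) auto
    then show "V2 \<noteq> {}" by blast
    show "{x, y} \<in> E" if "x \<in> {v 1}" "y \<in> V2" for x y
    proof -
      obtain j where "j \<in> {1..n}" "y = w j" using \<open>y \<in> V2\<close> V2_eq by blast
      then show ?thesis using that(1) edgeI[of 1 j] by simp
    qed
  qed simp
  from depth_le_koszul_class[OF I this]
  have dI: "depth_quot V ?I \<le> enat n"
    using cards finV(2) by simp
  have "independent_set E V1"
    unfolding independent_set_def
  proof (intro ballI notI)
    fix e assume "e \<in> E" "e \<subseteq> V1"
    obtain i j where "i \<in> {1..n}" "j \<in> {1..n}" "i \<le> j" "e = {v i, w j}" using \<open>e \<in> E\<close> by (rule edgeE)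
    then show False using \<open>e \<subseteq> V1\<close> w_in[of j] V(2) by auto
  qed
  then have kI1: "enat n \<le> krull_dim (?S Quot ?I)"
    using krull_dim_edge_ideal_ge[OF finV(1) simple, of V1] V cards by auto
  have kI2: "krull_dim (?S Quot ?I) \<le> enat n"
  proof (rule krull_dim_edge_ideal_le[OF finV(1) simple])
    fix A assume A: "A \<subseteq> V" "independent_set E A"
    \<comment> \<open>The edges \<open>{v i, w i}\<close> form a perfect matching, so an independent
      set takes at most one vertex for each index.\<close>
    let ?I = "{i\<in>{1..n}. v i \<in> A}" and ?J = "{i\<in>{1..n}. w i \<in> A}"
    have "A \<subseteq> v ` ?I \<union> w ` ?J"
    proof
      fix x assume "x \<in> A"
      then show "x \<in> v ` ?I \<union> w ` ?J" using V_cases[of x] A(1) by blast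
    qed
    then have "card A \<le> card (v ` ?I \<union> w ` ?J)" by (intro card_mono) auto
    also have "\<dots> \<le> card ?I + card ?J"
      using card_Un_le[of "v ` ?I" "w ` ?J"] card_image_le[of ?I v] card_image_le[of ?J w] by simp
    also have "\<dots> = card (?I \<union> ?J)"
    proof (rule card_Un_disjoint[symmetric])
      have "\<not> (v i \<in> A \<and> w i \<in> A)" if "i \<in> {1..n}" for i
        using A(2) edgeI[of i i] that by (auto simp: independent_set_def)
      then show "?I \<inter> ?J = {}" by blast
    qed auto
    also have "\<dots> \<le> card {1..n}" by (intro card_mono) auto
    finally have "card A \<le> card {1..n}" .
    then show "card A \<le> n" by simp
  qed
  have e: "{v 1, w 1} \<in> E" using n by (intro edgeI) auto
  have "depth_quot V ?J \<le> enat (card V - 2)"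
    by (rule depth_le_koszul_class[OF ideal_cover_ideal koszul_class_cover_ideal_edge[OF simple e]])
  moreover have "krull_dim (?S Quot ?J) = enat (card V - 2)"
    by (intro antisym krull_dim_cover_ideal_le[OF finV(1) simple] krull_dim_cover_ideal_ge[OF finV(1) simple e])
  moreover have "enat (card V - 2) \<le> depth_quot V ?J"
    unfolding finV(2) by (rule depth_cover_ideal_ge)
  ultimately have "cohen_macaulay_ideal V ?J"
    unfolding cohen_macaulay_ideal_def by (metis antisym)
  moreover have "cohen_macaulay_ideal V ?I"
    unfolding cohen_macaulay_ideal_def
    using dI depth_edge_ideal_ge[where 'k = 'k] kI1 kI2 by (metis antisym)
  ultimately show ?thesis
    unfolding bi_cohen_macaulay_def alexander_dual_edge_ideal[OF finV(1) simple] by simp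
qed

end

theorem theorem2p1:
  fixes V V1 V2 :: "'v set" and E :: "'v set set" and n m :: nat
  assumes "finite V"
    and "simple_graph V E"
    and "connected_graph V E"
    and "no_isolated_vertices V E"
    and "bipartition V E V1 V2"
    and "card V1 = n" and "card V2 = m"
  shows "bi_cohen_macaulay TYPE('k::field) V E \<longleftrightarrow>
    (n = m \<and> (\<exists>v w :: nat \<Rightarrow> 'v.
       bij_betw v {1..n} V1 \<and> bij_betw w {1..n} V2 \<and>
       E = {{v i, w j} | i j. 1 \<le> i \<and> i \<le> j \<and> j \<le> n}))"
    (is "?L \<longleftrightarrow> ?R")
proof
  have ne: "V \<noteq> {}" using assms(3) by (simp add: connected_graph_def)
  {
    assume ?L
    from staircase_if_bi_cohen_macaulay[OF assms(1,2) ne assms(4,5) this assms(6)[symmetric]]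
    show ?R using assms(7) by simp
  next
    assume ?R
    then obtain v w where vw: "bij_betw v {1..n} V1" "bij_betw w {1..n} V2"
      "E = {{v i, w j} | i j. 1 \<le> i \<and> i \<le> j \<and> j \<le> n}" and "n = m" by blast
    have V: "V = V1 \<union> V2" "V1 \<inter> V2 = {}" using assms(5) by (simp_all add: bipartition_def)
    then have "V1 \<noteq> {} \<or> V2 \<noteq> {}" "finite V1" "finite V2" using ne assms(1) by auto
    then have "n \<ge> 1" using assms(6,7) \<open>n = m\<close> by (metis One_nat_def Suc_leI card_gt_0_iff)
    then interpret staircase n v w V1 V2 V E using vw V by unfold_locales
    show ?L by (rule bi_cohen_macaulay)
  }
qed

end
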